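(* Assume the setting below, with $r\ge2$, $\chi\ge1$, $0<s\le3/2$, $h=\max_ih_i\le\min(\hat h_0,\hat h_1,0.2)$, and $H=H_{r+1}$ satisfying $Hh^r<1$. Then, with $R(\mathbf{L}_{s,\nu})$ the spectral radius of $\mathbf{L}_{s,\nu}$, $$\big[(1+Hh^r)^{-1}R(\mathbf{L}_{s,\nu})\big]^{1/\nu}\le\lambda_s\le\big[(1-Hh^r)^{-1}R(\mathbf{L}_{s,\nu})\big]^{1/\nu}.$$
   Context: Setting. $\mathcal{B}$ is a finite set of distinct reals, $\gamma=\min\mathcal{B}\ge1$, $\Gamma=\max\mathcal{B}>\gamma$, $\theta_\beta(x)=1/(x+\beta)$. $\mathfrak{a}_0=0$, $\mathfrak{b}_0=1/\gamma$, $\mathfrak{a}_{k+1}=\theta_\Gamma(\mathfrak{b}_k)$, $\mathfrak{b}_{k+1}=\theta_\gamma(\mathfrak{a}_k)$; their limits are $\mathfrak{a}_\infty=-\gamma/2+\sqrt{(\gamma/2)^2+\gamma/\Gamma}$, $\mathfrak{b}_\infty=-\Gamma/2+\sqrt{(\Gamma/2)^2+\Gamma/\gamma}$. $S=[\mathfrak{a}_\infty,\mathfrak{b}_\infty]$, $\chi=2\mathfrak{a}_\infty+\gamma$. For $s>0$, $(L_sf)(x)=\sum_{\beta\in\mathcal{B}}|\theta_\beta'(x)|^sf(\theta_\beta(x))$ on $C(S)$, $\lambda_s$ its spectral radius. For $\nu\ge1$, $\Omega_\nu=\mathcal{B}^\nu$, $\theta_\omega=\theta_{\beta_1}\circ\cdots\circ\theta_{\beta_\nu}$,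 $g_\omega=|\theta_\omega'|$. Parameters. $\eta(r)=\tfrac12$ ($r$ even), $\tfrac12[1+\tan(\pi/(2r+2))]$ ($r$ odd); $\psi(r)=\tfrac2\pi\ln(r+1)+\tfrac34$. $\tilde B_0=1$, $\tilde B_1=\gamma$, $\tilde B_{j+1}=\tilde B_{j-1}+\gamma\tilde B_j$; $c(\nu)=(\tilde B_{\nu-1}\mathfrak{a}_\infty+\tilde B_\nu)^{-2}$. The positive integer $\nu$ satisfies $\kappa_1:=c(\nu)[2\eta(r)r^2\psi(r)]<1$; $\kappa_1<\kappa_2<1$. $M_0(\nu)=2/(\mathfrak{a}_\infty+\mathfrak{a}_{\nu-1}+\gamma)$, $M=\frac{4s}{\mathfrak{a}_\infty+\mathfrak{a}_{\nu-1}+\gamma}\cdot\frac{1}{\kappa_2-\kappa_1}$. Mesh. Pairwise disjoint nonempty compact intervals $[a_i,b_i]\subset S$, $1\le i\le I$, $b_i<a_{i+1}$, such that each $\theta_\omega(S)$, $\omega\in\Omega_\nu$, lies in some $[a_i,b_i]$; positive integers $N_i$, $h_i=(b_i-a_i)/N_i$, $h=\max_ih_i$, $\mu=h/\min_ih_i$, $t^i_j=a_i+jh_i$; and $2[\sin(\pi/(2r+2))]^2h_i\le a_{i+1}-b_i$ for $1\le i<I$. $\hat c_k=-\cos(\tfrac{2k+1}{2r+2}\pi)/\cos(\tfrac\pi{2r+2})$, $c^i_{j,k}=t^i_{j-1}+h_i(1+\hat c_k)/2$; $T$ = set of all $c^i_{j,k}$. For $F:T\to\mathbb{R}$, $\mathcal{F}$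 is the continuous function on $\bigcup_i[a_i,b_i]$ equal on each $[t^i_{j-1},t^i_j]$ to the polynomial of degree $\le r$ interpolating $F$ at $c^i_{j,0},\dots,c^i_{j,r}$. $(\mathbf{L}_{s,\nu}F)(\xi)=\sum_{\omega\in\Omega_\nu}g_\omega(\xi)^s\mathcal{F}(\theta_\omega(\xi))$, $\xi\in T$ (a linear map on $\mathbb{R}^T$). Constants. $G_{r+1}=2e^{2sh/\chi}\big[\frac{(2s)(2s+1)\cdots(2s+r)}{(2)(4)\cdots(2r+2)}\big]\chi^{-(r+1)}\big[\frac{1}{2\cos(\pi/(2r+2))}\big]^{r+1}$; $H_{r+1}=\mu\big[\frac{1}{\sin(\pi/(2r+2))}\big]^2G_{r+1}\frac{\chi}{2s}$. $\hat h_0>0$ is such that for all $0<h\le\hat h_0$, with $u=M\eta(r)h$: $\psi(r)ue^u<1$ and $\kappa_1e^u/(1-\psi(r)ue^u)<\kappa_2-sM_0(\nu)/M$. $\hat h_1>0$ is such that for all $0<h\le\hat h_1$: $2+H_{r+1}h^r(1+h^{2r+2})+h^2\le2/(\kappa_2-\kappa_1)$. *)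

theory Defs
  imports "HOL-Analysis.Analysis" "HOL-Computational_Algebra.Polynomial"
begin

section \<open>Spectral radius of an operator on \<open>C(X)\<close>\<close>

text \<open>Functions on \<open>X\<close> are represented extensionally.  The intended \<open>X\<close> are nonempty
  and compact, so that \<open>sup_norm X\<close> is the Banach norm of \<open>C(X)\<close>.  For finite \<open>X\<close>
  every function is continuous, so \<open>C(X)\<close> is then the space of all functions on \<open>X\<close>.\<close>

definition cont_functions :: "'a::topological_space set \<Rightarrow> ('a \<Rightarrow> 'b::topological_space) set"
  where "cont_functions X = {f \<in> extensional X. continuous_on X f}"

definition sup_norm :: "'a set \<Rightarrow> ('a \<Rightarrow> 'b::real_normed_vector) \<Rightarrow> real"
  where "sup_norm X f = (SUP x\<in>X. norm (f x))"

lemma cont_functions_finite: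
  fixes X :: "'a::t1_space set"
  assumes "finite X"
  shows "cont_functions X = (extensional X :: ('a \<Rightarrow> 'b::topological_space) set)"
  using assms by (auto simp: cont_functions_def intro: continuous_on_finite)

definition complexification ::
    "'a set \<Rightarrow> (('a \<Rightarrow> real) \<Rightarrow> ('a \<Rightarrow> real)) \<Rightarrow> ('a \<Rightarrow> complex) \<Rightarrow> ('a \<Rightarrow> complex)"
  where "complexification X A f =
    (\<lambda>x\<in>X. Complex (A (\<lambda>y\<in>X. Re (f y)) x) (A (\<lambda>y\<in>X. Im (f y)) x))"

text \<open>\<open>z\<close> is in the resolvent set iff \<open>zI - A\<close> is a bijection of the complex space \<open>C(X)\<close>
  with bounded inverse.\<close>

definition resolvent_set ::
    "'a::topological_space set \<Rightarrow> (('a \<Rightarrow> complex) \<Rightarrow> ('a \<Rightarrow> complex)) \<Rightarrow> complex set"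
  where "resolvent_set X A =
    {z. bij_betw (\<lambda>f. \<lambda>x\<in>X. z * f x - A f x) (cont_functions X) (cont_functions X) \<and>
        (\<exists>K. \<forall>f\<in>cont_functions X. sup_norm X f \<le> K * sup_norm X (\<lambda>x\<in>X. z * f x - A f x))}"

definition op_spectrum ::
    "'a::topological_space set \<Rightarrow> (('a \<Rightarrow> complex) \<Rightarrow> ('a \<Rightarrow> complex)) \<Rightarrow> complex set"
  where "op_spectrum X A = - resolvent_set X A"

definition spec_radius ::
    "'a::topological_space set \<Rightarrow> (('a \<Rightarrow> real) \<Rightarrow> ('a \<Rightarrow> real)) \<Rightarrow> real"
  where "spec_radius X A = Sup (cmod ` op_spectrum X (complexification X A))"


section \<open>The iterated function system and its transfer operator\<close>

definition theta :: "real \<Rightarrow> real \<Rightarrow> real"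
  where "theta \<beta> x = 1 / (x + \<beta>)"

fun theta_word :: "real list \<Rightarrow> real \<Rightarrow> real" where
  "theta_word [] = id"
| "theta_word (\<beta> # \<omega>) = theta \<beta> \<circ> theta_word \<omega>"

definition words :: "real set \<Rightarrow> nat \<Rightarrow> real list set"
  where "words B \<nu> = {\<omega>. set \<omega> \<subseteq> B \<and> length \<omega> = \<nu>}"

definition g_word :: "real list \<Rightarrow> real \<Rightarrow> real"
  where "g_word \<omega> x = \<bar>deriv (theta_word \<omega>) x\<bar>"

fun a_seq :: "real \<Rightarrow> real \<Rightarrow> nat \<Rightarrow> real" and b_seq :: "real \<Rightarrow> real \<Rightarrow> nat \<Rightarrow> real" where
  "a_seq \<gamma> \<Gamma> 0 = 0"
| "a_seq \<gamma> \<Gamma> (Suc k) = theta \<Gamma> (b_seq \<gamma> \<Gamma> k)"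
| "b_seq \<gamma> \<Gamma> 0 = 1 / \<gamma>"
| "b_seq \<gamma> \<Gamma> (Suc k) = theta \<gamma> (a_seq \<gamma> \<Gamma> k)"

definition a_inf :: "real \<Rightarrow> real \<Rightarrow> real"
  where "a_inf \<gamma> \<Gamma> = - \<gamma> / 2 + sqrt ((\<gamma> / 2)\<^sup>2 + \<gamma> / \<Gamma>)"

definition b_inf :: "real \<Rightarrow> real \<Rightarrow> real"
  where "b_inf \<gamma> \<Gamma> = - \<Gamma> / 2 + sqrt ((\<Gamma> / 2)\<^sup>2 + \<Gamma> / \<gamma>)"

lemma
  assumes "1 \<le> \<gamma>" "\<gamma> < \<Gamma>"
  shows a_seq_tendsto: "a_seq \<gamma> \<Gamma> \<longlonglongrightarrow> a_inf \<gamma> \<Gamma>"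
    and b_seq_tendsto: "b_seq \<gamma> \<Gamma> \<longlonglongrightarrow> b_inf \<gamma> \<Gamma>"
proof -
  define \<alpha> where "\<alpha> = a_inf \<gamma> \<Gamma>"
  define \<beta> where "\<beta> = b_inf \<gamma> \<Gamma>"
  have pos: "\<gamma> > 0" "\<Gamma> > 0" "\<Gamma> > 1" using assms by auto
  have \<alpha>0: "\<alpha> > 0" and \<beta>0: "\<beta> > 0"
    unfolding \<alpha>_def \<beta>_def a_inf_def b_inf_def
    using pos real_less_rsqrt[of "\<gamma> / 2" "(\<gamma> / 2)\<^sup>2 + \<gamma> / \<Gamma>"]
      real_less_rsqrt[of "\<Gamma> / 2" "(\<Gamma> / 2)\<^sup>2 + \<Gamma> / \<gamma>"] by auto
  have "(\<alpha> + \<gamma> / 2)\<^sup>2 = (\<gamma> / 2)\<^sup>2 + \<gamma> / \<Gamma>" "(\<beta> + \<Gamma> / 2)\<^sup>2 = (\<Gamma> / 2)\<^sup>2 + \<Gamma> / \<gamma>"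
    unfolding \<alpha>_def \<beta>_def a_inf_def b_inf_def using pos by simp_all
  hence q: "\<alpha> * (\<alpha> + \<gamma>) = \<gamma> / \<Gamma>" "\<beta> * (\<beta> + \<Gamma>) = \<Gamma> / \<gamma>"
    by (simp_all add: power2_eq_square algebra_simps)
  define \<delta> where "\<delta> = \<Gamma> * \<alpha> / \<gamma>"
  have d0: "\<delta> > 0" unfolding \<delta>_def using pos \<alpha>0 by simp
  have "\<delta> * (\<delta> + \<Gamma>) = (\<Gamma> / \<gamma>)\<^sup>2 * (\<alpha> * (\<alpha> + \<gamma>))"
    unfolding \<delta>_def using pos by (simp add: field_simps power2_eq_square)
  also have "\<dots> = \<Gamma> / \<gamma>" unfolding q using pos by (simp add: field_simps power2_eq_square)
  finally have "(\<delta> - \<beta>) * (\<delta> + \<beta> + \<Gamma>) = 0" using q by (simp add: algebra_simps)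
  hence "\<beta> = \<delta>" using d0 \<beta>0 pos by auto
  hence eq: "\<beta> * \<gamma> = \<alpha> * \<Gamma>" unfolding \<delta>_def using pos by simp
  have "\<alpha> * (\<alpha> + \<gamma>) * \<Gamma> = \<gamma>" using q pos by simp
  hence "\<beta> * (\<alpha> + \<gamma>) * \<gamma> = \<gamma>" using eq by (metis mult.assoc mult.commute)
  hence bfix: "\<beta> * (\<alpha> + \<gamma>) = 1" using pos by simp
  have "\<alpha> * (\<beta> + \<Gamma>) = 1" using bfix eq by (simp add: algebra_simps)
  hence fix1: "\<alpha> = theta \<Gamma> \<beta>" "\<beta> = theta \<gamma> \<alpha>" using bfix \<alpha>0 \<beta>0 pos
    by (simp_all add: theta_def field_simps)
  have nn: "a_seq \<gamma> \<Gamma> k \<ge> 0 \<and> b_seq \<gamma> \<Gamma> k \<ge> 0" for k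
    using pos by (induction k) (auto simp: theta_def)
  have lip: "\<bar>theta p x - theta p y\<bar> \<le> \<bar>x - y\<bar> / p\<^sup>2" if "p > 0" "x \<ge> 0" "y \<ge> 0" for p x y
  proof -
    have "theta p x - theta p y = (y - x) / ((x + p) * (y + p))"
      using that by (simp add: theta_def field_simps)
    hence "\<bar>theta p x - theta p y\<bar> = \<bar>x - y\<bar> / ((x + p) * (y + p))"
      using that by (simp add: abs_mult abs_minus_commute)
    also have "\<dots> \<le> \<bar>x - y\<bar> / p\<^sup>2"
      unfolding power2_eq_square using that by (intro divide_left_mono mult_mono) auto
    finally show ?thesis .
  qed
  define e where "e k = \<bar>a_seq \<gamma> \<Gamma> k - \<alpha>\<bar> + \<bar>b_seq \<gamma> \<Gamma> k - \<beta>\<bar> / \<Gamma>" for k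
  have ea: "\<bar>a_seq \<gamma> \<Gamma> (Suc k) - \<alpha>\<bar> \<le> \<bar>b_seq \<gamma> \<Gamma> k - \<beta>\<bar> / \<Gamma>\<^sup>2" for k
    using lip[of \<Gamma> "b_seq \<gamma> \<Gamma> k" \<beta>] nn[of k] pos \<beta>0 fix1(1) by simp
  have eb: "\<bar>b_seq \<gamma> \<Gamma> (Suc k) - \<beta>\<bar> \<le> \<bar>a_seq \<gamma> \<Gamma> k - \<alpha>\<bar>" for k
  proof -
    have "\<bar>b_seq \<gamma> \<Gamma> (Suc k) - \<beta>\<bar> \<le> \<bar>a_seq \<gamma> \<Gamma> k - \<alpha>\<bar> / \<gamma>\<^sup>2"
      using lip[of \<gamma> "a_seq \<gamma> \<Gamma> k" \<alpha>] nn[of k] pos \<alpha>0 fix1(2) by simp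
    also have "\<dots> \<le> \<bar>a_seq \<gamma> \<Gamma> k - \<alpha>\<bar> / 1"
      using assms by (intro divide_left_mono) (auto simp: one_le_power)
    finally show ?thesis by simp
  qed
  have step: "e (Suc k) \<le> (1 / \<Gamma>) * e k" for k
  proof -
    have "\<bar>b_seq \<gamma> \<Gamma> (Suc k) - \<beta>\<bar> / \<Gamma> \<le> \<bar>a_seq \<gamma> \<Gamma> k - \<alpha>\<bar> / \<Gamma>"
      using eb[of k] pos by (intro divide_right_mono) auto
    thus ?thesis using ea[of k] unfolding e_def
      by (simp add: algebra_simps power2_eq_square)
  qed
  have "e k \<le> (1 / \<Gamma>) ^ k * e 0" for k
  proof (induction k)
    case (Suc k)
    have "e (Suc k) \<le> (1 / \<Gamma>) * ((1 / \<Gamma>) ^ k * e 0)"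
      using step[of k] Suc pos by (meson mult_left_mono order_trans zero_le_divide_1_iff less_imp_le)
    thus ?case by simp
  qed simp
  moreover have "(\<lambda>k. (1 / \<Gamma>) ^ k * e 0) \<longlonglongrightarrow> 0"
    using pos by (intro tendsto_mult_left_zero LIMSEQ_power_zero) auto
  moreover have "e k \<ge> 0" for k unfolding e_def using pos by simp
  ultimately have e0: "e \<longlonglongrightarrow> 0"
    by (intro tendsto_sandwich[of "\<lambda>_. 0" e sequentially "\<lambda>k. (1 / \<Gamma>) ^ k * e 0"]) auto
  have "(\<lambda>k. a_seq \<gamma> \<Gamma> k - \<alpha>) \<longlonglongrightarrow> 0"
    by (rule Lim_null_comparison[OF _ e0]) (use pos in \<open>auto simp: e_def\<close>)
  thus "a_seq \<gamma> \<Gamma> \<longlonglongrightarrow> a_inf \<gamma> \<Gamma>" unfolding \<alpha>_def by (simp add: LIM_zero_iff)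
  have "(\<lambda>k. \<Gamma> * e k) \<longlonglongrightarrow> 0" using tendsto_mult_right_zero[OF e0] .
  hence "(\<lambda>k. b_seq \<gamma> \<Gamma> k - \<beta>) \<longlonglongrightarrow> 0"
    by (rule Lim_null_comparison[rotated]) (use pos in \<open>auto simp: e_def algebra_simps\<close>)
  thus "b_seq \<gamma> \<Gamma> \<longlonglongrightarrow> b_inf \<gamma> \<Gamma>" unfolding \<beta>_def by (simp add: LIM_zero_iff)
qed

definition S_interval :: "real \<Rightarrow> real \<Rightarrow> real set"
  where "S_interval \<gamma> \<Gamma> = {a_inf \<gamma> \<Gamma> .. b_inf \<gamma> \<Gamma>}"

definition chi :: "real \<Rightarrow> real \<Rightarrow> real"
  where "chi \<gamma> \<Gamma> = 2 * a_inf \<gamma> \<Gamma> + \<gamma>"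

definition L_op :: "real set \<Rightarrow> real \<Rightarrow> real set \<Rightarrow> (real \<Rightarrow> real) \<Rightarrow> (real \<Rightarrow> real)"
  where "L_op B s S f = (\<lambda>x\<in>S. \<Sum>\<beta>\<in>B. \<bar>deriv (theta \<beta>) x\<bar> powr s * f (theta \<beta> x))"


section \<open>Parameters\<close>

definition eta :: "nat \<Rightarrow> real"
  where "eta r = (if even r then 1 / 2 else 1 / 2 * (1 + tan (pi / (2 * real r + 2))))"

definition psi :: "nat \<Rightarrow> real"
  where "psi r = 2 / pi * ln (real r + 1) + 3 / 4"

fun B_tilde :: "real \<Rightarrow> nat \<Rightarrow> real" where
  "B_tilde \<gamma> 0 = 1"
| "B_tilde \<gamma> (Suc 0) = \<gamma>"
| "B_tilde \<gamma> (Suc (Suc j)) = B_tilde \<gamma> j + \<gamma> * B_tilde \<gamma> (Suc j)"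

definition c_const :: "real \<Rightarrow> real \<Rightarrow> nat \<Rightarrow> real"
  where "c_const \<gamma> \<Gamma> \<nu> = 1 / (B_tilde \<gamma> (\<nu> - 1) * a_inf \<gamma> \<Gamma> + B_tilde \<gamma> \<nu>)\<^sup>2"

definition kappa1 :: "real \<Rightarrow> real \<Rightarrow> nat \<Rightarrow> nat \<Rightarrow> real"
  where "kappa1 \<gamma> \<Gamma> \<nu> r = c_const \<gamma> \<Gamma> \<nu> * (2 * eta r * (real r)\<^sup>2 * psi r)"

definition M0_const :: "real \<Rightarrow> real \<Rightarrow> nat \<Rightarrow> real"
  where "M0_const \<gamma> \<Gamma> \<nu> = 2 / (a_inf \<gamma> \<Gamma> + a_seq \<gamma> \<Gamma> (\<nu> - 1) + \<gamma>)"

definition M_const :: "real \<Rightarrow> real \<Rightarrow> nat \<Rightarrow> real \<Rightarrow> real \<Rightarrow> real \<Rightarrow> real"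
  where "M_const \<gamma> \<Gamma> \<nu> s \<kappa>1 \<kappa>2 =
    4 * s / (a_inf \<gamma> \<Gamma> + a_seq \<gamma> \<Gamma> (\<nu> - 1) + \<gamma>) * (1 / (\<kappa>2 - \<kappa>1))"

definition G_const :: "nat \<Rightarrow> real \<Rightarrow> real \<Rightarrow> real \<Rightarrow> real"
  where "G_const r s x h =
    2 * exp (2 * s * h / x)
      * ((\<Prod>k=0..r. 2 * s + real k) / (\<Prod>k=1..r+1. 2 * real k))
      * (1 / x ^ (r + 1))
      * (1 / (2 * cos (pi / (2 * real r + 2)))) ^ (r + 1)"

definition H_const :: "nat \<Rightarrow> real \<Rightarrow> real \<Rightarrow> real \<Rightarrow> real \<Rightarrow> real"
  where "H_const r s x \<mu> h =
    \<mu> * (1 / sin (pi / (2 * real r + 2)))\<^sup>2 * G_const r s x h * (x / (2 * s))"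


section \<open>Mesh, piecewise polynomial interpolation and the discretized operator\<close>

definition mesh_h :: "(nat \<Rightarrow> real) \<Rightarrow> (nat \<Rightarrow> real) \<Rightarrow> (nat \<Rightarrow> nat) \<Rightarrow> nat \<Rightarrow> real"
  where "mesh_h a b N i = (b i - a i) / real (N i)"

definition mesh_t :: "(nat \<Rightarrow> real) \<Rightarrow> (nat \<Rightarrow> real) \<Rightarrow> (nat \<Rightarrow> nat) \<Rightarrow> nat \<Rightarrow> nat \<Rightarrow> real"
  where "mesh_t a b N i j = a i + real j * mesh_h a b N i"

definition c_hat :: "nat \<Rightarrow> nat \<Rightarrow> real"
  where "c_hat r k = - cos ((2 * real k + 1) / (2 * real r + 2) * pi) / cos (pi / (2 * real r + 2))"

definition mesh_c ::
    "nat \<Rightarrow> (nat \<Rightarrow> real) \<Rightarrow> (nat \<Rightarrow> real) \<Rightarrow> (nat \<Rightarrow> nat) \<Rightarrow> nat \<Rightarrow> nat \<Rightarrow> nat \<Rightarrow> real"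
  where "mesh_c r a b N i j k = mesh_t a b N i (j - 1) + mesh_h a b N i * (1 + c_hat r k) / 2"

definition mesh_T ::
    "nat \<Rightarrow> nat \<Rightarrow> (nat \<Rightarrow> real) \<Rightarrow> (nat \<Rightarrow> real) \<Rightarrow> (nat \<Rightarrow> nat) \<Rightarrow> real set"
  where "mesh_T r I a b N = {mesh_c r a b N i j k | i j k. i \<in> {1..I} \<and> j \<in> {1..N i} \<and> k \<in> {0..r}}"

text \<open>Consecutive subintervals share the end node \<open>c\<^sub>j\<^sub>,\<^sub>r = c\<^sub>j\<^sub>+\<^sub>1\<^sub>,\<^sub>0\<close>, so on
  a mesh with \<open>a i < b i\<close>, \<open>b i < a (i + 1)\<close> and \<open>0 < N i\<close> the description below determines
  exactly one function.\<close>

definition interpolant ::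
    "nat \<Rightarrow> nat \<Rightarrow> (nat \<Rightarrow> real) \<Rightarrow> (nat \<Rightarrow> real) \<Rightarrow> (nat \<Rightarrow> nat) \<Rightarrow> (real \<Rightarrow> real) \<Rightarrow> (real \<Rightarrow> real)"
  where "interpolant r I a b N F =
    (THE f. f \<in> cont_functions (\<Union>i\<in>{1..I}. {a i..b i}) \<and>
       (\<forall>i\<in>{1..I}. \<forall>j\<in>{1..N i}. \<exists>p :: real poly. degree p \<le> r \<and>
          (\<forall>k\<in>{0..r}. poly p (mesh_c r a b N i j k) = F (mesh_c r a b N i j k)) \<and>
          (\<forall>x\<in>{mesh_t a b N i (j - 1)..mesh_t a b N i j}. f x = poly p x)))"

definition L_disc ::
    "real set \<Rightarrow> real \<Rightarrow> nat \<Rightarrow> nat \<Rightarrow> nat \<Rightarrow> (nat \<Rightarrow> real) \<Rightarrow> (nat \<Rightarrow> real) \<Rightarrow> (nat \<Rightarrow> nat) \<Rightarrow>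
     (real \<Rightarrow> real) \<Rightarrow> (real \<Rightarrow> real)"
  where "L_disc B s \<nu> r I a b N F =
    (\<lambda>\<xi>\<in>mesh_T r I a b N.
       \<Sum>\<omega>\<in>words B \<nu>. g_word \<omega> \<xi> powr s * interpolant r I a b N F (theta_word \<omega> \<xi>))"

end

theory Submission
  imports Defs
begin

text \<open>The matrix of the discretized operator has entries of both signs, so it is compared with the
  transfer operator not pointwise but in the order induced by the cone of functions \<open>f\<close> with
  \<open>0 \<le> f x \<le> exp (M \<bar>x - y\<bar>) f y\<close>.  On one mesh interval the interpolating polynomial of such an \<open>f\<close>
  deviates little from its value at the central node, because the Lebesgue constant of the expanded
  Chebyshev nodes is at most \<open>psi r\<close>, and by Markov's inequality its derivative is small as well;
  the contraction of the words of length \<open>\<nu>\<close> then makes the discretized operator map the cone into a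
  smaller one.  Birkhoff's contraction argument gives a positive eigenvector, and its eigenvalue is
  the spectral radius.  The same argument applied to the transfer operator yields an eigenfunction
  \<open>v\<close> that is a limit of positive combinations of functions \<open>(x + \<tau>)\<^sup>-\<^sup>2\<^sup>s\<close>, for which the interpolation
  error is explicit.  The nodes are separated by a multiple of \<open>h\<close>, so the error is, up to a loss of
  one power of \<open>h\<close>, dominated by \<open>v\<close> in the order of the cone, and this order relation bounds one
  eigenvalue by the other.\<close>

section \<open>Lagrange interpolation\<close>

text \<open>Closeness of \<open>v\<close> to its interpolant is useful only if the relative error
  respects log-Lipschitz bounds, and this is where discreteness of the node set helps. With \<sigma>
  = sin^2 (pi/(2r+2)), distinct nodes are at least 2 \<sigma> min h_i apart, so a relative error of
  size \<epsilon> = (2s/\<chi>) \<sigma> min h_i raises the log-Lipschitz constant 2s/\<chi> of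
  \<open>v\<close> by a factor of at most 2 + h^2. The constant \<open>H\<close> solves G h^(r+1) =
  (H h^r) \<epsilon>, which explains its factors \<mu>, 1/\<sigma> and \<chi>/(2s). The threshold
  for \<kappa>2 - \<kappa>1 keeps (2 + h^2) 2s/\<chi> below \<open>M\<close>; the other threshold
  makes the cone invariant. In \<kappa>1, c(\<nu>) is the contraction of words, r^2 comes from
  Markov, \<psi>(r) from Lebesgue, \<eta>(r) from the distance to the central node, and 2 from
  rescaling to [-1, 1]. As \<psi>(r) has the explicit summand 3/4, the Lebesgue estimate must hold
  with little slack already for three nodes; this forces the numerical work.\<close>

definition lagrange :: "nat \<Rightarrow> (nat \<Rightarrow> real) \<Rightarrow> nat \<Rightarrow> real \<Rightarrow> real"
  where "lagrange n z k x = (\<Prod>j\<in>{..<n} - {k}. (x - z j) / (z k - z j))"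

definition lagrange_poly :: "nat \<Rightarrow> (nat \<Rightarrow> real) \<Rightarrow> (nat \<Rightarrow> real) \<Rightarrow> real poly"
  where "lagrange_poly n z F =
    (\<Sum>k<n. smult (F k) (\<Prod>j\<in>{..<n} - {k}. smult (1 / (z k - z j)) [:- z j, 1:]))"

lemma poly_lagrange_poly: "poly (lagrange_poly n z F) x = (\<Sum>k<n. F k * lagrange n z k x)"
  unfolding lagrange_poly_def lagrange_def
  by (simp add: poly_sum poly_prod algebra_simps diff_divide_distrib)

lemma degree_lagrange_poly: "degree (lagrange_poly n z F) \<le> n - 1"
  unfolding lagrange_poly_def
proof (rule degree_sum_le)
  fix k assume k: "k \<in> {..<n}"
  have "degree (\<Prod>j\<in>{..<n} - {k}. smult (1 / (z k - z j)) [:- z j, 1:])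
      \<le> sum (degree \<circ> (\<lambda>j. smult (1 / (z k - z j)) [:- z j, 1:])) ({..<n} - {k})"
    by (rule degree_prod_sum_le) simp
  also have "\<dots> \<le> (\<Sum>j\<in>{..<n} - {k}. 1)"
    by (intro sum_mono) (auto intro: order_trans[OF degree_smult_le])
  also have "\<dots> = n - 1" using k by simp
  finally show "degree (smult (F k) (\<Prod>j\<in>{..<n} - {k}. smult (1 / (z k - z j)) [:- z j, 1:])) \<le> n - 1"
    using degree_smult_le order_trans by blast
qed simp

lemma lagrange_node:
  assumes "inj_on z {..<n}" "i < n" "k < n"
  shows "lagrange n z k (z i) = (if i = k then 1 else 0)"
proof (cases "i = k")
  case True
  have "z k \<noteq> z j" if "j \<in> {..<n} - {k}" for j
    using assms that by (auto dest: inj_onD)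
  thus ?thesis using True by (simp add: lagrange_def)
next
  case False
  thus ?thesis using assms by (auto simp: lagrange_def intro!: prod_zero)
qed

lemma poly_lagrange_poly_node:
  assumes "inj_on z {..<n}" "i < n"
  shows "poly (lagrange_poly n z F) (z i) = F i"
  using assms by (simp add: poly_lagrange_poly lagrange_node if_distrib cong: if_cong)

lemma poly_eq_if_nodes_agree:
  fixes p q :: "real poly"
  assumes "inj_on z {..<n}" "degree p \<le> n - 1" "degree q \<le> n - 1" "0 < n"
    and "\<And>k. k < n \<Longrightarrow> poly p (z k) = poly q (z k)"
  shows "p = q"
proof (rule ccontr)
  assume "p \<noteq> q"
  hence nz: "p - q \<noteq> 0" by simp
  have "n = card (z ` {..<n})" using assms(1) by (simp add: card_image)
  also have "\<dots> \<le> card {x. poly (p - q) x = 0}"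
    using assms(5) poly_roots_finite[OF nz] by (intro card_mono) auto
  also have "\<dots> \<le> degree (p - q)" by (rule card_poly_roots_bound[OF nz])
  also have "\<dots> \<le> n - 1" using assms by (intro degree_diff_le) auto
  finally show False using assms(4) by simp
qed

lemma poly_eq_lagrange_sum:
  fixes p :: "real poly"
  assumes "inj_on z {..<n}" "degree p \<le> n - 1" "0 < n"
  shows "poly p x = (\<Sum>k<n. poly p (z k) * lagrange n z k x)"
proof -
  have "p = lagrange_poly n z (\<lambda>k. poly p (z k))"
    using assms by (intro poly_eq_if_nodes_agree[OF assms(1)])
      (auto simp: degree_lagrange_poly[simplified] poly_lagrange_poly_node)
  thus ?thesis by (metis poly_lagrange_poly)
qed

lemma sum_lagrange:
  assumes "inj_on z {..<n}" "0 < n"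
  shows "(\<Sum>k<n. lagrange n z k x) = 1"
  using poly_eq_lagrange_sum[OF assms(1), of 1] assms(2) by simp

lemma lagrange_affine:
  assumes "v \<noteq> 0"
  shows "lagrange n (\<lambda>k. u + v * z k) k (u + v * x) = lagrange n z k x"
proof -
  have "(v * x - v * z j) / (v * z k - v * z j) = (x - z j) / (z k - z j)" for j
    using assms by (metis mult_divide_mult_cancel_left right_diff_distrib')
  thus ?thesis by (simp add: lagrange_def)
qed

text \<open>The derivatives are passed as a sequence so that the induction can shift it: Rolle
  between consecutive zeros gives interlacing zeros of \<open>f 1\<close>, one fewer, and the
  hypothesis is applied to \<open>\<lambda>m. f (Suc m)\<close>.\<close>

lemma iterated_Rolle:
  fixes f :: "nat \<Rightarrow> real \<Rightarrow> real"
  assumes "\<And>i. i < n \<Longrightarrow> z i < z (Suc i)"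
    and "\<And>i. i \<le> n \<Longrightarrow> f 0 (z i) = 0"
    and "\<And>m x. m < n \<Longrightarrow> z 0 \<le> x \<Longrightarrow> x \<le> z n \<Longrightarrow> (f m has_real_derivative f (Suc m) x) (at x)"
  shows "\<exists>\<zeta>\<in>{z 0..z n}. f n \<zeta> = 0"
  using assms
proof (induction n arbitrary: f z)
  case 0
  thus ?case by auto
next
  case (Suc n)
  have mono: "z i \<le> z j" if "i \<le> j" "j \<le> Suc n" for i j
    using that
  proof (induction j rule: dec_induct)
    case (step m)
    thus ?case using Suc.prems(1)[of m] by auto
  qed simp
  have "\<exists>y. z i < y \<and> y < z (Suc i) \<and> f 1 y = 0" if i: "i \<le> n" for i
  proof -
    have d: "(f 0 has_real_derivative f 1 x) (at x)" if "z i \<le> x" "x \<le> z (Suc i)" for x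
      using Suc.prems(3)[of 0 x] mono[of 0 i] mono[of "Suc i" "Suc n"] that i by auto
    have "\<exists>y. z i < y \<and> y < z (Suc i) \<and> (\<lambda>h. f 1 y * h) = (\<lambda>h. 0)"
    proof (rule Rolle_deriv[of "z i" "z (Suc i)" "f 0"])
      show "z i < z (Suc i)" using Suc.prems(1) i by simp
      show "f 0 (z i) = f 0 (z (Suc i))" using Suc.prems(2) i by simp
      show "continuous_on {z i..z (Suc i)} (f 0)"
        by (auto intro!: continuous_at_imp_continuous_on DERIV_isCont d)
      show "(f 0 has_derivative (\<lambda>h. f 1 y * h)) (at y)" if "z i < y" "y < z (Suc i)" for y
        using d[of y] that by (simp add: has_field_derivative_def)
    qed
    thus ?thesis by (metis mult.right_neutral)
  qed
  then obtain y where y: "\<And>i. i \<le> n \<Longrightarrow> z i < y i \<and> y i < z (Suc i) \<and> f 1 (y i) = 0"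
    by metis
  have "\<exists>\<zeta>\<in>{y 0..y n}. f (Suc n) \<zeta> = 0"
  proof (rule Suc.IH[of y "\<lambda>m. f (Suc m)", simplified])
    show "y i < y (Suc i)" if "i < n" for i
      using y[of i] y[of "Suc i"] that by auto
    show "f (Suc 0) (y i) = 0" if "i \<le> n" for i using y that by simp
    show "(f (Suc m) has_real_derivative f (Suc (Suc m)) x) (at x)"
      if "m < n" "y 0 \<le> x" "x \<le> y n" for m x
      using that y[of 0] y[of n] Suc.prems(3)[of "Suc m" x] by auto
  qed
  moreover have "z 0 \<le> y 0" "y n \<le> z (Suc n)" using y[of 0] y[of n] by auto
  ultimately show ?case by force
qed


section \<open>Chebyshev polynomials and Markov's inequality\<close>

fun chebyshev :: "nat \<Rightarrow> real poly" where
  "chebyshev 0 = 1"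
| "chebyshev (Suc 0) = [:0, 1:]"
| "chebyshev (Suc (Suc n)) = [:0, 2:] * chebyshev (Suc n) - chebyshev n"

lemma poly_chebyshev_cos: "poly (chebyshev n) (cos t) = cos (real n * t)"
proof (induction n rule: chebyshev.induct)
  case (3 n)
  have "cos (real (Suc (Suc n)) * t) + cos (real n * t) = 2 * cos t * cos (real (Suc n) * t)"
  proof -
    have "real (Suc (Suc n)) * t = real (Suc n) * t + t" "real n * t = real (Suc n) * t - t"
      by (simp_all add: algebra_simps)
    thus ?thesis by (simp only: cos_add cos_diff) simp
  qed
  thus ?case using 3 by simp
qed simp_all

lemma degree_chebyshev_le: "degree (chebyshev n) \<le> n"
proof (induction n rule: chebyshev.induct)
  case (3 n)
  have "degree ([:0, 2:] * chebyshev (Suc n)) \<le> Suc (Suc n)"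
    using degree_mult_le[of "[:0,2:]" "chebyshev (Suc n)"] 3(1) by simp
  thus ?case using 3 by (simp del: mult_pCons_left add: degree_diff_le)
qed simp_all

text \<open>Indexed by \<open>Suc n\<close> because the pattern 2^(n-1) fails at degree 0.\<close>

lemma coeff_chebyshev: "coeff (chebyshev (Suc n)) (Suc n) = 2 ^ n"
proof (induction n)
  case (Suc n)
  have "coeff (chebyshev n) (Suc (Suc n)) = 0"
    using degree_chebyshev_le[of n] by (intro coeff_eq_0) simp
  thus ?case using Suc by simp
qed simp

lemma poly_chebyshev_1: "poly (chebyshev n) 1 = 1"
  using poly_chebyshev_cos[of n 0] by simp

text \<open>Divided by n, this value is the factor in \<open>Schur_right\<close>, and so accounts
  for one of the two factors r in Markov's inequality.\<close>

lemma poly_pderiv_chebyshev_1: "poly (pderiv (chebyshev n)) 1 = (real n)\<^sup>2"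
proof (induction n rule: chebyshev.induct)
  case (3 n)
  have "pderiv (chebyshev (Suc (Suc n)))
      = [:0, 2:] * pderiv (chebyshev (Suc n)) + [:2:] * chebyshev (Suc n) - pderiv (chebyshev n)"
    by (simp only: chebyshev.simps pderiv_diff pderiv_mult) (simp add: pderiv_pCons)
  hence "poly (pderiv (chebyshev (Suc (Suc n)))) 1
      = 2 * (real (Suc n))\<^sup>2 + 2 - (real n)\<^sup>2"
    using 3 poly_chebyshev_1[of "Suc n"] by simp
  thus ?case by (simp add: power2_eq_square algebra_simps)
qed (simp_all add: pderiv_pCons)

text \<open>The angles increase with \<open>k\<close>, so the nodes are listed in decreasing order
  and \<open>cheb_node n 0\<close> is the largest one.\<close>

definition cheb_angle :: "nat \<Rightarrow> nat \<Rightarrow> real"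
  where "cheb_angle n k = (2 * real k + 1) * (pi / (2 * real n))"

definition cheb_node :: "nat \<Rightarrow> nat \<Rightarrow> real"
  where "cheb_node n k = cos (cheb_angle n k)"

lemma cheb_angle_bounds:
  assumes "k < n"
  shows "0 < cheb_angle n k" "cheb_angle n k < pi"
proof -
  show "0 < cheb_angle n k" using assms by (simp add: cheb_angle_def)
  have "2 * real k + 1 < 2 * real n" using assms by linarith
  from mult_strict_right_mono[OF this pi_gt_zero]
  show "cheb_angle n k < pi" using assms by (simp add: cheb_angle_def field_simps)
qed

lemma cheb_angle_less: "0 < n \<Longrightarrow> j < k \<Longrightarrow> cheb_angle n j < cheb_angle n k"
  by (simp add: cheb_angle_def divide_strict_right_mono mult_strict_right_mono)

lemma cheb_node_less: "j < k \<Longrightarrow> k < n \<Longrightarrow> cheb_node n k < cheb_node n j"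
  unfolding cheb_node_def using cheb_angle_less[of n j k] cheb_angle_bounds[of j n] cheb_angle_bounds[of k n]
  by (intro cos_monotone_0_pi) auto

lemma inj_on_cheb_node: "inj_on (cheb_node n) {..<n}"
  by (rule inj_onI) (metis cheb_node_less lessThan_iff less_irrefl nat_neq_iff)

lemma cos_n_cheb_angle: "0 < n \<Longrightarrow> cos (real n * cheb_angle n k) = 0"
proof -
  assume "0 < n"
  hence "real n * cheb_angle n k = of_int (2 * int k + 1) * (pi / 2)"
    by (simp add: cheb_angle_def)
  thus ?thesis using cos_zero_iff_int[of "real n * cheb_angle n k"] by (metis even_plus_one_iff dvd_triv_left)
qed

text \<open>Both sides have leading coefficient 2^(n-1), so their difference has degree at most n -
  1; it vanishes at all n nodes.\<close>

lemma chebyshev_eq_prod: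
  assumes "0 < n"
  shows "poly (chebyshev n) x = 2 ^ (n - 1) * (\<Prod>k<n. x - cheb_node n k)"
proof -
  define q where "q = smult (2 ^ (n - 1)) (\<Prod>k<n. [:- cheb_node n k, 1:])"
  obtain m where n: "n = Suc m" using assms by (cases n) auto
  have mon: "lead_coeff (\<Prod>k<n. [:- cheb_node n k, 1:]) = 1"
    by (simp add: lead_coeff_prod)
  have deg: "degree (\<Prod>k<n. [:- cheb_node n k, 1:]) = n"
    by (subst degree_prod_eq_sum_degree) auto
  have dq: "degree q \<le> n" "coeff q n = 2 ^ (n - 1)"
    using mon deg by (auto simp: q_def)
  have "coeff (chebyshev n - q) n = 0"
    using coeff_chebyshev[of m] dq(2) n by simp
  moreover have "degree (chebyshev n - q) \<le> n"
    using degree_chebyshev_le dq(1) by (rule degree_diff_le)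
  ultimately have "degree (chebyshev n - q) \<le> n - 1"
    by (metis Suc_pred' assms le_Suc_eq leading_coeff_0_iff degree_0 zero_le)
  moreover have "poly (chebyshev n - q) (cheb_node n k) = poly 0 (cheb_node n k)" if "k < n" for k
  proof -
    have "poly (chebyshev n) (cheb_node n k) = 0"
      unfolding cheb_node_def poly_chebyshev_cos by (rule cos_n_cheb_angle[OF assms])
    moreover have "poly q (cheb_node n k) = 0"
      using that by (auto simp: q_def poly_prod intro!: prod_zero)
    ultimately show ?thesis by simp
  qed
  ultimately have "chebyshev n - q = 0"
    using assms by (intro poly_eq_if_nodes_agree[OF inj_on_cheb_node[of n]]) auto
  hence "poly (chebyshev n) x = poly q x" by simp
  thus ?thesis by (simp add: q_def poly_prod)
qed

lemma prod_cheb_node_remove: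
  assumes "k < n"
  shows "poly (chebyshev n) x
    = 2 ^ (n - 1) * (x - cheb_node n k) * (\<Prod>j\<in>{..<n} - {k}. x - cheb_node n j)"
  using chebyshev_eq_prod[of n x] prod.remove[of "{..<n}" k "\<lambda>j. x - cheb_node n j"] assms
  by simp

text \<open>Factor cos (n t) through node \<open>k\<close> and differentiate at its angle: only the
  term with the differentiated factor survives, and the sine of n times that angle has modulus
  1.\<close>

lemma abs_prod_cheb_node_diff:
  assumes "k < n"
  shows "\<bar>\<Prod>j\<in>{..<n} - {k}. cheb_node n k - cheb_node n j\<bar>
    = real n / (2 ^ (n - 1) * sin (cheb_angle n k))"
proof -
  define W where "W x = (\<Prod>j\<in>{..<n} - {k}. x - cheb_node n j)" for x
  let ?t = "cheb_angle n k"
  have n: "0 < n" using assms by simp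
  have sp: "sin ?t > 0" using cheb_angle_bounds[OF assms] by (simp add: sin_gt_zero)
  have "\<exists>W'. (W has_real_derivative W') (at (cos ?t))"
    unfolding W_def
    by (rule exI, rule has_field_derivative_prod[where f' = "\<lambda>_. 1"]) (auto intro!: derivative_eq_intros)
  then obtain W' where W': "(W has_real_derivative W') (at (cos ?t))" by blast
  have "((\<lambda>t. 2 ^ (n - 1) * (cos t - cheb_node n k) * W (cos t)) has_real_derivative
      2 ^ (n - 1) * (- sin ?t) * W (cos ?t)) (at ?t)"
    by (auto intro!: derivative_eq_intros DERIV_chain2[where f = W and g = cos, OF W'] simp: cheb_node_def)
  moreover have "(\<lambda>t. 2 ^ (n - 1) * (cos t - cheb_node n k) * W (cos t)) = (\<lambda>t. cos (real n * t))"
    using prod_cheb_node_remove[OF assms] by (simp add: W_def flip: poly_chebyshev_cos)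
  moreover have "((\<lambda>t. cos (real n * t)) has_real_derivative - sin (real n * ?t) * real n) (at ?t)"
    by (auto intro!: derivative_eq_intros)
  ultimately have "2 ^ (n - 1) * (- sin ?t) * W (cos ?t) = - sin (real n * ?t) * real n"
    using DERIV_unique by metis
  hence "\<bar>2 ^ (n - 1) * (- sin ?t) * W (cos ?t)\<bar> = \<bar>- sin (real n * ?t) * real n\<bar>" by (rule arg_cong)
  hence "2 ^ (n - 1) * sin ?t * \<bar>W (cos ?t)\<bar> = \<bar>sin (real n * ?t)\<bar> * real n"
    using sp by (simp add: abs_mult)
  moreover have "\<bar>sin (real n * ?t)\<bar> = 1"
    using cos_n_cheb_angle[OF n, of k] sin_cos_squared_add[of "real n * ?t"]
    by (simp add: power2_eq_1_iff) (metis abs_1 abs_minus_cancel)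
  ultimately show ?thesis using sp unfolding W_def cheb_node_def by (simp add: field_simps)
qed

lemma abs_lagrange_cheb_node:
  assumes "k < n"
  shows "\<bar>lagrange n (cheb_node n) k x\<bar> =
    sin (cheb_angle n k) / real n * (2 ^ (n - 1) * (\<Prod>j\<in>{..<n} - {k}. \<bar>x - cheb_node n j\<bar>))"
  unfolding lagrange_def prod_dividef abs_divide
  unfolding abs_prod_cheb_node_diff[OF assms] unfolding abs_prod
  by simp

lemma abs_lagrange_cheb_node_cos:
  assumes "k < n" "cos t \<noteq> cheb_node n k"
  shows "\<bar>lagrange n (cheb_node n) k (cos t)\<bar> =
    \<bar>cos (real n * t)\<bar> / real n * (sin (cheb_angle n k) / \<bar>cos t - cheb_node n k\<bar>)"
proof -
  have "\<bar>cos (real n * t)\<bar> = 2 ^ (n - 1) * \<bar>cos t - cheb_node n k\<bar> *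
      (\<Prod>j\<in>{..<n} - {k}. \<bar>cos t - cheb_node n j\<bar>)"
    unfolding poly_chebyshev_cos[symmetric] prod_cheb_node_remove[OF assms(1)]
    by (simp add: abs_mult abs_prod)
  thus ?thesis unfolding abs_lagrange_cheb_node[OF assms(1)] using assms(2) by (simp add: field_simps)
qed

text \<open>To the right of the largest node all differences \<open>x - cheb_node n j\<close> are
  nonnegative and grow up to x = 1. The weights sin of the nodal angles are absorbed into
  \<open>K\<close>, and the remaining sum of products at 1 is the derivative of the Chebyshev
  polynomial there.\<close>

lemma Schur_right:
  fixes q :: "real poly"
  assumes n: "0 < n" and deg: "degree q \<le> n - 1"
    and bd: "\<And>t. \<bar>poly q (cos t) * sin t\<bar> \<le> K"
    and x: "cheb_node n 0 \<le> x" "x \<le> 1"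
  shows "\<bar>poly q x\<bar> \<le> real n * K"
proof -
  have K: "K \<ge> 0" using bd[of 0] by simp
  have le: "cheb_node n j \<le> x" if "j < n" for j
    using x cheb_node_less[of 0 j n] that by (cases "j = 0") auto
  have deriv: "(\<Sum>k<n. 2 ^ (n - 1) * (\<Prod>j\<in>{..<n} - {k}. 1 - cheb_node n j)) = (real n)\<^sup>2"
  proof -
    have "((\<lambda>x. \<Prod>k<n. x - cheb_node n k) has_real_derivative
        (\<Sum>k<n. 1 * (\<Prod>j\<in>{..<n} - {k}. 1 - cheb_node n j))) (at 1)"
      by (rule has_field_derivative_prod) (auto intro!: derivative_eq_intros)
    hence "((\<lambda>x. 2 ^ (n - 1) * (\<Prod>k<n. x - cheb_node n k)) has_real_derivative
        2 ^ (n - 1) * (\<Sum>k<n. 1 * (\<Prod>j\<in>{..<n} - {k}. 1 - cheb_node n j))) (at 1)"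
      by (rule DERIV_cmult)
    moreover have "(\<lambda>x. 2 ^ (n - 1) * (\<Prod>k<n. x - cheb_node n k)) = poly (chebyshev n)"
      using chebyshev_eq_prod[OF n] by auto
    ultimately have "2 ^ (n - 1) * (\<Sum>k<n. 1 * (\<Prod>j\<in>{..<n} - {k}. 1 - cheb_node n j))
        = poly (pderiv (chebyshev n)) 1"
      using DERIV_unique poly_DERIV by metis
    thus ?thesis by (simp add: poly_pderiv_chebyshev_1 sum_distrib_left)
  qed
  have "\<bar>poly q x\<bar> \<le> (\<Sum>k<n. \<bar>poly q (cheb_node n k) * lagrange n (cheb_node n) k x\<bar>)"
    unfolding poly_eq_lagrange_sum[OF inj_on_cheb_node deg n, of x] by (rule sum_abs)
  also have "\<dots> \<le> (\<Sum>k<n. K / real n * (2 ^ (n - 1) * (\<Prod>j\<in>{..<n} - {k}. 1 - cheb_node n j)))"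
  proof (rule sum_mono)
    fix k assume "k \<in> {..<n}"
    hence k: "k < n" by simp
    have sp: "sin (cheb_angle n k) > 0" using cheb_angle_bounds[OF k] by (simp add: sin_gt_zero)
    have p0: "0 \<le> (\<Prod>j\<in>{..<n} - {k}. \<bar>x - cheb_node n j\<bar>)" by (simp add: prod_nonneg)
    have "\<bar>poly q (cheb_node n k) * lagrange n (cheb_node n) k x\<bar>
        = \<bar>poly q (cheb_node n k) * sin (cheb_angle n k)\<bar> / real n
          * (2 ^ (n - 1) * (\<Prod>j\<in>{..<n} - {k}. \<bar>x - cheb_node n j\<bar>))"
      using sp by (simp add: abs_mult abs_lagrange_cheb_node[OF k])
    also have "\<dots> \<le> K / real n * (2 ^ (n - 1) * (\<Prod>j\<in>{..<n} - {k}. \<bar>x - cheb_node n j\<bar>))"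
      using bd[of "cheb_angle n k"] p0
      by (intro mult_right_mono divide_right_mono) (auto simp: cheb_node_def)
    also have "\<dots> \<le> K / real n * (2 ^ (n - 1) * (\<Prod>j\<in>{..<n} - {k}. 1 - cheb_node n j))"
      using K le x by (intro mult_left_mono prod_mono) auto
    finally show "\<bar>poly q (cheb_node n k) * lagrange n (cheb_node n) k x\<bar>
      \<le> K / real n * (2 ^ (n - 1) * (\<Prod>j\<in>{..<n} - {k}. 1 - cheb_node n j))" .
  qed
  also have "\<dots> = K / real n * (real n)\<^sup>2"
    unfolding sum_distrib_left[symmetric] deriv[symmetric] by (simp add: sum_distrib_left)
  finally show ?thesis using n by (simp add: power2_eq_square mult.commute)
qed

text \<open>Splits t \<mapsto> p (cos (u + t)) into its even and its odd part. The case
  \<open>B = 0\<close> is separate because the zero polynomial has degree 0, which would break the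
  strict bound for constant \<open>p\<close>.\<close>

lemma poly_cos_add_decomposition:
  fixes p :: "real poly"
  shows "\<exists>A B. degree A \<le> degree p \<and> (B = 0 \<or> degree B < degree p) \<and>
    (\<forall>t. poly p (cos (u + t)) = poly A (cos t) + sin t * poly B (cos t))"
proof (induction p)
  case 0
  show ?case by (rule exI[of _ 0], rule exI[of _ 0]) simp
next
  case (pCons c p)
  show ?case
  proof (cases "p = 0")
    case True
    show ?thesis by (rule exI[of _ "[:c:]"], rule exI[of _ 0]) (simp add: True)
  next
    case False
    then obtain A B where AB: "degree A \<le> degree p" "B = 0 \<or> degree B < degree p"
      "\<And>t. poly p (cos (u + t)) = poly A (cos t) + sin t * poly B (cos t)"
      using pCons by blast
    \<comment> \<open>Multiplication by cos (u + t) = cos u cos t - sin u sin t, with sin^2 t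
      rewritten as 1 - cos^2 t.\<close>
    define A' where "A' = [:c:] + [:0, cos u:] * A - [:sin u:] * ([:1, 0, -1:] * B)"
    define B' where "B' = [:0, cos u:] * B - [:sin u:] * A"
    have dp: "degree (pCons c p) = Suc (degree p)" using False by simp
    have d1: "degree ([:0, cos u:] * A) \<le> Suc (degree p)"
      using degree_mult_le[of "[:0, cos u:]" A] AB(1) by (auto split: if_splits)
    have d2: "degree ([:sin u:] * ([:1, 0, -1:] * B)) \<le> Suc (degree p)"
    proof (cases "B = 0")
      case False
      have "degree ([:sin u:] * ([:1, 0, -1:] * B)) \<le> 0 + (2 + degree B)"
        using degree_mult_le[of "[:sin u:]" "[:1, 0, -1:] * B"] degree_mult_le[of "[:1, 0, -1:]" B]
        by simp
      thus ?thesis using AB(2) False by simp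
    qed simp
    have "degree A' \<le> Suc (degree p)"
      unfolding A'_def by (intro degree_diff_le degree_add_le d1 d2) simp
    moreover have "degree B' \<le> degree p"
      unfolding B'_def
    proof (rule degree_diff_le)
      show "degree ([:0, cos u:] * B) \<le> degree p"
      proof (cases "B = 0")
        case False
        thus ?thesis using degree_mult_le[of "[:0, cos u:]" B] AB(2) by (auto split: if_splits)
      qed simp
      show "degree ([:sin u:] * A) \<le> degree p"
        using degree_mult_le[of "[:sin u:]" A] AB(1) by simp
    qed
    moreover have "poly (pCons c p) (cos (u + t)) = poly A' (cos t) + sin t * poly B' (cos t)" for t
    proof -
      have s: "sin t * sin t = 1 - cos t * cos t"
        using sin_cos_squared_add3[of t] by linarith
      have "poly (pCons c p) (cos (u + t))
        = c + (cos u * cos t - sin u * sin t) * (poly A (cos t) + sin t * poly B (cos t))"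
        using AB(3) by (simp add: cos_add)
      also have "\<dots> = c + cos u * cos t * poly A (cos t) - sin u * (sin t * sin t) * poly B (cos t)
          + sin t * (cos u * cos t * poly B (cos t) - sin u * poly A (cos t))"
        by (simp add: algebra_simps)
      also have "\<dots> = poly A' (cos t) + sin t * poly B' (cos t)"
        unfolding s A'_def B'_def by (simp add: algebra_simps)
      finally show ?thesis .
    qed
    ultimately show ?thesis unfolding dp by (metis less_Suc_eq_le)
  qed
qed

text \<open>The odd part sin t * B (cos t) is bounded by \<open>K\<close>, so Schur's inequality
  bounds \<open>poly B 1\<close>. That number is the derivative of p (cos (u + t)) at t = 0, the
  even part having derivative zero there.\<close>

lemma Bernstein_inequality:
  fixes p :: "real poly"
  assumes bd: "\<And>x. \<bar>x\<bar> \<le> 1 \<Longrightarrow> \<bar>poly p x\<bar> \<le> K" and deg: "degree p \<le> r" and r: "0 < r"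
  shows "\<bar>poly (pderiv p) (cos u) * sin u\<bar> \<le> real r * K"
proof -
  obtain A B where AB: "degree A \<le> degree p" "B = 0 \<or> degree B < degree p"
      "\<And>t. poly p (cos (u + t)) = poly A (cos t) + sin t * poly B (cos t)"
    using poly_cos_add_decomposition[of p u] by blast
  have K: "\<bar>poly p (cos t)\<bar> \<le> K" for t by (rule bd) simp
  \<comment> \<open>Half the difference of the values at t and -t isolates the odd part.\<close>
  have "\<bar>poly B (cos t) * sin t\<bar> \<le> K" for t
    using AB(3)[of t] AB(3)[of "- t"] K[of "u + t"] K[of "u - t"] by (simp add: algebra_simps abs_le_iff)
  hence "\<bar>poly B 1\<bar> \<le> real r * K"
    using AB(2) deg r by (intro Schur_right) (auto simp: cheb_node_def)
  moreover have "poly (pderiv p) (cos u) * (- sin u) = poly B 1"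
  proof -
    have "((\<lambda>t. poly p (cos (u + t))) has_real_derivative poly (pderiv p) (cos u) * (- sin u)) (at 0)"
      by (rule DERIV_chain2[where f = "poly p"]) (auto intro!: derivative_eq_intros simp: poly_DERIV)
    moreover have "((\<lambda>t. poly A (cos t) + sin t * poly B (cos t)) has_real_derivative
        poly (pderiv A) (cos 0) * (- sin 0) + (sin 0 * (poly (pderiv B) (cos 0) * (- sin 0))
          + cos 0 * poly B (cos 0))) (at 0)"
      by (auto intro!: derivative_eq_intros DERIV_chain2[where f = "poly A"] DERIV_chain2[where f = "poly B"]
          simp: poly_DERIV)
    ultimately show ?thesis unfolding AB(3) using DERIV_unique by fastforce
  qed
  ultimately show ?thesis by (simp add: abs_mult)
qed

text \<open>Concavity of the sine: chords from the origin have decreasing slope. Two mean value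
  points and the monotone cosine replace a second derivative.\<close>

lemma sin_chord_le:
  assumes "0 \<le> x" "x \<le> y" "y \<le> pi"
  shows "x * sin y \<le> y * sin x"
proof (cases "x = 0 \<or> x = y")
  case False
  obtain u where u: "0 < u" "u < x" "sin x - sin 0 = (x - 0) * cos u"
    using MVT2[of 0 x sin cos] False assms DERIV_sin by fastforce
  obtain v where v: "x < v" "v < y" "sin y - sin x = (y - x) * cos v"
    using MVT2[of x y sin cos] False assms DERIV_sin by fastforce
  have "cos v \<le> cos u" using u v assms by (intro cos_monotone_0_pi_le) auto
  hence "(y - x) * cos v \<le> (y - x) * cos u"
    using assms by (intro mult_left_mono) auto
  hence "sin y \<le> y * cos u" using u v by (simp add: algebra_simps)
  hence "x * sin y \<le> x * (y * cos u)" using assms by (intro mult_left_mono)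
  thus ?thesis using u by (simp add: algebra_simps)
qed auto

text \<open>Bernstein's factor sin t degenerates near the end points. There Schur's inequality,
  applied to the derivative, trades the sine for a factor r; elsewhere sin t is at least 1/r.
  Negative \<open>x\<close> follow by reflection.\<close>

theorem Markov_inequality:
  fixes p :: "real poly"
  assumes bd: "\<And>x. \<bar>x\<bar> \<le> 1 \<Longrightarrow> \<bar>poly p x\<bar> \<le> K" and deg: "degree p \<le> r" and r: "0 < r"
    and x: "\<bar>x\<bar> \<le> 1"
  shows "\<bar>poly (pderiv p) x\<bar> \<le> (real r)\<^sup>2 * K"
proof -
  have main: "\<bar>poly (pderiv p) x\<bar> \<le> (real r)\<^sup>2 * K"
    if bd: "\<And>x. \<bar>x\<bar> \<le> 1 \<Longrightarrow> \<bar>poly p x\<bar> \<le> K" and deg: "degree p \<le> r" and x: "0 \<le> x" "x \<le> 1"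
    for p :: "real poly" and x
  proof (cases "cheb_node r 0 \<le> x")
    case True
    have "\<bar>poly (pderiv p) x\<bar> \<le> real r * (real r * K)"
      using True x deg r Bernstein_inequality[OF bd deg r]
      by (intro Schur_right) (auto simp: degree_pderiv)
    thus ?thesis by (simp add: power2_eq_square)
  next
    case False
    define t where "t = arccos x"
    have t: "0 \<le> t" "t \<le> pi / 2" "cos t = x" using x using arccos_le_pi2[of x] by (auto simp: t_def arccos_lbound)
    have pr: "pi / (2 * real r) \<le> pi / 2" using r by (simp add: field_simps)
    have "pi / (2 * real r) \<le> t"
    proof (rule ccontr)
      assume "\<not> pi / (2 * real r) \<le> t"
      hence "cos (pi / (2 * real r)) \<le> cos t" using t pr pi_gt_zero by (intro cos_monotone_0_pi_le) linarith+
      thus False using False t by (simp add: cheb_node_def cheb_angle_def)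
    qed
    hence "1 / real r \<le> 2 / pi * t" using r by (simp add: field_simps)
    \<comment> \<open>Jordan's inequality, the chord of the sine over [0, pi/2].\<close>
    also have "\<dots> \<le> sin t" using t sin_chord_le[of t "pi / 2"] by (simp add: field_simps)
    finally have s: "1 / real r \<le> sin t" .
    have "\<bar>poly (pderiv p) x\<bar> * (1 / real r) \<le> \<bar>poly (pderiv p) x\<bar> * sin t"
      using s by (rule mult_left_mono) simp
    also have "\<dots> = \<bar>poly (pderiv p) (cos t) * sin t\<bar>"
    proof -
      have "0 < 1 / real r" using r by simp
      hence "0 < sin t" using s by linarith
      thus ?thesis using t(3) by (simp add: abs_mult)
    qed
    also have "\<dots> \<le> real r * K" by (rule Bernstein_inequality[OF bd deg r])
    finally show ?thesis using r by (simp add: field_simps power2_eq_square)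
  qed
  show ?thesis
  proof (cases "0 \<le> x")
    case True
    thus ?thesis using main[OF bd deg] x by auto
  next
    case False
    have "degree (pcompose p [:0, -1:]) \<le> r" using deg by (simp add: degree_pcompose)
    moreover have "\<bar>poly (pcompose p [:0, -1:]) y\<bar> \<le> K" if "\<bar>y\<bar> \<le> 1" for y
      using bd[of "- y"] that by (simp add: poly_pcompose)
    ultimately have "\<bar>poly (pderiv (pcompose p [:0, -1:])) (- x)\<bar> \<le> (real r)\<^sup>2 * K"
      using main[of "pcompose p [:0, -1:]" "- x"] False x by auto
    thus ?thesis by (simp add: pderiv_pcompose poly_pcompose pderiv_pCons)
  qed
qed

section \<open>The Lebesgue constant of the expanded Chebyshev nodes\<close>

text \<open>One of \<open>p\<close>, \<open>q\<close> may be negative, where the single inequality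
  reverses, so the summands cannot be treated apart. The function \<open>g\<close> is odd and
  nondecreasing, hence g p + g q \<ge> 0 once p \<ge> -q.\<close>

lemma ln_ratio_sum_ge:
  fixes p q :: real
  assumes "\<bar>p\<bar> < 1" "\<bar>q\<bar> < 1" "0 \<le> p + q"
  shows "2 * (p + q) \<le> ln ((1 + p) / (1 - p)) + ln ((1 + q) / (1 - q))"
proof -
  define g where "g x = ln (1 + x) - ln (1 - x) - 2 * x" for x :: real
  have "g (- q) \<le> g p"
  proof (rule DERIV_nonneg_imp_nondecreasing[of "- q" p g])
    show "- q \<le> p" using assms by simp
    fix x assume x: "- q \<le> x" "x \<le> p"
    hence ax: "\<bar>x\<bar> < 1" using assms by auto
    have d: "(g has_real_derivative (1 / (1 + x) + 1 / (1 - x) - 2)) (at x)"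
      unfolding g_def using ax by (auto intro!: derivative_eq_intros)
    have "1 / (1 + x) + 1 / (1 - x) - 2 = 2 * x\<^sup>2 / ((1 + x) * (1 - x))"
    proof -
      have "1 + x > 0" "1 - x > 0" using ax by auto
      thus ?thesis by (simp add: divide_simps power2_eq_square) (simp add: algebra_simps)
    qed
    also have "\<dots> \<ge> 0" using ax by (intro divide_nonneg_nonneg mult_nonneg_nonneg) auto
    finally show "\<exists>y. (g has_real_derivative y) (at x) \<and> 0 \<le> y" using d by blast
  qed
  moreover have "ln ((1 + p) / (1 - p)) = ln (1 + p) - ln (1 - p)"
    "ln ((1 + q) / (1 - q)) = ln (1 + q) - ln (1 - q)"
    using assms by (auto simp: ln_div)
  ultimately show ?thesis unfolding g_def by (simp add: algebra_simps)
qed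

lemma ln_ratio_ge:
  fixes q :: real
  assumes "0 \<le> q" "q < 1"
  shows "2 * q \<le> ln ((1 + q) / (1 - q))"
  using ln_ratio_sum_ge[of q 0] assms by simp

lemma cot_add_cot:
  fixes A B :: real
  assumes "sin A \<noteq> 0" "sin B \<noteq> 0"
  shows "cot A + cot B = sin (A + B) / (sin A * sin B)"
  using assms by (simp add: cot_def sin_add field_simps)

lemma cot_half_sum:
  fixes t u :: real
  assumes "sin ((t - u) / 2) \<noteq> 0" "sin ((t + u) / 2) \<noteq> 0"
  shows "cot ((t - u) / 2) + cot ((t + u) / 2) = 2 * (sin t / (cos u - cos t))"
proof -
  have "(t - u) / 2 + (t + u) / 2 = t" by (simp add: field_simps)
  moreover have "cos u - cos t = 2 * (sin ((t - u) / 2) * sin ((t + u) / 2))"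
    by (simp add: cos_diff_cos algebra_simps)
  ultimately show ?thesis using cot_add_cot[OF assms] by simp
qed

text \<open>Midpoint rule for the convex function
  \<open>x \<mapsto> sin x / (cos u - cos x)\<close> on \<open>[t - \<phi>, t + \<phi>]\<close>; its primitive is \<open>ln (cos u - cos x)\<close>.\<close>

lemma midpoint_bound:
  fixes t u \<phi> :: real
  assumes u: "0 < u" "u < pi" and \<phi>: "0 < \<phi>" "\<phi> < pi / 2" and t: "u + \<phi> < t" "t + \<phi> \<le> pi"
  shows "2 * \<phi> * (sin t / (cos u - cos t)) \<le> ln (cos u - cos (t + \<phi>)) - ln (cos u - cos (t - \<phi>))"
proof -
  define \<delta> A B where "\<delta> = \<phi> / 2" and "A = (t - u) / 2" and "B = (t + u) / 2"
  have d: "0 < \<delta>" "\<delta> < pi / 4" using \<phi> by (auto simp: \<delta>_def)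
  have A: "0 < A - \<delta>" "A + \<delta> < pi" "0 < A" "A < pi"
    and B: "0 < B - \<delta>" "B + \<delta> < pi" "0 < B" "B < pi"
    using t u \<phi> unfolding A_def B_def \<delta>_def by (auto simp: field_simps)
  have AB: "A + B = t" unfolding A_def B_def by (simp add: field_simps)
  have cd: "cos \<delta> > 0" using d by (intro cos_gt_zero) auto
  have td: "\<delta> \<le> tan \<delta>" using abs_tan_ge[of \<delta>] d tan_gt_zero[of \<delta>] by auto
  \<comment> \<open>The factorization that converts logarithms of (1 + tan \<delta> cot x)/(1 - tan
    \<delta> cot x) into logarithms of sines, and thus into the primitive at the two ends of the
    interval. Replacing \<delta> by the larger tan \<delta> is what makes it available.\<close>
  have eq: "sin (x + \<delta>) = cos \<delta> * sin x * (1 + tan \<delta> * cot x) \<and>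
      sin (x - \<delta>) = cos \<delta> * sin x * (1 - tan \<delta> * cot x)" if "0 < x" "x < pi" for x
    using cd sin_gt_zero[OF that] by (simp add: sin_add sin_diff tan_def cot_def field_simps)
  have pos: "1 + tan \<delta> * cot x > 0 \<and> 1 - tan \<delta> * cot x > 0"
    if "0 < x" "x < pi" "0 < x - \<delta>" "x + \<delta> < pi" for x
  proof -
    have "sin (x + \<delta>) > 0" "sin (x - \<delta>) > 0" using that d by (auto intro!: sin_gt_zero)
    moreover have "cos \<delta> * sin x > 0" using cd sin_gt_zero[OF that(1,2)] by simp
    ultimately show ?thesis using eq[OF that(1,2)] by (metis zero_less_mult_pos)
  qed
  have pA: "1 + tan \<delta> * cot A > 0" "1 - tan \<delta> * cot A > 0" using pos[of A] A by auto
  have pB: "1 + tan \<delta> * cot B > 0" "1 - tan \<delta> * cot B > 0" using pos[of B] B by auto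
  have sA: "sin A > 0" "sin B > 0" using A B by (auto intro!: sin_gt_zero)
  have cc: "cot A + cot B \<ge> 0"
    unfolding cot_add_cot[OF less_imp_neq[OF sA(1), symmetric] less_imp_neq[OF sA(2), symmetric]] AB
    using sA t u \<phi> by (intro divide_nonneg_pos sin_ge_zero) auto
  have "2 * \<phi> * (sin t / (cos u - cos t)) = 2 * \<delta> * (cot A + cot B)"
    using cot_half_sum[of t u] sA unfolding A_def B_def \<delta>_def by simp
  also have "\<dots> \<le> 2 * (tan \<delta> * cot A + tan \<delta> * cot B)"
    using mult_right_mono[OF td cc] by (simp add: algebra_simps)
  also have "\<dots> \<le> ln ((1 + tan \<delta> * cot A) / (1 - tan \<delta> * cot A))
      + ln ((1 + tan \<delta> * cot B) / (1 - tan \<delta> * cot B))"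
  proof (rule ln_ratio_sum_ge)
    show "0 \<le> tan \<delta> * cot A + tan \<delta> * cot B"
      using cc td d by (simp flip: distrib_left)
  qed (use pA pB in auto)
  also have "\<dots> = ln (sin (A + \<delta>) * sin (B + \<delta>)) - ln (sin (A - \<delta>) * sin (B - \<delta>))"
    using eq[of A] eq[of B] A B pA pB cd sA by (simp add: ln_mult ln_div)
  also have "\<dots> = ln (2 * (sin (A + \<delta>) * sin (B + \<delta>))) - ln (2 * (sin (A - \<delta>) * sin (B - \<delta>)))"
    using A B d sin_gt_zero[of "A + \<delta>"] sin_gt_zero[of "A - \<delta>"] sin_gt_zero[of "B + \<delta>"]
      sin_gt_zero[of "B - \<delta>"] by (simp add: ln_mult)
  also have "2 * (sin (A + \<delta>) * sin (B + \<delta>)) = cos u - cos (t + \<phi>)"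
  proof -
    have "A + \<delta> - (B + \<delta>) = - u" "A + \<delta> + (B + \<delta>) = t + \<phi>"
      unfolding A_def B_def \<delta>_def by (auto simp: field_simps)
    thus ?thesis by (simp only: sin_times_sin) simp
  qed
  also have "2 * (sin (A - \<delta>) * sin (B - \<delta>)) = cos u - cos (t - \<phi>)"
  proof -
    have "A - \<delta> - (B - \<delta>) = - u" "A - \<delta> + (B - \<delta>) = t - \<phi>"
      unfolding A_def B_def \<delta>_def by (auto simp: field_simps)
    thus ?thesis by (simp only: sin_times_sin) simp
  qed
  finally show ?thesis .
qed

lemma midpoint_bound_left:
  fixes t u \<phi> :: real
  assumes u: "0 < u" "u < pi" and \<phi>: "0 < \<phi>" "\<phi> < pi / 2" and t: "t + \<phi> < u" "0 \<le> t - \<phi>"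
  shows "2 * \<phi> * (sin t / (cos t - cos u)) \<le> ln (cos (t - \<phi>) - cos u) - ln (cos (t + \<phi>) - cos u)"
proof -
  have e: "pi - t + \<phi> = pi - (t - \<phi>)" "pi - t - \<phi> = pi - (t + \<phi>)" by simp_all
  show ?thesis
    using midpoint_bound[of "pi - u" \<phi> "pi - t"] assms unfolding e by (simp del: diff_diff_eq2)
qed

section \<open>Contributions of the far and of the adjacent nodes\<close>

lemma cheb_angle_mult: "cheb_angle n k = 2 * real k * (pi / (2 * real n)) + pi / (2 * real n)"
  by (simp add: cheb_angle_def algebra_simps add_divide_distrib)

text \<open>Each node angle is the midpoint of a cell of width 2\<phi>, so the midpoint bounds
  telescope. Node \<open>j\<close> itself is left out: the evaluation angle may lie in its cell,
  where the primitive is singular. The last cell ends at pi, which gives ln (1 + cos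
  \<theta>).\<close>

lemma far_terms_right:
  assumes n: "2 \<le> n" and j: "j < n" and \<theta>: "0 < \<theta>" "\<theta> < cheb_angle n j"
  shows "(\<Sum>k\<in>{Suc j..<n}. sin (cheb_angle n k) / (cos \<theta> - cheb_node n k)) / real n
    \<le> (ln (1 + cos \<theta>) - ln (cos \<theta> - cos (2 * real (Suc j) * (pi / (2 * real n))))) / pi"
proof -
  define \<phi> where "\<phi> = pi / (2 * real n)"
  have \<phi>: "0 < \<phi>" "\<phi> < pi / 2" "2 * real n * \<phi> = pi" using n by (auto simp: \<phi>_def field_simps)
  define f where "f k = ln (cos \<theta> - cos (2 * real k * \<phi>))" for k
  have "\<theta> < pi" using \<theta> cheb_angle_bounds[OF j] by linarith
  have term_le: "2 * \<phi> * (sin (cheb_angle n k) / (cos \<theta> - cheb_node n k)) \<le> f (Suc k) - f k"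
    if k: "k \<in> {Suc j..<n}" for k
  proof -
    have e: "cheb_angle n k + \<phi> = 2 * real (Suc k) * \<phi>" "cheb_angle n k - \<phi> = 2 * real k * \<phi>"
      unfolding cheb_angle_mult \<phi>_def[symmetric] by (simp_all add: algebra_simps)
    have "real (Suc k) \<le> real n" using k by simp
    hence "2 * real (Suc k) * \<phi> \<le> 2 * real n * \<phi>"
      using \<phi> by (intro mult_right_mono mult_left_mono) auto
    moreover have "\<theta> + \<phi> < cheb_angle n k"
    proof -
      have "2 * real (Suc j) * \<phi> \<le> 2 * real k * \<phi>"
        using k \<phi> by (intro mult_right_mono mult_left_mono) auto
      thus ?thesis using \<theta>(2) \<phi> unfolding cheb_angle_mult \<phi>_def[symmetric] by (simp add: algebra_simps)
    qed
    ultimately show ?thesis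
      using midpoint_bound[of \<theta> \<phi> "cheb_angle n k"] \<open>\<theta> < pi\<close> \<theta> \<phi> e
      unfolding f_def cheb_node_def by simp
  qed
  have "2 * \<phi> * (\<Sum>k\<in>{Suc j..<n}. sin (cheb_angle n k) / (cos \<theta> - cheb_node n k)) \<le>
      (\<Sum>k\<in>{Suc j..<n}. f (Suc k) - f k)"
    unfolding sum_distrib_left by (intro sum_mono term_le)
  also have "\<dots> = f n - f (Suc j)" using j by (intro sum_Suc_diff') simp
  also have "f n = ln (1 + cos \<theta>)" using \<phi>(3) by (simp add: f_def add.commute)
  finally have "pi * ((\<Sum>k\<in>{Suc j..<n}. sin (cheb_angle n k) / (cos \<theta> - cheb_node n k)) / real n)
      \<le> ln (1 + cos \<theta>) - f (Suc j)"
    using n by (simp add: \<phi>_def field_simps)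
  thus ?thesis unfolding f_def \<phi>_def by (simp add: field_simps)
qed

lemma far_terms_left:
  assumes n: "2 \<le> n" and j: "j < n" and \<theta>: "cheb_angle n j < \<theta>" "\<theta> < pi"
  shows "(\<Sum>k<j. sin (cheb_angle n k) / (cheb_node n k - cos \<theta>)) / real n
    \<le> (ln (1 - cos \<theta>) - ln (cos (2 * real j * (pi / (2 * real n))) - cos \<theta>)) / pi"
proof -
  define \<phi> where "\<phi> = pi / (2 * real n)"
  have \<phi>: "0 < \<phi>" "\<phi> < pi / 2" "2 * real n * \<phi> = pi" using n by (auto simp: \<phi>_def field_simps)
  define f where "f k = - ln (cos (2 * real k * \<phi>) - cos \<theta>)" for k
  have "0 < \<theta>" using \<theta> cheb_angle_bounds[OF j] by linarith
  have term_le: "2 * \<phi> * (sin (cheb_angle n k) / (cheb_node n k - cos \<theta>)) \<le> f (Suc k) - f k"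
    if k: "k < j" for k
  proof -
    have e: "cheb_angle n k + \<phi> = 2 * real (Suc k) * \<phi>" "cheb_angle n k - \<phi> = 2 * real k * \<phi>"
      unfolding cheb_angle_mult \<phi>_def[symmetric] by (simp_all add: algebra_simps)
    have "2 * real (Suc k) * \<phi> \<le> 2 * real j * \<phi>"
      using k \<phi> by (intro mult_right_mono mult_left_mono) auto
    hence "cheb_angle n k + \<phi> < \<theta>" using \<theta>(1) \<phi>(1) e(1) unfolding cheb_angle_mult[of n j] \<phi>_def[symmetric] by linarith
    moreover have "0 \<le> cheb_angle n k - \<phi>" using e \<phi> by simp
    ultimately show ?thesis
      using midpoint_bound_left[of \<theta> \<phi> "cheb_angle n k"] \<open>0 < \<theta>\<close> \<theta> \<phi> e
      unfolding f_def cheb_node_def by simp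
  qed
  have "2 * \<phi> * (\<Sum>k<j. sin (cheb_angle n k) / (cheb_node n k - cos \<theta>)) \<le>
      (\<Sum>k<j. f (Suc k) - f k)"
    unfolding sum_distrib_left by (intro sum_mono term_le) simp
  also have "\<dots> = f j - f 0" by (rule sum_lessThan_telescope)
  finally have "pi * ((\<Sum>k<j. sin (cheb_angle n k) / (cheb_node n k - cos \<theta>)) / real n)
      \<le> f j + ln (1 - cos \<theta>)"
    using n by (simp add: \<phi>_def f_def field_simps)
  thus ?thesis unfolding f_def \<phi>_def by (simp add: field_simps)
qed

lemma cot_antimono:
  fixes x y :: real
  assumes "0 < x" "x \<le> y" "y < pi"
  shows "cot y \<le> cot x"
proof -
  have s: "sin x > 0" "sin y > 0" using assms by (auto intro!: sin_gt_zero)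
  have "sin (y - x) \<ge> 0" using assms by (intro sin_ge_zero) auto
  thus ?thesis using s by (simp add: cot_def sin_diff field_simps)
qed

lemma sin_over_one_minus_cos_le:
  fixes x :: real
  assumes "0 < x" "x < pi"
  shows "sin x / (1 - cos x) \<le> 2 / x"
proof -
  have s: "sin (x / 2) > 0" using assms by (intro sin_gt_zero) auto
  have c: "cos (x / 2) > 0" using assms by (intro cos_gt_zero) auto
  have "sin x = 2 * sin (x / 2) * cos (x / 2)" using sin_double[of "x / 2"] by simp
  moreover have "1 - cos x = 2 * sin (x / 2) * sin (x / 2)"
    using cos_double_sin[of "x / 2"] by (simp add: power2_eq_square)
  ultimately have "sin x / (1 - cos x) = 1 / tan (x / 2)" using s c by (simp add: tan_def)
  also have "\<dots> \<le> 1 / (x / 2)"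
    using abs_tan_ge[of "x / 2"] tan_gt_zero[of "x / 2"] assms by (intro divide_left_mono) auto
  finally show ?thesis by simp
qed

text \<open>The two nodes adjacent to the evaluation point contribute at most as much as they do at the
  midpoint, where their contribution is \<open>cot (\<phi> / 2) / n\<close> with \<open>\<phi> = \<pi> / (2 n)\<close>.\<close>

lemma near_terms:
  assumes n: "2 \<le> n" and j: "Suc j < n"
    and \<theta>: "cheb_angle n j < \<theta>" "\<theta> < cheb_angle n (Suc j)"
  shows "\<bar>cos (real n * \<theta>)\<bar> / real n * (sin (cheb_angle n j) / (cheb_node n j - cos \<theta>)
      + sin (cheb_angle n (Suc j)) / (cos \<theta> - cheb_node n (Suc j))) \<le> 4 / pi"
proof -
  define \<phi> \<tau> where "\<phi> = pi / (2 * real n)" and "\<tau> = \<theta> - 2 * real (Suc j) * \<phi>"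
  have \<phi>: "0 < \<phi>" "\<phi> < pi / 2" "2 * real n * \<phi> = pi" using n by (auto simp: \<phi>_def field_simps)
  have t1: "cheb_angle n j = \<theta> - (\<tau> + \<phi>)" "cheb_angle n (Suc j) = \<theta> + (\<phi> - \<tau>)"
    unfolding cheb_angle_mult \<phi>_def[symmetric] \<tau>_def by (simp_all add: algebra_simps)
  have \<tau>: "- \<phi> < \<tau>" "\<tau> < \<phi>" using \<theta> t1 by auto
  have b: "0 < cheb_angle n j" "cheb_angle n (Suc j) < pi" using cheb_angle_bounds j by auto
  have sp: "sin ((\<phi> + \<tau>) / 2) > 0" "sin ((\<phi> - \<tau>) / 2) > 0"
    using \<tau> \<phi> by (auto intro!: sin_gt_zero)
  have sp2: "sin ((\<theta> + cheb_angle n j) / 2) > 0" "sin ((cheb_angle n (Suc j) + \<theta>) / 2) > 0"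
    using b \<theta> by (auto intro!: sin_gt_zero)
  have 1: "2 * (sin (cheb_angle n (Suc j)) / (cos \<theta> - cheb_node n (Suc j)))
      = cot ((\<phi> - \<tau>) / 2) + cot ((cheb_angle n (Suc j) + \<theta>) / 2)"
    unfolding cheb_node_def using cot_half_sum[of "cheb_angle n (Suc j)" \<theta>] sp sp2 t1 by simp
  have 2: "2 * (sin (cheb_angle n j) / (cheb_node n j - cos \<theta>))
      = cot ((\<phi> + \<tau>) / 2) - cot ((\<theta> + cheb_angle n j) / 2)"
  proof -
    have "cot ((cheb_angle n j - \<theta>) / 2) = - cot ((\<phi> + \<tau>) / 2)"
    proof -
      have "(cheb_angle n j - \<theta>) / 2 = - ((\<phi> + \<tau>) / 2)" unfolding t1 by (simp add: field_simps)
      thus ?thesis by (simp only: cot_def cos_minus sin_minus)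
    qed
    moreover have "(cheb_angle n j - \<theta>) / 2 = - ((\<phi> + \<tau>) / 2)" unfolding t1 by (simp add: field_simps)
    hence "sin ((cheb_angle n j - \<theta>) / 2) \<noteq> 0" using sp(1) by (simp only: sin_minus)
    ultimately have "- cot ((\<phi> + \<tau>) / 2) + cot ((\<theta> + cheb_angle n j) / 2)
        = 2 * (sin (cheb_angle n j) / (cos \<theta> - cheb_node n j))"
      using cot_half_sum[of "cheb_angle n j" \<theta>] sp2(1) by (simp add: cheb_node_def add.commute)
    also have "sin (cheb_angle n j) / (cos \<theta> - cheb_node n j)
        = - (sin (cheb_angle n j) / (cheb_node n j - cos \<theta>))"
      by (metis minus_diff_eq minus_divide_right)
    finally show ?thesis by simp
  qed
  \<comment> \<open>The two cotangents of half sums enter with opposite signs, and by monotonicity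
    their total contribution is not positive.\<close>
  have "cot ((cheb_angle n (Suc j) + \<theta>) / 2) \<le> cot ((\<theta> + cheb_angle n j) / 2)"
    using b \<theta> by (intro cot_antimono) auto
  hence "2 * (sin (cheb_angle n j) / (cheb_node n j - cos \<theta>)
      + sin (cheb_angle n (Suc j)) / (cos \<theta> - cheb_node n (Suc j)))
      \<le> cot ((\<phi> - \<tau>) / 2) + cot ((\<phi> + \<tau>) / 2)"
    unfolding distrib_left 1 2 by simp
  also have "\<dots> = 2 * (sin \<phi> / (cos \<tau> - cos \<phi>))"
    using sp by (intro cot_half_sum) auto
  finally have le: "sin (cheb_angle n j) / (cheb_node n j - cos \<theta>)
      + sin (cheb_angle n (Suc j)) / (cos \<theta> - cheb_node n (Suc j)) \<le> sin \<phi> / (cos \<tau> - cos \<phi>)" by simp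
  have ang0: "cheb_angle n 0 = \<phi>" by (simp add: cheb_angle_def \<phi>_def)
  have cos\<tau>: "cos \<phi> < cos \<tau>"
    using \<tau> \<phi> cos_monotone_0_pi[of "\<bar>\<tau>\<bar>" \<phi>] by (auto simp: abs_less_iff cos_abs_real)
  have w: "\<bar>cos (real n * \<theta>)\<bar> = \<bar>cos (real n * \<tau>)\<bar>"
  proof -
    have "real n * \<theta> = real n * \<tau> + real (Suc j) * (2 * real n * \<phi>)"
      unfolding \<tau>_def by (simp add: algebra_simps)
    hence "real n * \<theta> = real n * \<tau> + real (Suc j) * pi" unfolding \<phi>(3) .
    thus ?thesis by (simp only: cos_add sin_npi cos_npi) (simp add: abs_mult power_abs)
  qed
  have "\<bar>cos (real n * \<theta>)\<bar> / real n * (sin (cheb_angle n j) / (cheb_node n j - cos \<theta>)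
      + sin (cheb_angle n (Suc j)) / (cos \<theta> - cheb_node n (Suc j)))
      \<le> \<bar>cos (real n * \<tau>)\<bar> / real n * (sin \<phi> / (cos \<tau> - cos \<phi>))"
    unfolding w by (intro mult_left_mono le) auto
  also have "\<dots> = \<bar>lagrange n (cheb_node n) 0 (cos \<tau>)\<bar>"
    using abs_lagrange_cheb_node_cos[of 0 n \<tau>] n cos\<tau> by (simp add: cheb_node_def ang0)
  \<comment> \<open>After the symmetrization the expression is the fundamental polynomial of the
    largest node, evaluated at cos \<tau>. To the right of that node every factor grows with the
    argument, so its value at 1 is an upper bound.\<close>
  also have "\<dots> \<le> \<bar>lagrange n (cheb_node n) 0 (cos 0)\<bar>"
  proof -
    have "\<bar>cos \<tau> - cheb_node n i\<bar> \<le> \<bar>cos 0 - cheb_node n i\<bar>" if "i < n" for i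
    proof -
      have "cheb_node n i \<le> cheb_node n 0"
        using cheb_node_less[of 0 i n] that by (cases "i = 0") auto
      thus ?thesis using cos\<tau> cos_le_one[of \<tau>] unfolding cheb_node_def ang0 by simp
    qed
    moreover have "sin \<phi> \<ge> 0" using \<phi> by (intro sin_ge_zero) auto
    ultimately show ?thesis using n
      by (subst (1 2) abs_lagrange_cheb_node) (auto simp: ang0 intro!: divide_right_mono mult_left_mono prod_mono)
  qed
  also have "\<dots> = 1 / real n * (sin \<phi> / (1 - cos \<phi>))"
    using abs_lagrange_cheb_node_cos[of 0 n 0] n cos\<tau> cos_le_one[of \<tau>] by (simp add: cheb_node_def ang0)
  also have "\<dots> \<le> 1 / real n * (2 / \<phi>)"
    using \<phi> by (intro mult_left_mono sin_over_one_minus_cos_le) auto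
  also have "\<dots> = 4 / pi" using n by (simp add: \<phi>_def)
  finally show ?thesis .
qed

section \<open>Numerical constants and Taylor estimates\<close>

lemma pi_bounds: "314 / 100 < pi" "pi < 3146 / 1000"
proof -
  \<comment> \<open>With its remainder, the Taylor polynomial of degree 5 decides on which side of
    pi/6, where the sine is 1/2, a rational number lies.\<close>
  have s: "\<bar>sin x - (x - x ^ 3 / 6 + x ^ 5 / 120)\<bar> \<le> \<bar>x\<bar> ^ 7 / 5040" for x :: real
    using Maclaurin_sin_bound[of x 7]
    by (simp add: sin_coeff_def fact_numeral lessThan_nat_numeral lessThan_Suc power_numeral_reduce field_simps)
  have "sin (314 / 600 :: real) \<le> 314 / 600 - (314 / 600) ^ 3 / 6 + (314 / 600) ^ 5 / 120 + (314 / 600) ^ 7 / 5040"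
    using abs_le_D1[OF s[of "314 / 600"]] by simp
  also have "\<dots> < 1 / 2" by (simp add: power_divide)
  finally have "sin (314 / 600) < sin (pi / 6 :: real)" by (simp add: sin_30)
  show "314 / 100 < pi"
  proof (rule ccontr)
    assume "\<not> 314 / 100 < pi"
    hence "sin (pi / 6) \<le> sin (314 / 600)"
      using pi_gt3 by (intro sin_monotone_2pi_le) auto
    thus False using \<open>sin (314 / 600) < sin (pi / 6 :: real)\<close> by simp
  qed
  have "(1 / 2 :: real) < 3146 / 6000 - (3146 / 6000) ^ 3 / 6 + (3146 / 6000) ^ 5 / 120 - (3146 / 6000) ^ 7 / 5040"
    by (simp add: power_divide)
  also have "\<dots> \<le> sin (3146 / 6000)"
    using abs_le_D2[OF s[of "3146 / 6000"]] by simp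
  finally have "sin (pi / 6) < sin (3146 / 6000)" by (simp add: sin_30)
  show "pi < 3146 / 1000"
  proof (rule ccontr)
    assume "\<not> pi < 3146 / 1000"
    hence "sin (3146 / 6000) \<le> sin (pi / 6 :: real)"
      by (intro sin_monotone_2pi_le) auto
    thus False using \<open>sin (pi / 6) < sin (3146 / 6000 :: real)\<close> by simp
  qed
qed

text \<open>Compares the 4/pi of the adjacent nodes with the 3/4 in \<open>psi\<close>. The
  witnesses 1/21 and 14/1014 are the arguments at which (1 + q)/(1 - q) equals 1.1 and 1.028; the
  product 1.1^17 * 1.028 lies just below 5.2.\<close>

lemma ln_52_10_gt: "4 - 3 / 4 * pi < ln (52 / 10)"
proof -
  have "17 * (2 * (1 / 21)) + 2 * (14 / 1014) \<le> 17 * ln (11 / 10) + ln (1028 / 1000 :: real)"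
    using ln_ratio_ge[of "1 / 21"] ln_ratio_ge[of "14 / 1014"] by simp
  also have "\<dots> = ln ((11 / 10) ^ 17 * (1028 / 1000))"
    by (subst ln_mult) (auto simp: ln_realpow)
  also have "\<dots> \<le> ln (52 / 10)" by (subst ln_le_cancel_iff) (auto simp: eval_nat_numeral)
  finally show ?thesis using pi_bounds by simp
qed

lemma cos_ge_quadratic: "1 - x\<^sup>2 / 2 \<le> cos (x :: real)"
proof -
  have "\<bar>sin (x / 2)\<bar> \<le> \<bar>x / 2\<bar>" by (rule abs_sin_x_le_abs_x)
  hence "(sin (x / 2))\<^sup>2 \<le> (x / 2)\<^sup>2" by (simp only: abs_le_square_iff)
  thus ?thesis using cos_double_sin[of "x / 2"] by (simp add: power2_eq_square field_simps)
qed

lemma sin_ge_cubic: "0 \<le> x \<Longrightarrow> x - x ^ 3 / 6 \<le> sin (x :: real)"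
proof -
  assume "0 \<le> x"
  hence "\<bar>sin x - x\<bar> \<le> x ^ 3 / 6"
    using Maclaurin_sin_bound[of x 3] by (simp add: sin_coeff_def eval_nat_numeral field_simps)
  from abs_le_D2[OF this] show ?thesis by simp
qed

lemma cos_double_le:
  fixes x :: real
  assumes "0 \<le> x" "x \<le> 1"
  shows "cos (2 * x) \<le> 1 - 2 * x\<^sup>2 + 2 / 3 * x ^ 4"
proof -
  have "x * x\<^sup>2 \<le> x * 1" using assms by (intro mult_left_mono power_le_one) auto
  hence "0 \<le> x - x ^ 3 / 6" using assms by (simp add: power3_eq_cube power2_eq_square)
  hence "(x - x ^ 3 / 6)\<^sup>2 \<le> (sin x)\<^sup>2" using sin_ge_cubic[OF assms(1)] by (intro power_mono)
  moreover have "(x - x ^ 3 / 6)\<^sup>2 = x\<^sup>2 - x ^ 4 / 3 + (x ^ 3 / 6)\<^sup>2"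
    by (simp add: power2_eq_square field_simps eval_nat_numeral)
  moreover have "0 \<le> (x ^ 3 / 6)\<^sup>2" by simp
  ultimately show ?thesis unfolding cos_double_sin by linarith
qed

text \<open>Reduces a trigonometric inequality to a polynomial one in \<phi>^2: an upper Taylor
  bound for cos (2\<phi>) on the left, a lower one for cos x on the right. The parameter
  \<open>k\<close> measures how far \<open>x\<close> may extend in units of \<phi>.\<close>

lemma cos_sq_double_le:
  fixes \<phi> k m :: real
  assumes \<phi>: "0 < \<phi>" "\<phi> \<le> pi / 6" and k: "0 \<le> k" "k \<le> 3 / 2"
    and poly: "(1 - 2 * \<phi>\<^sup>2 + 2 / 3 * \<phi>\<^sup>2 ^ 2)\<^sup>2 \<le> (1 - k\<^sup>2 / 2 * \<phi>\<^sup>2)\<^sup>2 * (1 - m * \<phi>\<^sup>2)"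
    and x: "0 \<le> x" "x \<le> k * \<phi>" and m: "m * \<phi>\<^sup>2 \<le> 1"
  shows "(cos (2 * \<phi>))\<^sup>2 \<le> (cos x)\<^sup>2 * (1 - m * \<phi>\<^sup>2)"
proof -
  have p6: "\<phi> < 1" using \<phi> pi_bounds by simp
  have c0: "0 \<le> cos (2 * \<phi>)" using \<phi> by (intro cos_ge_zero) auto
  have "cos (2 * \<phi>) \<le> 1 - 2 * \<phi>\<^sup>2 + 2 / 3 * \<phi>\<^sup>2 ^ 2"
    using cos_double_le[of \<phi>] \<phi> p6 by simp
  hence "(cos (2 * \<phi>))\<^sup>2 \<le> (1 - 2 * \<phi>\<^sup>2 + 2 / 3 * \<phi>\<^sup>2 ^ 2)\<^sup>2" using c0 by (intro power_mono)
  also note poly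
  also have "(1 - k\<^sup>2 / 2 * \<phi>\<^sup>2)\<^sup>2 * (1 - m * \<phi>\<^sup>2) \<le> (cos x)\<^sup>2 * (1 - m * \<phi>\<^sup>2)"
  proof (intro mult_right_mono power_mono)
    have "x\<^sup>2 \<le> (k * \<phi>)\<^sup>2" using x by (intro power_mono)
    thus "1 - k\<^sup>2 / 2 * \<phi>\<^sup>2 \<le> cos x" using cos_ge_quadratic[of x] by (simp add: power_mult_distrib)
    have "\<phi> \<le> 3146 / 6000" using \<phi> pi_bounds by simp
    hence "(k * \<phi>)\<^sup>2 \<le> (3 / 2 * (3146 / 6000))\<^sup>2" using k \<phi> by (intro power_mono mult_mono) auto
    also have "\<dots> \<le> 2" by (simp add: power2_eq_square)
    finally show "0 \<le> 1 - k\<^sup>2 / 2 * \<phi>\<^sup>2" by (simp add: power_mult_distrib)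
  qed (use m in simp)
  finally show ?thesis .
qed

lemma phi_sq_le: "0 < \<phi> \<Longrightarrow> \<phi> \<le> pi / 6 \<Longrightarrow> \<phi>\<^sup>2 \<le> 275 / 1000"
proof -
  assume "0 < \<phi>" "\<phi> \<le> pi / 6"
  hence "\<phi>\<^sup>2 \<le> (3146 / 6000)\<^sup>2" using pi_bounds by (intro power_mono) auto
  thus ?thesis by (simp add: power2_eq_square)
qed

text \<open>For \<open>n\<close> nodes, \<open>\<phi> = \<pi> / (2 n)\<close> and evaluation points at distance \<open>\<bar>\<tau>\<bar>\<close> from the midpoint between
  two nodes, the Lebesgue bound needs a lower bound \<open>5.2 / n\<^sup>2\<close> for \<open>\<bar>\<tau>\<bar> \<le> \<phi> / 2\<close> and \<open>4.2 / n\<^sup>2\<close> otherwise,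
  since \<open>exp (4 - 3 \<pi> / 4) < 5.2\<close>; the constants \<open>2.11\<close> and \<open>1.71\<close> slightly exceed
  \<open>5.2 \<cdot> 4 / \<pi>\<^sup>2\<close> and \<open>4.2 \<cdot> 4 / \<pi>\<^sup>2\<close>.\<close>

lemma poly_bound_171:
  fixes u :: real
  assumes "0 \<le> u" "u \<le> 275 / 1000"
  shows "(1 - 2 * u + 2 / 3 * u\<^sup>2)\<^sup>2 \<le> (1 - 9 / 8 * u)\<^sup>2 * (1 - 171 / 100 * u)"
proof -
  \<comment> \<open>The difference of the two sides is u times a cubic. Bounding u^3 by 0.275 u^2
    leaves a quadratic, whose nonnegativity this square certifies.\<close>
  have "0 \<le> 38 / 100 * (u - 29 / 100)\<^sup>2" by simp
  moreover have "u * u * u \<le> u * u * (275 / 1000)" using assms by (intro mult_left_mono) auto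
  moreover have "0 \<le> u * u" by simp
  ultimately have "0 \<le> 1 / 25 - 1057 / 4800 * u + 9647 / 19200 * (u * u) - 4 / 9 * (u * u * u)"
    using assms by (simp add: power2_eq_square algebra_simps)
  hence "0 \<le> u * (1 / 25 - 1057 / 4800 * u + 9647 / 19200 * (u * u) - 4 / 9 * (u * u * u))"
    using assms(1) by (rule mult_nonneg_nonneg[rotated])
  also have "\<dots> = (1 - 9 / 8 * u)\<^sup>2 * (1 - 171 / 100 * u) - (1 - 2 * u + 2 / 3 * u\<^sup>2)\<^sup>2"
    by (simp add: power2_eq_square field_simps)
  finally show ?thesis by simp
qed

lemma poly_bound_211:
  fixes u :: real
  assumes "0 \<le> u" "u \<le> 275 / 1000"
  shows "(1 - 2 * u + 2 / 3 * u\<^sup>2)\<^sup>2 \<le> (1 - 25 / 32 * u)\<^sup>2 * (1 - 211 / 100 * u)"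
proof -
  \<comment> \<open>The same reduction; here the quadratic decreases up to the end of the range, so
    the square is centred there.\<close>
  have "0 \<le> (u - 275 / 1000)\<^sup>2" by simp
  moreover have "u * u * u \<le> u * u * (275 / 1000)" using assms by (intro mult_left_mono) auto
  moreover have "0 \<le> u * u" by simp
  ultimately have "0 \<le> 131 / 400 - 4381 / 3072 * u + 16943 / 12288 * (u * u) - 4 / 9 * (u * u * u)"
    using assms by (simp add: power2_eq_square algebra_simps)
  hence "0 \<le> u * (131 / 400 - 4381 / 3072 * u + 16943 / 12288 * (u * u) - 4 / 9 * (u * u * u))"
    using assms(1) by (rule mult_nonneg_nonneg[rotated])
  also have "\<dots> = (1 - 25 / 32 * u)\<^sup>2 * (1 - 211 / 100 * u) - (1 - 2 * u + 2 / 3 * u\<^sup>2)\<^sup>2"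
    by (simp add: power2_eq_square field_simps)
  finally show ?thesis by simp
qed

text \<open>The two extreme cases of \<open>chebyshev_gap_left\<close>: the angle \<theta> = 2\<phi>
  + \<tau>, with the common factor 1 - cos (2\<phi> + \<tau>) cancelled, and the angle \<theta> =
  pi/2.\<close>

lemma chebyshev_gap_end:
  fixes \<phi> \<tau> :: real
  assumes \<phi>: "0 < \<phi>" "\<phi> \<le> pi / 6" and \<tau>: "\<bar>\<tau>\<bar> \<le> \<phi>"
    and m: "m = 171 / 100 * \<phi>\<^sup>2 \<or> m = 211 / 100 * \<phi>\<^sup>2 \<and> \<bar>\<tau>\<bar> \<le> \<phi> / 2"
  shows "m * (1 + cos (2 * \<phi> + \<tau>)) \<le> cos (2 * \<phi> + \<tau>) - cos (4 * \<phi>)"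
    and "m \<le> sin (2 * \<phi> - \<tau>) * sin (2 * \<phi> + \<tau>)"
proof -
  define u where "u = \<phi>\<^sup>2"
  have u: "0 \<le> u" "u \<le> 275 / 1000" using phi_sq_le[OF \<phi>] by (auto simp: u_def)
  have "(cos (2 * \<phi>))\<^sup>2 \<le> (cos ((2 * \<phi> + \<tau>) / 2))\<^sup>2 * (1 - m)"
  proof (rule disjE[OF m])
    assume m: "m = 171 / 100 * \<phi>\<^sup>2"
    show ?thesis unfolding m
    proof (rule cos_sq_double_le[OF \<phi>, of "3 / 2"])
      show "(1 - 2 * \<phi>\<^sup>2 + 2 / 3 * \<phi>\<^sup>2 ^ 2)\<^sup>2 \<le> (1 - (3 / 2)\<^sup>2 / 2 * \<phi>\<^sup>2)\<^sup>2 * (1 - 171 / 100 * \<phi>\<^sup>2)"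
        using poly_bound_171[of "\<phi>\<^sup>2"] u unfolding u_def by (simp add: power_divide)
    qed (use \<phi> \<tau> u in \<open>auto simp: u_def\<close>)
  next
    assume m: "m = 211 / 100 * \<phi>\<^sup>2 \<and> \<bar>\<tau>\<bar> \<le> \<phi> / 2"
    have "(cos (2 * \<phi>))\<^sup>2 \<le> (cos ((2 * \<phi> + \<tau>) / 2))\<^sup>2 * (1 - 211 / 100 * \<phi>\<^sup>2)"
    proof (rule cos_sq_double_le[OF \<phi>, of "5 / 4"])
      show "(1 - 2 * \<phi>\<^sup>2 + 2 / 3 * \<phi>\<^sup>2 ^ 2)\<^sup>2 \<le> (1 - (5 / 4)\<^sup>2 / 2 * \<phi>\<^sup>2)\<^sup>2 * (1 - 211 / 100 * \<phi>\<^sup>2)"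
        using poly_bound_211[of "\<phi>\<^sup>2"] u unfolding u_def by (simp add: power_divide)
    qed (use \<phi> \<tau> u m in \<open>auto simp: u_def\<close>)
    moreover have "m = 211 / 100 * \<phi>\<^sup>2" using m by simp
    ultimately show ?thesis by (simp only:)
  qed
  moreover have "cos (2 * \<phi> + \<tau>) = 2 * (cos ((2 * \<phi> + \<tau>) / 2))\<^sup>2 - 1"
  proof -
    have "2 * ((2 * \<phi> + \<tau>) / 2) = 2 * \<phi> + \<tau>" by (simp add: field_simps)
    thus ?thesis using cos_double_cos[of "(2 * \<phi> + \<tau>) / 2"] by (simp only:)
  qed
  moreover have "cos (4 * \<phi>) = 2 * (cos (2 * \<phi>))\<^sup>2 - 1"
    using cos_double_cos[of "2 * \<phi>"] by simp
  ultimately show "m * (1 + cos (2 * \<phi> + \<tau>)) \<le> cos (2 * \<phi> + \<tau>) - cos (4 * \<phi>)"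
    by (simp add: algebra_simps)
  \<comment> \<open>The chord of the sine over [0, pi/3], squared. It leads to the coefficient 2.72,
    which covers both 1.71 + 1 and 2.11 + 1/4.\<close>
  have s2: "27 / pi\<^sup>2 * u \<le> (sin (2 * \<phi>))\<^sup>2"
  proof -
    have "2 * \<phi> * sin (pi / 3) \<le> pi / 3 * sin (2 * \<phi>)" using \<phi> by (intro sin_chord_le) auto
    hence "3 * sqrt 3 / pi * \<phi> \<le> sin (2 * \<phi>)" by (simp add: sin_60 field_simps)
    hence "(3 * sqrt 3 / pi * \<phi>)\<^sup>2 \<le> (sin (2 * \<phi>))\<^sup>2" using \<phi> by (intro power_mono) auto
    thus ?thesis by (simp add: u_def power_mult_distrib power_divide)
  qed
  have "pi\<^sup>2 \<le> (3146 / 1000)\<^sup>2" using pi_bounds by (intro power_mono) auto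
  hence "272 / 100 \<le> 27 / pi\<^sup>2" by (simp add: field_simps power2_eq_square)
  hence "272 / 100 * u \<le> 27 / pi\<^sup>2 * u" using u by (intro mult_right_mono)
  hence s2': "272 / 100 * u \<le> (sin (2 * \<phi>))\<^sup>2" using s2 by linarith
  have st: "(sin \<tau>)\<^sup>2 \<le> \<tau>\<^sup>2" using abs_sin_x_le_abs_x[of \<tau>] by (simp only: abs_le_square_iff)
  have eq: "sin (2 * \<phi> - \<tau>) * sin (2 * \<phi> + \<tau>) = (sin (2 * \<phi>))\<^sup>2 - (sin \<tau>)\<^sup>2"
  proof -
    have "(sin (2 * \<phi>) * cos \<tau>)\<^sup>2 - (cos (2 * \<phi>) * sin \<tau>)\<^sup>2
      = (sin (2 * \<phi>))\<^sup>2 * (1 - (sin \<tau>)\<^sup>2) - (1 - (sin (2 * \<phi>))\<^sup>2) * (sin \<tau>)\<^sup>2"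
      unfolding power_mult_distrib cos_squared_eq ..
    thus ?thesis by (simp add: sin_add sin_diff power2_eq_square algebra_simps)
  qed
  show "m \<le> sin (2 * \<phi> - \<tau>) * sin (2 * \<phi> + \<tau>)"
  proof (rule disjE[OF m])
    assume m: "m = 171 / 100 * \<phi>\<^sup>2"
    have "\<tau>\<^sup>2 \<le> u" using \<tau> abs_le_square_iff[of \<tau> \<phi>] \<phi> unfolding u_def by simp
    thus ?thesis unfolding eq m u_def[symmetric] using s2' st u(1) by linarith
  next
    assume m: "m = 211 / 100 * \<phi>\<^sup>2 \<and> \<bar>\<tau>\<bar> \<le> \<phi> / 2"
    hence "\<tau>\<^sup>2 \<le> (\<phi> / 2)\<^sup>2" using abs_le_square_iff[of \<tau> "\<phi> / 2"] \<phi> by simp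
    hence "\<tau>\<^sup>2 \<le> u / 4" by (simp add: u_def power_divide)
    thus ?thesis unfolding eq u_def[symmetric] using m s2' st u by (simp add: u_def[symmetric])
  qed
qed

text \<open>Divided by sin^2 \<theta>, the right-hand side is a quadratic in cot \<theta> with
  leading coefficient -e \<le> 0. Being concave, it is at least \<open>m\<close> between 0 and cot
  (2\<phi> + \<tau>) once it is so at these two points.\<close>

lemma chebyshev_gap_left:
  fixes \<phi> \<tau> \<theta> m :: real
  assumes \<phi>: "0 < \<phi>" "\<phi> \<le> pi / 6" and \<tau>: "\<bar>\<tau>\<bar> \<le> \<phi>"
    and m1: "m * (1 + cos (2 * \<phi> + \<tau>)) \<le> cos (2 * \<phi> + \<tau>) - cos (4 * \<phi>)"
    and m2: "m \<le> sin (2 * \<phi> - \<tau>) * sin (2 * \<phi> + \<tau>)"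
    and \<theta>: "2 * \<phi> + \<tau> \<le> \<theta>" "\<theta> \<le> pi / 2"
  shows "m * (sin \<theta>)\<^sup>2 \<le> (cos \<theta> - cos (\<theta> + (2 * \<phi> - \<tau>))) * (cos (\<theta> - (2 * \<phi> + \<tau>)) - cos \<theta>)"
proof -
  define p q where "p = 2 * \<phi> - \<tau>" and "q = 2 * \<phi> + \<tau>"
  have pq: "0 < p" "0 < q" "q \<le> pi / 2" "p + q = 4 * \<phi>" using \<phi> \<tau> by (auto simp: p_def q_def)
  define b e where "b = sin q * (1 - cos p) - sin p * (1 - cos q)" and "e = (1 - cos p) * (1 - cos q)"
  have e: "0 \<le> e" by (simp add: e_def)
  define x y where "x = cos \<theta> / sin \<theta>" and "y = cos q / sin q"
  have sq: "sin q > 0" using pq by (intro sin_gt_zero) auto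
  have st: "sin \<theta> > 0" using \<theta> pq by (intro sin_gt_zero) (auto simp: q_def)
  have x0: "0 \<le> x" unfolding x_def using st \<theta> pq by (intro divide_nonneg_pos cos_ge_zero) (auto simp: q_def)
  have xy: "x \<le> y"
  proof -
    have "0 \<le> sin (\<theta> - q)" using \<theta> pq by (intro sin_ge_zero) (auto simp: q_def)
    thus ?thesis using sq st by (simp add: x_def y_def sin_diff field_simps)
  qed
  \<comment> \<open>The value at \<theta> = q. Multiplying by sin^2 q makes the quadratic factor
    into (cos q - cos (4\<phi>)) (1 - cos q).\<close>
  have ey: "m \<le> sin p * sin q + b * y - e * y\<^sup>2"
  proof -
    have yq: "y * sin q = cos q" using sq by (simp add: y_def)
    have "(sin q)\<^sup>2 * (sin p * sin q + b * y - e * y\<^sup>2)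
        = (sin q)\<^sup>2 * sin p * sin q + sin q * (y * sin q) * b - (y * sin q)\<^sup>2 * e"
      by (simp add: power2_eq_square algebra_simps)
    also have "\<dots> = (sin q)\<^sup>2 * sin p * sin q + sin q * cos q * b - (cos q)\<^sup>2 * e"
      unfolding yq ..
    also have "\<dots> = (sin p * sin q + cos q * (1 - cos p)) * ((sin q)\<^sup>2 - cos q * (1 - cos q))"
    proof -
      have "S\<^sup>2 * P * S + S * C * (S * (1 - Q) - P * (1 - C)) - C\<^sup>2 * ((1 - Q) * (1 - C))
          = (P * S + C * (1 - Q)) * (S\<^sup>2 - C * (1 - C))" for S C P Q :: real
        by (simp add: power2_eq_square algebra_simps)
      thus ?thesis unfolding b_def e_def .
    qed
    also have "sin p * sin q + cos q * (1 - cos p) = cos q - cos (4 * \<phi>)"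
      unfolding pq(4)[symmetric] by (simp add: cos_add algebra_simps)
    also have "(sin q)\<^sup>2 - cos q * (1 - cos q) = 1 - cos q"
      by (simp add: sin_squared_eq power2_eq_square algebra_simps)
    also have "(cos q - cos (4 * \<phi>)) * (1 - cos q) \<ge> m * (1 + cos q) * (1 - cos q)"
      using m1 unfolding q_def by (intro mult_right_mono) auto
    also have "m * (1 + cos q) * (1 - cos q) = (sin q)\<^sup>2 * m"
      unfolding sin_squared_eq by (simp add: sin_squared_eq power2_eq_square algebra_simps)
    finally show ?thesis using sq by simp
  qed
  have "m \<le> sin p * sin q + b * x - e * x\<^sup>2"
  proof (cases "y = 0")
    case True
    thus ?thesis using x0 xy m2 by (simp add: p_def q_def)
  next
    case False
    hence y: "0 < y" using x0 xy by simp
    \<comment> \<open>Concavity by hand: x is the convex combination of 0 and y with weight l, and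
      l^2 \<le> l.\<close>
    define l where "l = x / y"
    have l: "0 \<le> l" "l \<le> 1" "x = l * y" using x0 xy y by (auto simp: l_def)
    have "l * l \<le> l * 1" using l by (intro mult_left_mono) auto
    hence "e * y\<^sup>2 * (l * l) \<le> e * y\<^sup>2 * l" using e by (intro mult_left_mono) auto
    moreover have "0 \<le> (1 - l) * (sin p * sin q - m)" "0 \<le> l * (sin p * sin q + b * y - e * y\<^sup>2 - m)"
      using l m2 ey by (auto simp: p_def q_def)
    ultimately show ?thesis unfolding l(3) by (simp add: power2_eq_square algebra_simps)
  qed
  hence "m * (sin \<theta>)\<^sup>2 \<le> (sin p * sin q + b * x - e * x\<^sup>2) * (sin \<theta>)\<^sup>2"
    by (rule mult_right_mono) simp
  also have "\<dots> = (sin \<theta>)\<^sup>2 * sin p * sin q + b * (sin \<theta> * (x * sin \<theta>)) - e * (x * sin \<theta>)\<^sup>2"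
    by (simp add: power2_eq_square algebra_simps)
  also have "x * sin \<theta> = cos \<theta>" using st by (simp add: x_def)
  also have "(sin \<theta>)\<^sup>2 * sin p * sin q + b * (sin \<theta> * cos \<theta>) - e * (cos \<theta>)\<^sup>2
      = (cos \<theta> - cos (\<theta> + p)) * (cos (\<theta> - q) - cos \<theta>)"
    by (simp add: b_def e_def cos_add cos_diff power2_eq_square algebra_simps)
  finally show ?thesis by (simp add: p_def q_def)
qed

text \<open>The reflection of \<theta> in pi/2 interchanges the two factors and changes the sign of
  \<tau>.\<close>

lemma chebyshev_gap:
  fixes \<phi> \<tau> \<theta> m :: real
  assumes \<phi>: "0 < \<phi>" "\<phi> \<le> pi / 6" and \<tau>: "\<bar>\<tau>\<bar> \<le> \<phi>"
    and m: "m = 171 / 100 * \<phi>\<^sup>2 \<or> m = 211 / 100 * \<phi>\<^sup>2 \<and> \<bar>\<tau>\<bar> \<le> \<phi> / 2"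
    and \<theta>: "2 * \<phi> + \<tau> \<le> \<theta>" "\<theta> \<le> pi - (2 * \<phi> - \<tau>)"
  shows "m * (sin \<theta>)\<^sup>2 \<le> (cos \<theta> - cos (\<theta> + (2 * \<phi> - \<tau>))) * (cos (\<theta> - (2 * \<phi> + \<tau>)) - cos \<theta>)"
proof (cases "\<theta> \<le> pi / 2")
  case True
  show ?thesis using chebyshev_gap_left[OF \<phi> \<tau> chebyshev_gap_end[OF \<phi> \<tau> m] \<theta>(1) True] .
next
  case False
  have \<tau>': "\<bar>- \<tau>\<bar> \<le> \<phi>" using \<tau> by simp
  have m': "m = 171 / 100 * \<phi>\<^sup>2 \<or> m = 211 / 100 * \<phi>\<^sup>2 \<and> \<bar>- \<tau>\<bar> \<le> \<phi> / 2" using m by simp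
  have e: "pi - \<theta> + (2 * \<phi> + \<tau>) = pi - (\<theta> - (2 * \<phi> + \<tau>))"
    "pi - \<theta> - (2 * \<phi> - \<tau>) = pi - (\<theta> + (2 * \<phi> - \<tau>))" by simp_all
  have "m * (sin (pi - \<theta>))\<^sup>2 \<le> (cos (pi - \<theta>) - cos (pi - \<theta> + (2 * \<phi> + \<tau>)))
      * (cos (pi - \<theta> - (2 * \<phi> - \<tau>)) - cos (pi - \<theta>))"
    using chebyshev_gap_left[OF \<phi> \<tau>' chebyshev_gap_end[OF \<phi> \<tau>' m'], of "pi - \<theta>"] False \<theta> by simp
  thus ?thesis unfolding e by (simp add: mult.commute del: diff_diff_eq2)
qed

lemma psi_ge_1: "1 \<le> r \<Longrightarrow> 1 \<le> psi r"
proof -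
  assume "1 \<le> r"
  hence "ln 2 \<le> ln (real r + 1)" by simp
  hence "2 / 3 \<le> ln (real r + 1)" using ln2_ge_two_thirds by linarith
  hence "1 / 4 \<le> 2 / pi * ln (real r + 1)" using pi_bounds by (simp add: field_simps)
  thus ?thesis unfolding psi_def by linarith
qed

text \<open>Equivalent to x^2 \<ge> 5.2^7 / 4.2^5, a number slightly below 81. The argument is n^2
  for at least three nodes, and 5/7 is a rational upper bound for cos (pi/4).\<close>

lemma log_comparison:
  fixes x :: real
  assumes "9 \<le> x"
  shows "5 / 7 * ln (x / (42 / 10)) \<le> ln (x / (52 / 10))"
proof -
  have "81 * x ^ 5 \<le> x ^ 2 * x ^ 5"
    using power_mono[OF assms, of 2] assms by (intro mult_right_mono) auto
  moreover have "0 \<le> x ^ 5" using assms by simp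
  moreover have "x ^ 2 * x ^ 5 = x ^ 7" by (simp flip: power_add)
  ultimately have "8031810176 * x ^ 5 \<le> 102102525 * x ^ 7" by linarith
  hence "(x / (42 / 10)) ^ 5 \<le> (x / (52 / 10)) ^ 7"
    using assms by (simp add: power_divide field_simps)
  hence "ln ((x / (42 / 10)) ^ 5) \<le> ln ((x / (52 / 10)) ^ 7)"
    using assms by (subst ln_le_cancel_iff) auto
  moreover have "ln ((x / (42 / 10)) ^ 5) = 5 * ln (x / (42 / 10))" "ln ((x / (52 / 10)) ^ 7) = 7 * ln (x / (52 / 10))"
    using assms by (simp_all add: ln_realpow)
  ultimately show ?thesis by simp
qed

text \<open>The bound on \<open>x\<close> is the range between the extreme nodes, onto which a whole
  mesh subinterval is mapped. The far nodes contribute a logarithm, the two adjacent ones at most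
  4/pi; what remains is a lower bound for the product of the distances \<open>P1\<close> and
  \<open>P2\<close> in that logarithm.\<close>

theorem Lebesgue_constant_le:
  assumes r: "2 \<le> r" and n: "n = Suc r" and x: "\<bar>x\<bar> \<le> cos (pi / (2 * real n))"
  shows "(\<Sum>k<n. \<bar>lagrange n (cheb_node n) k x\<bar>) \<le> psi r"
proof (cases "\<exists>i<n. x = cheb_node n i")
  case True
  then obtain i where i: "i < n" "x = cheb_node n i" by blast
  have "(\<Sum>k<n. \<bar>lagrange n (cheb_node n) k x\<bar>) = (\<Sum>k<n. if i = k then 1 else 0)"
    using i by (intro sum.cong) (auto simp: lagrange_node[OF inj_on_cheb_node])
  also have "\<dots> = 1" using i by simp
  finally show ?thesis using psi_ge_1[of r] r by simp
next
  case False
  define \<phi> where "\<phi> = pi / (2 * real n)"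
  have n3: "3 \<le> real n" "2 \<le> n" using r n by auto
  have \<phi>: "0 < \<phi>" "\<phi> \<le> pi / 6" "2 * real n * \<phi> = pi" "real n * \<phi> = pi / 2"
    using n3 by (auto simp: \<phi>_def field_simps)
  have \<phi>pi: "\<phi> < pi" "\<phi> < pi / 2" using \<phi>(1,2) by linarith+
  define \<theta> where "\<theta> = arccos x"
  have "\<bar>x\<bar> \<le> 1" using x cos_le_one order_trans by blast
  hence ct: "cos \<theta> = x" and \<theta>01: "0 \<le> \<theta>" "\<theta> \<le> pi"
    by (auto simp: \<theta>_def cos_arccos_abs arccos_lbound arccos_ubound)
  have ang: "cheb_angle n 0 = \<phi>" "cheb_angle n r = pi - \<phi>"
  proof -
    show "cheb_angle n 0 = \<phi>" by (simp add: cheb_angle_def \<phi>_def)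
    have "cheb_angle n r + \<phi> = 2 * real n * \<phi>"
      unfolding cheb_angle_mult \<phi>_def[symmetric] by (simp add: n algebra_simps)
    thus "cheb_angle n r = pi - \<phi>" using \<phi>(3) by simp
  qed
  have nodes: "cheb_node n 0 = cos \<phi>" "cheb_node n r = - cos \<phi>"
    unfolding cheb_node_def ang by simp_all
  have xlt: "x < cos \<phi>" "- cos \<phi> < x"
  proof -
    have "x \<noteq> cos \<phi>" "x \<noteq> - cos \<phi>" using False nodes n by (metis zero_less_Suc, metis lessI)
    thus "x < cos \<phi>" "- cos \<phi> < x" using x unfolding \<phi>_def[symmetric] by auto
  qed
  have \<theta>: "\<phi> < \<theta>" "\<theta> < pi - \<phi>"
  proof -
    show "\<phi> < \<theta>"
    proof (rule ccontr)
      assume "\<not> \<phi> < \<theta>"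
      hence "cos \<phi> \<le> cos \<theta>" using \<phi>pi \<theta>01 by (intro cos_monotone_0_pi_le) auto
      thus False using xlt(1) ct by simp
    qed
    show "\<theta> < pi - \<phi>"
    proof (rule ccontr)
      assume "\<not> \<theta> < pi - \<phi>"
      hence "cos \<theta> \<le> cos (pi - \<phi>)" using \<phi>pi \<theta>01 by (intro cos_monotone_0_pi_le) auto
      thus False using xlt(2) ct by simp
    qed
  qed
  define m where "m = (LEAST m. \<theta> < cheb_angle n m)"
  have ex: "\<theta> < cheb_angle n r" using \<theta> ang by simp
  have m: "\<theta> < cheb_angle n m" "m \<le> r"
    unfolding m_def using ex by (auto intro: LeastI Least_le)
  have "m \<noteq> 0" using m(1) ang \<theta> by (metis less_asym)
  then obtain j where j: "m = Suc j" by (cases m) auto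
  have jn: "Suc j < n" "j < n" using m(2) j n by auto
  have "\<not> \<theta> < cheb_angle n j" using not_less_Least[of j] j unfolding m_def by (metis lessI)
  moreover have "\<theta> \<noteq> cheb_angle n j" using False jn ct unfolding cheb_node_def by metis
  ultimately have tj: "cheb_angle n j < \<theta>" "\<theta> < cheb_angle n (Suc j)" using m j by auto
  \<comment> \<open>The offset of \<theta> from the midpoint between the adjacent node angles j and
    j + 1.\<close>
  define \<tau> where "\<tau> = \<theta> - 2 * real (Suc j) * \<phi>"
  have \<tau>: "\<bar>\<tau>\<bar> \<le> \<phi>"
    using tj unfolding cheb_angle_mult \<phi>_def[symmetric] \<tau>_def by (simp add: abs_le_iff algebra_simps)
  define w where "w = \<bar>cos (real n * \<theta>)\<bar>"
  have w: "w = \<bar>cos (real n * \<tau>)\<bar>"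
  proof -
    have "real n * \<theta> = real n * \<tau> + real (Suc j) * (2 * real n * \<phi>)"
      unfolding \<tau>_def by (simp add: algebra_simps)
    hence "real n * \<theta> = real n * \<tau> + real (Suc j) * pi" unfolding \<phi>(3) .
    thus ?thesis unfolding w_def
      by (simp only: cos_add sin_npi cos_npi) (simp add: abs_mult power_abs)
  qed
  \<comment> \<open>Distances to the outer borders of the cells of the two adjacent nodes; these are
    the points where the telescoping sums stop.\<close>
  define P1 P2 where "P1 = cos \<theta> - cos (2 * real (Suc (Suc j)) * \<phi>)"
    and "P2 = cos (2 * real j * \<phi>) - cos \<theta>"
  have P1: "0 < P1"
  proof -
    have "\<theta> < 2 * real (Suc (Suc j)) * \<phi>"
      using tj(2) \<phi> unfolding cheb_angle_mult \<phi>_def[symmetric] by (simp add: algebra_simps)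
    moreover have "2 * real (Suc (Suc j)) * \<phi> \<le> 2 * real n * \<phi>"
      using jn \<phi> by (intro mult_right_mono mult_left_mono) auto
    ultimately show ?thesis unfolding P1_def using \<phi>(3) \<theta>01 by (simp add: cos_monotone_0_pi)
  qed
  have P2: "0 < P2"
  proof -
    have "2 * real j * \<phi> < \<theta>"
      using tj(1) \<phi> unfolding cheb_angle_mult \<phi>_def[symmetric] by simp
    thus ?thesis unfolding P2_def using \<phi> \<theta>01 by (simp add: cos_monotone_0_pi)
  qed
  have s0: "0 < sin \<theta>" using \<theta> \<phi> by (intro sin_gt_zero) auto
  have c1: "0 < 1 + cos \<theta>" "0 < 1 - cos \<theta>"
  proof -
    have "(1 + cos \<theta>) * (1 - cos \<theta>) = (sin \<theta>)\<^sup>2" by (simp add: sin_squared_eq power2_eq_square algebra_simps)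
    hence "0 < (1 + cos \<theta>) * (1 - cos \<theta>)" using s0 by simp
    thus "0 < 1 + cos \<theta>" "0 < 1 - cos \<theta>" using cos_le_one[of \<theta>] cos_ge_minus_one[of \<theta>]
      by (auto simp: zero_less_mult_iff)
  qed
  define L where "L = ln ((sin \<theta>)\<^sup>2 / (P1 * P2))"
  define g where "g k = sin (cheb_angle n k) / \<bar>cos \<theta> - cheb_node n k\<bar>" for k
  have lag: "\<bar>lagrange n (cheb_node n) k x\<bar> = w / real n * g k" if "k < n" for k
    using abs_lagrange_cheb_node_cos[of k n \<theta>] that False ct unfolding w_def g_def by auto
  have left: "cheb_node n k > cos \<theta>" if "k \<le> j" for k
  proof -
    have "cheb_angle n k < \<theta>" using tj(1) that cheb_angle_less[of n k j] jn by (cases "k = j") auto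
    moreover have "0 < cheb_angle n k" using cheb_angle_bounds[of k n] that jn by auto
    ultimately show ?thesis unfolding cheb_node_def using \<theta>01 by (intro cos_monotone_0_pi) auto
  qed
  have right: "cheb_node n k < cos \<theta>" if "Suc j \<le> k" "k < n" for k
  proof -
    have "\<theta> < cheb_angle n k" using tj(2) that cheb_angle_less[of n "Suc j" k] by (cases "k = Suc j") auto
    moreover have "cheb_angle n k < pi" using cheb_angle_bounds[of k n] that by auto
    ultimately show ?thesis unfolding cheb_node_def using \<theta>01 by (intro cos_monotone_0_pi) auto
  qed
  have "(\<Sum>k<n. g k) = (\<Sum>k<j. g k) + (g j + g (Suc j)) + (\<Sum>k\<in>{Suc (Suc j)..<n}. g k)"
  proof -
    have "(\<Sum>k<n. g k) = (\<Sum>k<Suc (Suc j). g k) + (\<Sum>k\<in>{Suc (Suc j)..<n}. g k)"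
      using jn sum.atLeastLessThan_concat[of 0 "Suc (Suc j)" n g] by (simp add: atLeast0LessThan)
    thus ?thesis by (simp add: algebra_simps)
  qed
  also have "(\<Sum>k<j. g k) = (\<Sum>k<j. sin (cheb_angle n k) / (cheb_node n k - cos \<theta>))"
    using left by (intro sum.cong) (auto simp: g_def abs_if dest: less_imp_le)
  also have "(\<Sum>k\<in>{Suc (Suc j)..<n}. g k)
      = (\<Sum>k\<in>{Suc (Suc j)..<n}. sin (cheb_angle n k) / (cos \<theta> - cheb_node n k))"
  proof (rule sum.cong[OF refl])
    fix k assume "k \<in> {Suc (Suc j)..<n}"
    hence "cheb_node n k < cos \<theta>" by (intro right) auto
    thus "g k = sin (cheb_angle n k) / (cos \<theta> - cheb_node n k)" by (simp add: g_def)
  qed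
  finally have "(\<Sum>k<n. g k) / real n =
      (\<Sum>k<j. sin (cheb_angle n k) / (cheb_node n k - cos \<theta>)) / real n + (g j + g (Suc j)) / real n
      + (\<Sum>k\<in>{Suc (Suc j)..<n}. sin (cheb_angle n k) / (cos \<theta> - cheb_node n k)) / real n"
    by (simp add: add_divide_distrib)
  also have "\<dots> \<le> (ln (1 - cos \<theta>) - ln P2) / pi + (g j + g (Suc j)) / real n
      + (ln (1 + cos \<theta>) - ln P1) / pi"
    using far_terms_left[OF n3(2) jn(2) tj(1)] far_terms_right[OF n3(2) jn(1) _ tj(2)] \<theta> \<phi>
    unfolding P1_def P2_def \<phi>_def[symmetric] by (intro add_mono order_refl) auto
  also have "\<dots> = (g j + g (Suc j)) / real n + L / pi"
  proof -
    have "(sin \<theta>)\<^sup>2 = (1 - cos \<theta>) * (1 + cos \<theta>)"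
      by (simp add: sin_squared_eq power2_eq_square algebra_simps)
    hence "L = ln (1 - cos \<theta>) + ln (1 + cos \<theta>) - (ln P1 + ln P2)"
      unfolding L_def using P1 P2 c1 by (simp add: ln_div ln_mult)
    thus ?thesis by (simp add: add_divide_distrib diff_divide_distrib)
  qed
  finally have "w * ((\<Sum>k<n. g k) / real n) \<le> w * ((g j + g (Suc j)) / real n + L / pi)"
    by (rule mult_left_mono) (simp add: w_def)
  also have "\<dots> = w / real n * (g j + g (Suc j)) + w * L / pi" by (simp add: algebra_simps add_divide_distrib)
  also have "w / real n * (g j + g (Suc j)) \<le> 4 / pi"
    using near_terms[OF n3(2) jn(1) tj] left[of j] right[of "Suc j"] jn
    unfolding w_def g_def by (simp add: abs_if)
  finally have main: "(\<Sum>k<n. \<bar>lagrange n (cheb_node n) k x\<bar>) \<le> 4 / pi + w * L / pi"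
    using lag by (simp add: sum_distrib_left sum_divide_distrib)
  have gap: "c * (sin \<theta>)\<^sup>2 \<le> P1 * P2"
    if "c = 171 / 100 * \<phi>\<^sup>2 \<or> c = 211 / 100 * \<phi>\<^sup>2 \<and> \<bar>\<tau>\<bar> \<le> \<phi> / 2" for c
  proof -
    have "0 \<le> 2 * real j * \<phi>" using \<phi> by simp
    hence "2 * \<phi> + \<tau> \<le> \<theta>" unfolding \<tau>_def by (simp add: algebra_simps)
    moreover have "2 * real (Suc (Suc j)) * \<phi> \<le> 2 * real n * \<phi>"
      using jn \<phi> by (intro mult_right_mono mult_left_mono) auto
    hence "\<theta> \<le> pi - (2 * \<phi> - \<tau>)" unfolding \<phi>(3) \<tau>_def by (simp add: algebra_simps)
    moreover have "\<theta> + (2 * \<phi> - \<tau>) = 2 * real (Suc (Suc j)) * \<phi>" "\<theta> - (2 * \<phi> + \<tau>) = 2 * real j * \<phi>"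
      unfolding \<tau>_def by (simp_all add: algebra_simps)
    ultimately show ?thesis using chebyshev_gap[OF \<phi>(1,2) \<tau> that, of \<theta>] unfolding P1_def P2_def by (simp only:)
  qed
  have L_le: "L \<le> ln ((real n)\<^sup>2 / d)"
    if c: "c * (sin \<theta>)\<^sup>2 \<le> P1 * P2" "d / (real n)\<^sup>2 \<le> c" "0 < d" for c d
  proof -
    have "d / (real n)\<^sup>2 * (sin \<theta>)\<^sup>2 \<le> P1 * P2"
      using c order_trans[OF mult_right_mono[OF c(2), of "(sin \<theta>)\<^sup>2"] c(1)] by simp
    hence "(sin \<theta>)\<^sup>2 / (P1 * P2) \<le> (real n)\<^sup>2 / d"
      using P1 P2 c(3) n3 by (simp add: field_simps)
    thus ?thesis unfolding L_def using s0 P1 P2 c(3) n3 by (subst ln_le_cancel_iff) auto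
  qed
  have pi2: "98596 / 10000 \<le> pi\<^sup>2"
    using power_mono[of "314 / 100" pi 2] pi_bounds by (simp add: power2_eq_square)
  have \<phi>2: "\<phi>\<^sup>2 = pi\<^sup>2 / 4 / (real n)\<^sup>2" by (simp add: \<phi>_def power_divide power_mult_distrib)
  have nn: "9 \<le> (real n)\<^sup>2" using power_mono[OF n3(1), of 2] by simp
  have d: "d / (real n)\<^sup>2 \<le> c * \<phi>\<^sup>2" if "d \<le> c * (pi\<^sup>2 / 4)" for c d
    using divide_right_mono[OF that, of "(real n)\<^sup>2"] by (simp add: \<phi>2)
  \<comment> \<open>Near the midpoint the weight \<open>w\<close> may reach 1, but the better gap
    constant is available. Farther away only the weaker one is, and w \<le> cos (pi/4) compensates
    for it.\<close>
  have "w * L \<le> ln ((real n)\<^sup>2 / (52 / 10))"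
  proof (cases "\<bar>\<tau>\<bar> \<le> \<phi> / 2")
    case True
    have "L \<le> ln ((real n)\<^sup>2 / (52 / 10))"
      using True pi2 by (intro L_le[of "211 / 100 * \<phi>\<^sup>2"] gap d) auto
    moreover have "0 \<le> ln ((real n)\<^sup>2 / (52 / 10))" using nn by simp
    moreover have "0 \<le> w" "w \<le> 1" unfolding w by simp_all
    ultimately show ?thesis by (smt (verit) mult_left_le_one_le mult_left_mono)
  next
    case False
    have "L \<le> ln ((real n)\<^sup>2 / (42 / 10))"
      using pi2 by (intro L_le[of "171 / 100 * \<phi>\<^sup>2"] gap d) auto
    moreover have "0 \<le> ln ((real n)\<^sup>2 / (42 / 10))" using nn by simp
    moreover have "0 \<le> w" "w \<le> 5 / 7"
    proof -
      have "real n * (\<phi> / 2) \<le> real n * \<bar>\<tau>\<bar>" "real n * \<bar>\<tau>\<bar> \<le> real n * \<phi>"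
        using False \<tau> by (intro mult_left_mono; simp)+
      hence b: "pi / 4 \<le> real n * \<bar>\<tau>\<bar>" "real n * \<bar>\<tau>\<bar> \<le> pi / 2" using \<phi>(4) by auto
      have "w = \<bar>cos (real n * \<bar>\<tau>\<bar>)\<bar>" unfolding w by (metis abs_mult abs_of_nat cos_abs_real)
      also have "\<dots> = cos (real n * \<bar>\<tau>\<bar>)" using b by (intro abs_of_nonneg cos_ge_zero) auto
      also have "\<dots> \<le> cos (pi / 4)" using b by (intro cos_monotone_0_pi_le) auto
      also have "\<dots> \<le> 5 / 7"
      proof -
        have "sqrt 2 \<le> 10 / 7" by (rule real_le_lsqrt) (auto simp: power2_eq_square)
        thus ?thesis by (simp add: cos_45)
      qed
      finally show "w \<le> 5 / 7" .
    qed (simp add: w)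
    ultimately have "w * L \<le> 5 / 7 * ln ((real n)\<^sup>2 / (42 / 10))"
      by (meson mult_left_mono mult_right_mono order_trans)
    also note log_comparison[OF nn]
    finally show ?thesis .
  qed
  also have "ln ((real n)\<^sup>2 / (52 / 10)) = 2 * ln (real n) - ln (52 / 10)"
    using n3 by (subst ln_div) (auto simp: ln_realpow)
  finally have "4 + w * L \<le> 2 * ln (real n) + 3 / 4 * pi" using ln_52_10_gt by linarith
  hence "(4 + w * L) / pi \<le> (2 * ln (real n) + 3 / 4 * pi) / pi" by (rule divide_right_mono) simp
  hence "4 / pi + w * L / pi \<le> psi r" by (simp add: psi_def n add_divide_distrib add.commute)
  thus ?thesis using main by linarith
qed

section \<open>Spectral radius and eigenvectors of cone preserving operators\<close>

lemma bdd_above_norm_image: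
  fixes f :: "'a::topological_space \<Rightarrow> 'b::real_normed_vector"
  assumes "compact X" "continuous_on X f"
  shows "bdd_above ((\<lambda>x. norm (f x)) ` X)"
  using assms by (intro bounded_imp_bdd_above compact_imp_bounded compact_continuous_image continuous_intros)

lemma norm_le_sup_norm:
  assumes "compact X" "continuous_on X f" "x \<in> X"
  shows "norm (f x) \<le> sup_norm X f"
  unfolding sup_norm_def using bdd_above_norm_image[OF assms(1,2)] assms(3) by (rule cSUP_upper[rotated])

lemma sup_norm_leI:
  assumes "X \<noteq> {}" "\<And>x. x \<in> X \<Longrightarrow> norm (f x) \<le> K"
  shows "sup_norm X f \<le> K"
  unfolding sup_norm_def using assms by (rule cSUP_least)

text \<open>Functions may take any values off \<open>X\<close>; \<open>T_cong\<close> makes these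
  values irrelevant. The codomain stays a type variable so that the real operators and their
  complexifications are both instances.\<close>

locale field_operator =
  fixes X :: "'a::topological_space set" and T :: "('a \<Rightarrow> 'b::{real_normed_field,banach}) \<Rightarrow> 'a \<Rightarrow> 'b" and C :: real
  assumes compact_X: "compact X" and X_ne: "X \<noteq> {}"
    and T_cong: "\<And>f g. (\<And>x. x \<in> X \<Longrightarrow> f x = g x) \<Longrightarrow> T f = T g"
    and T_cont: "\<And>f. continuous_on X f \<Longrightarrow> continuous_on X (T f)"
    and T_lin: "\<And>f g c d x. continuous_on X f \<Longrightarrow> continuous_on X g \<Longrightarrow> x \<in> X \<Longrightarrow>
      T (\<lambda>y. c * f y + d * g y) x = c * T f x + d * T g x"
    and T_bdd: "\<And>f K x. continuous_on X f \<Longrightarrow> (\<And>y. y \<in> X \<Longrightarrow> norm (f y) \<le> K) \<Longrightarrow> x \<in> X \<Longrightarrow>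
      norm (T f x) \<le> C * K"
begin

lemma T_pow_cont: "continuous_on X f \<Longrightarrow> continuous_on X ((T ^^ n) f)"
  by (induction n) (auto intro: T_cont)

lemma T_pow_lin:
  assumes "continuous_on X f" "continuous_on X g" "x \<in> X"
  shows "(T ^^ n) (\<lambda>y. c * f y + d * g y) x = c * (T ^^ n) f x + d * (T ^^ n) g x"
  using assms(3)
proof (induction n arbitrary: x)
  case (Suc n)
  have "(T ^^ Suc n) (\<lambda>y. c * f y + d * g y) x
      = T (\<lambda>y. c * (T ^^ n) f y + d * (T ^^ n) g y) x"
    using Suc.IH by (simp add: T_cong[of "(T ^^ n) (\<lambda>y. c * f y + d * g y)"])
  also have "\<dots> = c * (T ^^ Suc n) f x + d * (T ^^ Suc n) g x"
    using Suc.prems T_pow_cont[OF assms(1)] T_pow_cont[OF assms(2)] by (simp add: T_lin)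
  finally show ?case .
qed simp

lemma T_pow_cong: "(\<And>x. x \<in> X \<Longrightarrow> f x = g x) \<Longrightarrow> x \<in> X \<Longrightarrow> (T ^^ n) f x = (T ^^ n) g x"
proof (induction n arbitrary: x)
  case (Suc n)
  thus ?case using T_cong[of "(T ^^ n) f" "(T ^^ n) g"] by simp
qed simp

lemma T_pow_eigen:
  assumes "continuous_on X f" "\<And>x. x \<in> X \<Longrightarrow> T f x = \<rho> * f x" "x \<in> X"
  shows "(T ^^ n) f x = \<rho> ^ n * f x"
  using assms(3)
proof (induction n arbitrary: x)
  case (Suc n)
  have "(T ^^ Suc n) f x = T (\<lambda>y. \<rho> ^ n * f y + 0 * f y) x"
    using Suc.IH by (simp add: T_cong[of "(T ^^ n) f"])
  also have "\<dots> = \<rho> ^ n * T f x + 0 * T f x" using assms(1) Suc.prems by (intro T_lin)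
  finally show ?case using assms(2) Suc.prems by simp
qed simp

end

text \<open>The Neumann series \<open>\<Sum>n. T\<^sup>n g / z\<^sup>n\<^sup>+\<^sup>1\<close> inverts \<open>z - T\<close>.\<close>

lemma (in field_operator) resolvent_power_bound:
  fixes \<rho> D :: real
  assumes \<rho>: "0 \<le> \<rho>" "\<rho> < norm z" and D: "0 \<le> D"
    and pow: "\<And>f K x n. continuous_on X f \<Longrightarrow> (\<And>y. y \<in> X \<Longrightarrow> norm (f y) \<le> K) \<Longrightarrow> x \<in> X \<Longrightarrow>
      norm ((T ^^ n) f x) \<le> D * K * \<rho> ^ n"
  shows "bij_betw (\<lambda>f. \<lambda>x\<in>X. z * f x - T f x) (cont_functions X) (cont_functions X)"
    and "\<exists>K. \<forall>f\<in>cont_functions X. sup_norm X f \<le> K * sup_norm X (\<lambda>x\<in>X. z * f x - T f x)"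
proof -
  have z0: "z \<noteq> 0" using \<rho> by auto
  define q where "q = \<rho> / norm z"
  have q: "0 \<le> q" "q < 1" using \<rho> by (auto simp: q_def divide_less_eq)
  define R where "R f = (\<lambda>x\<in>X. z * f x - T f x)" for f
  have Rc: "R f \<in> cont_functions X" if "continuous_on X f" for f
  proof -
    have "continuous_on X (\<lambda>x. z * f x - T f x)" using that T_cont by (intro continuous_intros) auto
    hence "continuous_on X (R f)" by (rule continuous_on_eq) (simp add: R_def)
    thus ?thesis by (simp add: cont_functions_def R_def)
  qed
  \<comment> \<open>Read from right to left, this recovers \<open>f\<close> from \<open>R f\<close>
    up to a remainder that tends to zero. It yields both the bounded inverse and
    injectivity.\<close>
  have expand: "f x = (\<Sum>k<n. (T ^^ k) (R f) x / z ^ Suc k) + (T ^^ n) f x / z ^ n"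
    if f: "continuous_on X f" and x: "x \<in> X" for f n x
  proof (induction n)
    case (Suc n)
    have Rcf: "continuous_on X (R f)" using Rc[OF f] by (simp add: cont_functions_def)
    have "(T ^^ n) (R f) x = (T ^^ n) (\<lambda>y. z * f y + (- 1) * T f y) x"
      using x by (intro T_pow_cong) (auto simp: R_def)
    also have "\<dots> = z * (T ^^ n) f x - (T ^^ Suc n) f x"
      using T_pow_lin[OF f T_cont[OF f] x, of n z "- 1"] by (simp add: funpow_swap1)
    finally have "(T ^^ n) f x = ((T ^^ n) (R f) x + (T ^^ Suc n) f x) / z" using z0 by simp
    thus ?case using Suc z0 by (simp add: field_simps)
  qed simp
  have bound: "norm (f x) \<le> D * K / (norm z - \<rho>)"
    if f: "continuous_on X f" and x: "x \<in> X" and K: "\<And>y. y \<in> X \<Longrightarrow> norm (R f y) \<le> K" for f x K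
  proof -
    have Rcf: "continuous_on X (R f)" using Rc[OF f] by (simp add: cont_functions_def)
    have K0: "0 \<le> K" using K[OF x] norm_ge_zero order_trans by blast
    define F where "F = sup_norm X f"
    have le: "norm (f x) \<le> D * K / (norm z - \<rho>) + D * F * q ^ n" for n
    proof -
      have t1: "norm ((T ^^ k) (R f) x / z ^ Suc k) \<le> D * K / norm z * q ^ k" for k
      proof -
        have "norm ((T ^^ k) (R f) x / z ^ Suc k) = norm ((T ^^ k) (R f) x) / norm z ^ Suc k"
          by (simp add: norm_divide norm_power norm_mult)
        also have "\<dots> \<le> D * K * \<rho> ^ k / norm z ^ Suc k"
          by (intro divide_right_mono pow[OF Rcf K x]) auto
        finally show ?thesis by (simp add: q_def power_divide)
      qed
      have t2: "norm ((T ^^ n) f x / z ^ n) \<le> D * F * q ^ n"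
        using pow[OF f norm_le_sup_norm[OF compact_X f] x, of n] z0
        by (simp add: norm_divide norm_power q_def power_divide divide_right_mono F_def)
      have "norm (f x) \<le> (\<Sum>k<n. D * K / norm z * q ^ k) + D * F * q ^ n"
        unfolding expand[OF f x, of n] by (intro norm_triangle_mono sum_norm_le t1 t2)
      also have "(\<Sum>k<n. D * K / norm z * q ^ k) = D * K / norm z * ((1 - q ^ n) / (1 - q))"
        unfolding sum_distrib_left[symmetric] sum_gp_strict using q by simp
      also have "\<dots> \<le> D * K / norm z * (1 / (1 - q))"
        using q D K0 by (intro mult_left_mono divide_right_mono) auto
      also have "\<dots> = D * K / (norm z - \<rho>)" using z0 \<rho> by (simp add: q_def field_simps)
      finally show ?thesis by simp
    qed
    have "(\<lambda>n. D * K / (norm z - \<rho>) + D * F * q ^ n) \<longlonglongrightarrow> D * K / (norm z - \<rho>) + D * F * 0"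
      using q by (intro tendsto_intros LIMSEQ_power_zero) auto
    thus ?thesis using le by (intro LIMSEQ_le_const[of _ "D * K / (norm z - \<rho>)"]) auto
  qed
  show "\<exists>K. \<forall>f\<in>cont_functions X. sup_norm X f \<le> K * sup_norm X (\<lambda>x\<in>X. z * f x - T f x)"
  proof (intro exI ballI)
    fix f :: "'a \<Rightarrow> 'b" assume "f \<in> cont_functions X"
    hence f: "continuous_on X f" by (simp add: cont_functions_def)
    have "continuous_on X (R f)" using Rc[OF f] by (simp add: cont_functions_def)
    hence "sup_norm X f \<le> D * sup_norm X (R f) / (norm z - \<rho>)"
      using bound[OF f] norm_le_sup_norm[OF compact_X] by (intro sup_norm_leI X_ne) auto
    thus "sup_norm X f \<le> D / (norm z - \<rho>) * sup_norm X (\<lambda>x\<in>X. z * f x - T f x)"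
      by (simp add: R_def)
  qed
  have inj: "inj_on R (cont_functions X)"
  proof (rule inj_onI)
    fix f g :: "'a \<Rightarrow> 'b" assume fg: "f \<in> cont_functions X" "g \<in> cont_functions X" "R f = R g"
    hence c: "continuous_on X f" "continuous_on X g" by (auto simp: cont_functions_def)
    define d where "d y = 1 * f y + (- 1) * g y" for y
    have cd: "continuous_on X d" unfolding d_def using c by (intro continuous_intros)
    have "R d x = 0" if x: "x \<in> X" for x
    proof -
      have "T d x = T f x - T g x" unfolding d_def using T_lin[OF c x, of 1 "- 1"] by simp
      hence "R d x = R f x - R g x" using x by (simp add: R_def d_def algebra_simps)
      thus ?thesis using fg(3) by simp
    qed
    hence "d x = 0" if "x \<in> X" for x using bound[OF cd that, of 0] by simp
    hence "f x = g x" if "x \<in> X" for x using that by (simp add: d_def)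
    thus "f = g" using fg(1,2) by (intro extensionalityI[of f X]) (auto simp: cont_functions_def)
  qed
  have surj: "\<exists>f\<in>cont_functions X. R f = g" if g: "g \<in> cont_functions X" for g
  proof -
    have gc: "continuous_on X g" using g by (simp add: cont_functions_def)
    define G where "G = sup_norm X g"
    define t where "t k x = (T ^^ k) g x / z ^ Suc k" for k x
    have tb: "norm (t k x) \<le> D * G / norm z * q ^ k" if "x \<in> X" for k x
    proof -
      have "norm (t k x) = norm ((T ^^ k) g x) / norm z ^ Suc k"
        by (simp add: t_def norm_divide norm_power norm_mult)
      also have "\<dots> \<le> D * G * \<rho> ^ k / norm z ^ Suc k"
        unfolding G_def by (intro divide_right_mono pow[OF gc norm_le_sup_norm[OF compact_X gc] that]) auto
      finally show ?thesis by (simp add: q_def power_divide)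
    qed
    define f where "f = (\<lambda>x\<in>X. \<Sum>k. t k x)"
    define s where "s n x = (\<Sum>k<n. t k x)" for n x
    have "uniform_limit X s (\<lambda>x. \<Sum>k. t k x) sequentially"
      unfolding s_def
      by (rule Weierstrass_m_test[OF tb]) (use q in \<open>auto intro!: summable_mult\<close>)
    hence lim: "uniform_limit X s f sequentially"
      unfolding uniform_limit_iff by (simp add: f_def)
    have tc: "continuous_on X (t k)" for k
      unfolding t_def using T_pow_cont[OF gc] z0 by (intro continuous_intros) auto
    have sc: "continuous_on X (s n)" for n unfolding s_def by (intro continuous_intros tc)
    have fc: "continuous_on X f"
      by (rule uniform_limit_theorem[OF _ lim]) (auto intro!: always_eventually sc)
    \<comment> \<open>Partial sums of the series solve the resolvent equation up to a term that
      vanishes in the limit.\<close>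
    have Ts: "T (s n) x = z * s n x - g x + (T ^^ n) g x / z ^ n" if x: "x \<in> X" for n x
      using x
    proof (induction n)
      case 0
      have "T (s 0) x = T (\<lambda>y. 0 * g y + 0 * g y) x"
        by (rule fun_cong[OF T_cong]) (simp add: s_def)
      also have "\<dots> = 0" using T_lin[OF gc gc 0, of 0 0] by simp
      finally have "T (s 0) x = 0" .
      moreover have "s 0 x = 0" by (simp add: s_def)
      ultimately show ?case by simp
    next
      case (Suc n)
      have "T (s (Suc n)) x = T (\<lambda>y. 1 * s n y + (1 / z ^ Suc n) * (T ^^ n) g y) x"
        by (rule fun_cong[OF T_cong]) (simp add: s_def t_def)
      also have "\<dots> = 1 * T (s n) x + (1 / z ^ Suc n) * T ((T ^^ n) g) x"
        by (rule T_lin[OF sc T_pow_cont[OF gc] Suc.prems])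
      finally have e: "T (s (Suc n)) x = 1 * T (s n) x + 1 / z ^ Suc n * T ((T ^^ n) g) x" .
      have sS: "s (Suc n) x = s n x + (T ^^ n) g x / z ^ Suc n" by (simp add: s_def t_def)
      have zz: "z * (b / z ^ Suc n) = b / z ^ n" for b using z0 by simp
      have "T (s (Suc n)) x = z * s n x - g x + (T ^^ n) g x / z ^ n + (T ^^ Suc n) g x / z ^ Suc n"
        unfolding e Suc.IH[OF Suc.prems] by simp
      thus ?case unfolding sS distrib_left zz by simp
    qed
    have "R f x = g x" if x: "x \<in> X" for x
    proof -
      have "(\<lambda>n. T (s n) x) \<longlonglongrightarrow> T f x"
      proof (rule LIMSEQ_I)
        fix e :: real assume e: "0 < e"
        define e' where "e' = e / (2 * (\<bar>C\<bar> + 1))"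
        have e': "0 < e'" using e by (simp add: e'_def)
        obtain N where N: "\<And>n y. n \<ge> N \<Longrightarrow> y \<in> X \<Longrightarrow> dist (s n y) (f y) < e'"
          using uniform_limitD[OF lim e'] unfolding eventually_sequentially by blast
        have "norm (T (s n) x - T f x) < e" if n: "n \<ge> N" for n
        proof -
          have "T (\<lambda>y. 1 * s n y + (- 1) * f y) x = 1 * T (s n) x + (- 1) * T f x"
            by (rule T_lin[OF sc fc x])
          moreover have "norm (T (\<lambda>y. 1 * s n y + (- 1) * f y) x) \<le> C * e'"
            using N[OF n] by (intro T_bdd x continuous_intros sc fc) (auto simp: dist_norm dest: less_imp_le)
          moreover have "C * e' < e"
          proof -
            have "C * e' \<le> (\<bar>C\<bar> + 1) * e'" using e' by (intro mult_right_mono) auto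
            also have "\<dots> = e / 2" by (simp add: e'_def field_simps)
            finally show ?thesis using e by simp
          qed
          ultimately show ?thesis by simp
        qed
        thus "\<exists>N. \<forall>n\<ge>N. norm (T (s n) x - T f x) < e" by blast
      qed
      moreover have "(\<lambda>n. T (s n) x) \<longlonglongrightarrow> z * f x - g x + 0"
        unfolding Ts[OF x]
      proof (intro tendsto_intros)
        show "(\<lambda>n. s n x) \<longlonglongrightarrow> f x" using tendsto_uniform_limitI[OF lim x] .
        have nb: "norm ((T ^^ n) g x / z ^ n) \<le> D * G * q ^ n" for n
          using pow[OF gc norm_le_sup_norm[OF compact_X gc] x, of n] z0
          by (simp add: norm_divide norm_power q_def power_divide divide_right_mono G_def)
        have "(\<lambda>n. D * G * q ^ n) \<longlonglongrightarrow> D * G * 0"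
          using q by (intro tendsto_intros LIMSEQ_power_zero) auto
        hence lim0: "(\<lambda>n. D * G * q ^ n) \<longlonglongrightarrow> 0" by simp
        show "(\<lambda>n. (T ^^ n) g x / z ^ n) \<longlonglongrightarrow> 0"
          by (rule Lim_null_comparison[OF _ lim0]) (simp only: nb eventually_True)
      qed
      ultimately have "T f x = z * f x - g x + 0" by (rule LIMSEQ_unique)
      thus ?thesis using x by (simp add: R_def)
    qed
    hence "R f = g"
      using g by (intro extensionalityI[of _ X]) (auto simp: cont_functions_def R_def)
    moreover have "f \<in> cont_functions X" using fc by (simp add: cont_functions_def f_def)
    ultimately show ?thesis by blast
  qed
  have "R ` cont_functions X = cont_functions X"
  proof
    show "R ` cont_functions X \<subseteq> cont_functions X" using Rc by (auto simp: cont_functions_def)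
    show "cont_functions X \<subseteq> R ` cont_functions X" using surj by blast
  qed
  thus "bij_betw (\<lambda>f. \<lambda>x\<in>X. z * f x - T f x) (cont_functions X) (cont_functions X)"
    using inj unfolding bij_betw_def R_def by blast
qed

text \<open>The growth bound puts every z with cmod z > \<rho> into the resolvent set, while the
  eigenfunction keeps \<rho> itself in the spectrum, so the supremum is attained. Real and imaginary
  parts are estimated separately, hence the doubled constants.\<close>

lemma spec_radius_eq_eigenvalue:
  fixes A :: "(real \<Rightarrow> real) \<Rightarrow> real \<Rightarrow> real"
  assumes op: "field_operator X A C" and \<rho>: "0 \<le> \<rho>" and D: "0 \<le> D"
    and v: "continuous_on X v" "p \<in> X" "v p \<noteq> 0" "\<And>x. x \<in> X \<Longrightarrow> A v x = \<rho> * v x"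
    and pow: "\<And>f K x n. continuous_on X f \<Longrightarrow> (\<And>y. y \<in> X \<Longrightarrow> \<bar>f y\<bar> \<le> K) \<Longrightarrow> x \<in> X \<Longrightarrow>
      \<bar>(A ^^ n) f x\<bar> \<le> D * K * \<rho> ^ n"
  shows "spec_radius X A = \<rho>"
proof -
  interpret A: field_operator X A C by (rule op)
  define T where "T = complexification X A"
  have Teq: "T f x = Complex (A (\<lambda>y. Re (f y)) x) (A (\<lambda>y. Im (f y)) x)" if "x \<in> X" for f x
    using that A.T_cong[of "\<lambda>y\<in>X. Re (f y)" "\<lambda>y. Re (f y)"] A.T_cong[of "\<lambda>y\<in>X. Im (f y)" "\<lambda>y. Im (f y)"]
    by (simp add: T_def complexification_def)
  have cRe: "continuous_on X (\<lambda>y. Re (f y))" "continuous_on X (\<lambda>y. Im (f y))" if "continuous_on X f" for f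
    using that by (intro continuous_intros; simp)+
  have Tn: "(T ^^ n) f x = Complex ((A ^^ n) (\<lambda>y. Re (f y)) x) ((A ^^ n) (\<lambda>y. Im (f y)) x)"
    if "x \<in> X" for f x n
    using that
  proof (induction n arbitrary: x)
    case (Suc n)
    have "A (\<lambda>y. Re ((T ^^ n) f y)) = A ((A ^^ n) (\<lambda>y. Re (f y)))"
      "A (\<lambda>y. Im ((T ^^ n) f y)) = A ((A ^^ n) (\<lambda>y. Im (f y)))"
      using Suc.IH by (auto intro!: A.T_cong)
    thus ?case using Suc.prems by (simp add: Teq)
  qed simp
  have nb: "cmod (Complex a b) \<le> \<bar>a\<bar> + \<bar>b\<bar>" for a b using cmod_le[of "Complex a b"] by simp
  interpret T: field_operator X T "2 * C"
  proof
    show "T f = T g" if "\<And>x. x \<in> X \<Longrightarrow> f x = g x" for f g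
    proof
      fix x
      have "A (\<lambda>y. Re (f y)) = A (\<lambda>y. Re (g y))" "A (\<lambda>y. Im (f y)) = A (\<lambda>y. Im (g y))"
        using that by (auto intro!: A.T_cong)
      thus "T f x = T g x" by (cases "x \<in> X") (simp add: Teq, simp add: T_def complexification_def)
    qed
    show "continuous_on X (T f)" if "continuous_on X f" for f
    proof -
      have "continuous_on X (\<lambda>x. Complex (A (\<lambda>y. Re (f y)) x) (A (\<lambda>y. Im (f y)) x))"
        using A.T_cont[OF cRe(1)[OF that]] A.T_cont[OF cRe(2)[OF that]] by (intro continuous_intros)
      thus ?thesis by (rule continuous_on_eq) (simp add: Teq)
    qed
    show "T (\<lambda>y. c * f y + d * g y) x = c * T f x + d * T g x"
      if fg: "continuous_on X f" "continuous_on X g" and x: "x \<in> X" for f g c d x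
    proof -
      have lin4: "A (\<lambda>y. (a1 * f1 y + a2 * f2 y) + (a3 * f3 y + a4 * f4 y)) x
          = a1 * A f1 x + a2 * A f2 x + (a3 * A f3 x + a4 * A f4 x)"
        if "continuous_on X f1" "continuous_on X f2" "continuous_on X f3" "continuous_on X f4"
        for a1 a2 a3 a4 f1 f2 f3 f4
      proof -
        have "continuous_on X (\<lambda>y. a1 * f1 y + a2 * f2 y)" "continuous_on X (\<lambda>y. a3 * f3 y + a4 * f4 y)"
          using that by (intro continuous_intros; simp)+
        from A.T_lin[OF this x, of 1 1] show ?thesis
          using A.T_lin[OF that(1,2) x] A.T_lin[OF that(3,4) x] by simp
      qed
      note c = cRe[OF fg(1)] cRe[OF fg(2)]
      have e1: "Re (c * f y + d * g y)
          = (Re c * Re (f y) + (- Im c) * Im (f y)) + (Re d * Re (g y) + (- Im d) * Im (g y))"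
        and e2: "Im (c * f y + d * g y)
          = (Re c * Im (f y) + Im c * Re (f y)) + (Re d * Im (g y) + Im d * Re (g y))" for y
        by (simp_all add: algebra_simps)
      show ?thesis
        unfolding Teq[OF x] e1 e2 lin4[OF c(1,2,3,4)] lin4[OF c(2,1,4,3)]
        by (simp add: complex_eq_iff algebra_simps)
    qed
    show "cmod (T f x) \<le> 2 * C * K"
      if f: "continuous_on X f" and K: "\<And>y. y \<in> X \<Longrightarrow> cmod (f y) \<le> K" and x: "x \<in> X" for f K x
    proof -
      have "\<bar>A (\<lambda>y. Re (f y)) x\<bar> \<le> C * K" "\<bar>A (\<lambda>y. Im (f y)) x\<bar> \<le> C * K"
        using A.T_bdd[OF cRe(1)[OF f] _ x, of K] A.T_bdd[OF cRe(2)[OF f] _ x, of K]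
          K order_trans[OF abs_Re_le_cmod] order_trans[OF abs_Im_le_cmod] by auto
      hence "\<bar>A (\<lambda>y. Re (f y)) x\<bar> + \<bar>A (\<lambda>y. Im (f y)) x\<bar> \<le> 2 * C * K" by linarith
      thus ?thesis unfolding Teq[OF x] by (rule order_trans[OF nb])
    qed
  qed (rule A.compact_X A.X_ne)+
  have "op_spectrum X T \<subseteq> {z. cmod z \<le> \<rho>}"
  proof
    fix z assume z: "z \<in> op_spectrum X T"
    show "z \<in> {z. cmod z \<le> \<rho>}"
    proof (rule ccontr)
      assume "z \<notin> {z. cmod z \<le> \<rho>}"
      hence "\<rho> < cmod z" by simp
      have pw: "cmod ((T ^^ n) f x) \<le> 2 * D * K * \<rho> ^ n"
        if f: "continuous_on X f" and K: "\<And>y. y \<in> X \<Longrightarrow> cmod (f y) \<le> K" and x: "x \<in> X" for f K x n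
      proof -
        have "\<bar>(A ^^ n) (\<lambda>y. Re (f y)) x\<bar> \<le> D * K * \<rho> ^ n" "\<bar>(A ^^ n) (\<lambda>y. Im (f y)) x\<bar> \<le> D * K * \<rho> ^ n"
          using order_trans[OF abs_Re_le_cmod K] order_trans[OF abs_Im_le_cmod K]
          by (intro pow cRe f x; simp)+
        hence "\<bar>(A ^^ n) (\<lambda>y. Re (f y)) x\<bar> + \<bar>(A ^^ n) (\<lambda>y. Im (f y)) x\<bar> \<le> 2 * D * K * \<rho> ^ n"
          by linarith
        thus ?thesis unfolding Tn[OF x] by (rule order_trans[OF nb])
      qed
      have "z \<in> resolvent_set X T"
        unfolding resolvent_set_def
      proof (intro CollectI conjI)
        note res = T.resolvent_power_bound[of \<rho> z "2 * D"]
        show "bij_betw (\<lambda>f. \<lambda>x\<in>X. z * f x - T f x) (cont_functions X) (cont_functions X)"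
          by (rule res(1)) (use \<rho> \<open>\<rho> < cmod z\<close> D pw in simp_all)
        show "\<exists>K. \<forall>f\<in>cont_functions X. sup_norm X f \<le> K * sup_norm X (\<lambda>x\<in>X. z * f x - T f x)"
          by (rule res(2)) (use \<rho> \<open>\<rho> < cmod z\<close> D pw in simp_all)
      qed
      thus False using z by (simp add: op_spectrum_def)
    qed
  qed
  moreover have "complex_of_real \<rho> \<in> op_spectrum X T"
  proof (rule ccontr)
    assume "complex_of_real \<rho> \<notin> op_spectrum X T"
    hence inj: "inj_on (\<lambda>f. \<lambda>x\<in>X. complex_of_real \<rho> * f x - T f x) (cont_functions X)"
      by (simp add: op_spectrum_def resolvent_set_def bij_betw_def)
    \<comment> \<open>Both the complexified eigenfunction and the zero function must be restricted
      to \<open>X\<close>, because injectivity is known only on the extensional functions.\<close>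
    define w where "w = (\<lambda>x\<in>X. complex_of_real (v x))"
    define o0 where "o0 = (\<lambda>x\<in>X. 0 :: complex)"
    have w: "w \<in> cont_functions X"
    proof -
      have "continuous_on X (\<lambda>x. complex_of_real (v x))" using v(1) by (intro continuous_intros)
      hence "continuous_on X w" by (rule continuous_on_eq) (simp add: w_def)
      thus ?thesis by (simp add: cont_functions_def w_def)
    qed
    have o0: "o0 \<in> cont_functions X"
    proof -
      have "continuous_on X o0" by (rule continuous_on_eq[OF continuous_on_const[of _ 0]]) (simp add: o0_def)
      thus ?thesis by (simp add: cont_functions_def o0_def)
    qed
    have z1: "A (\<lambda>y. 0) x = 0" if "x \<in> X" for x
      using A.T_lin[OF v(1) v(1) that, of 0 0] by simp
    have "complex_of_real \<rho> * w x - T w x = 0" if x: "x \<in> X" for x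
    proof -
      have "A (\<lambda>y. Re (w y)) = A v" "A (\<lambda>y. Im (w y)) = A (\<lambda>y. 0)"
        by (auto intro!: A.T_cong simp: w_def)
      thus ?thesis using x z1[OF x] v(4)[OF x] by (simp add: Teq[OF x] w_def complex_eq_iff)
    qed
    moreover have "complex_of_real \<rho> * o0 x - T o0 x = 0" if x: "x \<in> X" for x
    proof -
      have "A (\<lambda>y. Re (o0 y)) = A (\<lambda>y. 0)" "A (\<lambda>y. Im (o0 y)) = A (\<lambda>y. 0)"
        by (auto intro!: A.T_cong simp: o0_def)
      thus ?thesis using x z1[OF x] by (simp add: Teq[OF x] o0_def complex_eq_iff)
    qed
    ultimately have "(\<lambda>x\<in>X. complex_of_real \<rho> * w x - T w x) = (\<lambda>x\<in>X. complex_of_real \<rho> * o0 x - T o0 x)"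
      by (intro restrict_ext) (simp only:)
    hence "w = o0" using w o0 by (rule inj_onD[OF inj])
    hence "w p = o0 p" by simp
    thus False using v(2,3) by (simp add: w_def o0_def)
  qed
  ultimately show ?thesis
    unfolding spec_radius_def T_def[symmetric] using \<rho>
    by (intro cSup_eq_maximum rev_image_eqI[of "complex_of_real \<rho>"]) auto
qed

text \<open>For positive \<open>f\<close> the last condition says that ln f is Lipschitz with
  constant \<open>M\<close>. The multiplicative form also admits zero and is closed under
  nonnegative combinations and pointwise limits of continuous functions with continuous
  limit.\<close>

definition log_lip_cone :: "real set \<Rightarrow> real \<Rightarrow> (real \<Rightarrow> real) set"
  where "log_lip_cone X M = {f. continuous_on X f \<and> (\<forall>x\<in>X. 0 \<le> f x) \<and>
    (\<forall>x\<in>X. \<forall>y\<in>X. f x \<le> exp (M * \<bar>x - y\<bar>) * f y)}"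

lemma log_lip_coneI:
  assumes "continuous_on X f" "\<And>x. x \<in> X \<Longrightarrow> 0 \<le> f x"
    and "\<And>x y. x \<in> X \<Longrightarrow> y \<in> X \<Longrightarrow> f x \<le> exp (M * \<bar>x - y\<bar>) * f y"
  shows "f \<in> log_lip_cone X M"
  using assms by (simp add: log_lip_cone_def)

lemma log_lip_coneD:
  assumes "f \<in> log_lip_cone X M"
  shows "continuous_on X f" "x \<in> X \<Longrightarrow> 0 \<le> f x"
    and "x \<in> X \<Longrightarrow> y \<in> X \<Longrightarrow> f x \<le> exp (M * \<bar>x - y\<bar>) * f y"
  using assms by (auto simp: log_lip_cone_def)

lemma log_lip_cone_mono:
  assumes "M' \<le> M"
  shows "log_lip_cone X M' \<subseteq> log_lip_cone X M"
proof
  fix f assume f: "f \<in> log_lip_cone X M'"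
  show "f \<in> log_lip_cone X M"
  proof (rule log_lip_coneI)
    fix x y assume xy: "x \<in> X" "y \<in> X"
    have "f x \<le> exp (M' * \<bar>x - y\<bar>) * f y" by (rule log_lip_coneD(3)[OF f xy])
    also have "\<dots> \<le> exp (M * \<bar>x - y\<bar>) * f y"
      using assms log_lip_coneD(2)[OF f xy(2)] by (intro mult_right_mono) (auto intro: mult_right_mono)
    finally show "f x \<le> exp (M * \<bar>x - y\<bar>) * f y" .
  qed (use log_lip_coneD[OF f] in auto)
qed

lemma log_lip_cone_comb:
  assumes "f \<in> log_lip_cone X M" "g \<in> log_lip_cone X M" "0 \<le> c" "0 \<le> d"
  shows "(\<lambda>x. c * f x + d * g x) \<in> log_lip_cone X M"
proof (rule log_lip_coneI)
  show "continuous_on X (\<lambda>x. c * f x + d * g x)"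
    using log_lip_coneD(1)[OF assms(1)] log_lip_coneD(1)[OF assms(2)] by (intro continuous_intros)
  show "0 \<le> c * f x + d * g x" if "x \<in> X" for x
    using log_lip_coneD(2)[OF assms(1) that] log_lip_coneD(2)[OF assms(2) that] assms(3,4) by simp
  fix x y assume xy: "x \<in> X" "y \<in> X"
  have "c * f x \<le> c * (exp (M * \<bar>x - y\<bar>) * f y)" "d * g x \<le> d * (exp (M * \<bar>x - y\<bar>) * g y)"
    using log_lip_coneD(3)[OF assms(1) xy] log_lip_coneD(3)[OF assms(2) xy] assms(3,4)
    by (auto intro: mult_left_mono)
  thus "c * f x + d * g x \<le> exp (M * \<bar>x - y\<bar>) * (c * f y + d * g y)" by (simp add: algebra_simps)
qed

lemma log_lip_cone_cong:
  assumes "f \<in> log_lip_cone X M" "\<And>x. x \<in> X \<Longrightarrow> f x = g x"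
  shows "g \<in> log_lip_cone X M"
proof -
  have "continuous_on X g" using log_lip_coneD(1)[OF assms(1)] assms(2) by (simp cong: continuous_on_cong)
  thus ?thesis using assms by (simp add: log_lip_cone_def)
qed

text \<open>Concavity of 1 - exp (-x), which vanishes at 0: chords from the origin have decreasing
  slope.\<close>

lemma one_minus_exp_chord:
  fixes a b :: real
  assumes "0 \<le> a" "a \<le> b"
  shows "a * (1 - exp (- b)) \<le> b * (1 - exp (- a))"
proof (cases "b = 0")
  case False
  hence b: "0 < b" using assms by simp
  define t where "t = a / b"
  have t: "0 \<le> t" "t \<le> 1" "a = t * b" using assms b by (auto simp: t_def)
  have "exp ((1 - t) *\<^sub>R 0 + t *\<^sub>R (- b)) \<le> (1 - t) * exp 0 + t * exp (- b)"
    by (rule convex_onD[OF exp_convex]) (use t in auto)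
  hence "b * (t * (1 - exp (- b))) \<le> b * (1 - exp (- (t * b)))"
    using b by (intro mult_left_mono) (auto simp: algebra_simps)
  thus ?thesis by (simp add: t(3) algebra_simps)
qed (use assms in auto)

text \<open>Functions of the smaller cone are interior points of the larger one, uniformly.\<close>

lemma log_lip_cone_diff:
  assumes M: "0 \<le> M'" "M' < M" and f: "f \<in> log_lip_cone X M'" and g: "g \<in> log_lip_cone X M'"
    and c: "0 \<le> c" "\<And>y. y \<in> X \<Longrightarrow> c * f y \<le> (M - M') / (M + M') * g y"
  shows "(\<lambda>x. g x - c * f x) \<in> log_lip_cone X M"
proof (rule log_lip_coneI)
  define \<delta> where "\<delta> = (M - M') / (M + M')"
  have \<delta>: "0 \<le> \<delta>" "\<delta> \<le> 1" using M by (auto simp: \<delta>_def)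
  show "continuous_on X (\<lambda>x. g x - c * f x)"
    using log_lip_coneD(1)[OF f] log_lip_coneD(1)[OF g] by (intro continuous_intros)
  show "0 \<le> g x - c * f x" if "x \<in> X" for x
  proof -
    have "\<delta> * g x \<le> 1 * g x" using \<delta> log_lip_coneD(2)[OF g that] by (intro mult_right_mono)
    thus ?thesis using c(2)[OF that] by (simp add: \<delta>_def)
  qed
  fix x y assume xy: "x \<in> X" "y \<in> X"
  define d where "d = \<bar>x - y\<bar>"
  have d: "0 \<le> d" by (simp add: d_def)
  \<comment> \<open>The quotient of the two differences of exponentials is never below its limit
    \<delta> for d tending to 0. After division by exp (M d) this is the chord inequality.\<close>
  have key: "\<delta> * (exp (M * d) - exp (- (M' * d))) \<le> exp (M * d) - exp (M' * d)"
  proof (cases "d = 0")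
    case False
    hence d: "0 < d" using d by simp
    have "(M - M') * d * (1 - exp (- ((M + M') * d))) \<le> (M + M') * d * (1 - exp (- ((M - M') * d)))"
      using M d by (intro one_minus_exp_chord mult_right_mono) auto
    hence "d * ((M - M') * (1 - exp (- ((M + M') * d)))) \<le> d * ((M + M') * (1 - exp (- ((M - M') * d))))"
      by (simp add: algebra_simps)
    hence "(M - M') * (1 - exp (- ((M + M') * d))) \<le> (M + M') * (1 - exp (- ((M - M') * d)))"
      using d by (simp only: mult_le_cancel_left_pos)
    hence "\<delta> * (1 - exp (- ((M + M') * d))) \<le> 1 - exp (- ((M - M') * d))"
      using M by (simp add: \<delta>_def field_simps)
    hence "exp (M * d) * (\<delta> * (1 - exp (- ((M + M') * d)))) \<le> exp (M * d) * (1 - exp (- ((M - M') * d)))"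
      by (rule mult_left_mono) simp
    moreover have "exp (M * d) * exp (- ((M + M') * d)) = exp (- (M' * d))"
      "exp (M * d) * exp (- ((M - M') * d)) = exp (M' * d)"
      by (simp_all add: algebra_simps flip: exp_add)
    ultimately show ?thesis by (simp add: algebra_simps)
  qed simp
  have gx: "g x \<le> exp (M' * d) * g y" using log_lip_coneD(3)[OF g xy] by (simp add: d_def)
  have "f y \<le> exp (M' * d) * f x"
    using log_lip_coneD(3)[OF f xy(2,1)] by (simp add: d_def abs_minus_commute)
  hence fx: "exp (- (M' * d)) * f y \<le> f x"
    by (simp add: exp_minus field_simps)
  have "c * (exp (M * d) * f y - f x) \<le> c * ((exp (M * d) - exp (- (M' * d))) * f y)"
    using fx c(1) by (intro mult_left_mono) (auto simp: algebra_simps)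
  also have "\<dots> = (exp (M * d) - exp (- (M' * d))) * (c * f y)" by simp
  also have "\<dots> \<le> (exp (M * d) - exp (- (M' * d))) * (\<delta> * g y)"
  proof (rule mult_left_mono)
    show "c * f y \<le> \<delta> * g y" using c(2)[OF xy(2)] by (simp add: \<delta>_def)
    have "- (M' * d) \<le> M * d" using M d by (smt (verit) mult_nonneg_nonneg)
    thus "0 \<le> exp (M * d) - exp (- (M' * d))" by simp
  qed
  also have "\<dots> \<le> (exp (M * d) - exp (M' * d)) * g y"
    using mult_right_mono[OF key log_lip_coneD(2)[OF g xy(2)]] by (simp add: algebra_simps)
  also have "\<dots> \<le> exp (M * d) * g y - g x" using gx by (simp add: algebra_simps)
  finally show "g x - c * f x \<le> exp (M * \<bar>x - y\<bar>) * (g y - c * f y)"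
    by (simp add: algebra_simps d_def)
qed

section \<open>Birkhoff contraction and the positive eigenvector\<close>

lemma positive_lower_bound:
  fixes f :: "real \<Rightarrow> real"
  assumes "compact X" "X \<noteq> {}" "continuous_on X f" "\<And>x. x \<in> X \<Longrightarrow> 0 < f x"
  shows "\<exists>m>0. \<forall>x\<in>X. m \<le> f x"
  using continuous_attains_inf[OF assms(1-3)] assms(4) by blast

lemma continuous_upper_bound:
  fixes f :: "real \<Rightarrow> real"
  assumes "compact X" "X \<noteq> {}" "continuous_on X f"
  shows "\<exists>m>0. \<forall>x\<in>X. f x \<le> m"
proof -
  obtain y where "\<forall>x\<in>X. f x \<le> f y" using continuous_attains_sup[OF assms] by blast
  thus ?thesis by (intro exI[of _ "\<bar>f y\<bar> + 1"]) force
qed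

text \<open>Only the order of the cone is assumed to be preserved, not the pointwise order, so that
  the discretized operator qualifies as well as the transfer operator. The strict positivity
  condition permits division by iterates.\<close>

locale cone_operator = field_operator X A C for X :: "real set" and A :: "(real \<Rightarrow> real) \<Rightarrow> real \<Rightarrow> real" and C +
  fixes M M' :: real
  assumes M': "0 \<le> M'" "M' < M"
    and cone: "\<And>f. f \<in> log_lip_cone X M \<Longrightarrow> A f \<in> log_lip_cone X M'"
    and pos: "\<And>f x. f \<in> log_lip_cone X M \<Longrightarrow> (\<And>y. y \<in> X \<Longrightarrow> 0 < f y) \<Longrightarrow> x \<in> X \<Longrightarrow> 0 < A f x"
begin

lemma cone_sub: "log_lip_cone X M' \<subseteq> log_lip_cone X M"
  using M' by (intro log_lip_cone_mono) simp

lemma A_diff: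
  assumes "continuous_on X f" "continuous_on X g" "x \<in> X"
  shows "A (\<lambda>y. c * f y - d * g y) x = c * A f x - d * A g x"
  using T_lin[OF assms, of c "- d"] by simp

text \<open>A strictly positive function of a smaller cone is an order unit for the larger one. The
  constant is dictated by \<open>log_lip_cone_diff\<close>: an upper bound of \<open>f\<close> over
  a lower bound of \<open>g\<close>, enlarged by 1/\<delta>.\<close>

lemma exists_cone_dominator:
  assumes "f \<in> log_lip_cone X L" "g \<in> log_lip_cone X L" "0 \<le> L" "L < M" "\<And>x. x \<in> X \<Longrightarrow> 0 < g x"
  shows "\<exists>c>0. (\<lambda>x. c * g x - f x) \<in> log_lip_cone X M"
proof -
  obtain m where m: "0 < m" "\<And>x. x \<in> X \<Longrightarrow> m \<le> g x"
    using positive_lower_bound[OF compact_X X_ne log_lip_coneD(1)[OF assms(2)]] assms(5) by blast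
  obtain k where k: "0 < k" "\<And>x. x \<in> X \<Longrightarrow> f x \<le> k"
    using continuous_upper_bound[OF compact_X X_ne log_lip_coneD(1)[OF assms(1)]] by blast
  define \<delta> where "\<delta> = (M - L) / (M + L)"
  have \<delta>: "0 < \<delta>" using assms(3,4) by (simp add: \<delta>_def)
  define c where "c = k / (m * \<delta>)"
  have c: "0 < c" using k m \<delta> by (simp add: c_def)
  have "(\<lambda>x. (c * g x + 0 * g x) - 1 * f x) \<in> log_lip_cone X M"
  proof (rule log_lip_cone_diff[OF assms(3,4,1)])
    show "(\<lambda>x. c * g x + 0 * g x) \<in> log_lip_cone X L"
      using assms(2) c by (intro log_lip_cone_comb) auto
    show "1 * f y \<le> (M - L) / (M + L) * (c * g y + 0 * g y)" if "y \<in> X" for y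
    proof -
      have "f y \<le> \<delta> * (c * m)" using k(2)[OF that] \<delta> m by (simp add: c_def)
      also have "\<dots> \<le> \<delta> * (c * g y)" using m(2)[OF that] \<delta> c by (intro mult_left_mono) auto
      finally show ?thesis by (simp add: \<delta>_def)
    qed
  qed simp
  thus ?thesis using c by (intro exI[of _ c]) simp
qed

text \<open>One step of Birkhoff's contraction argument: of two complementary pieces of a multiple of
  \<open>h\<close>, at least one dominates a fixed fraction of it.\<close>

lemma exists_contraction_constant:
  "\<exists>\<epsilon>>0. \<epsilon> < 1 \<and> (\<forall>h u w k. h \<in> log_lip_cone X M' \<longrightarrow> u \<in> log_lip_cone X M' \<longrightarrow> w \<in> log_lip_cone X M' \<longrightarrow>
    0 \<le> k \<longrightarrow> (\<forall>x\<in>X. u x + w x = k * h x) \<longrightarrow>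
    (\<lambda>x. u x - \<epsilon> * k * h x) \<in> log_lip_cone X M \<or> (\<lambda>x. w x - \<epsilon> * k * h x) \<in> log_lip_cone X M)"
proof -
  obtain x0 where x0: "x0 \<in> X" using X_ne by blast
  define D where "D = diameter X"
  have D: "\<bar>x - y\<bar> \<le> D" if "x \<in> X" "y \<in> X" for x y
    using diameter_bounded_bound[OF compact_imp_bounded[OF compact_X] that] by (simp add: D_def dist_real_def)
  have D0: "0 \<le> D" using D[OF x0 x0] by simp
  define E where "E = exp (M' * D)"
  have E1: "1 \<le> E" using M' D0 by (simp add: E_def)
  have osc: "f x \<le> E * f y" if "f \<in> log_lip_cone X M'" "x \<in> X" "y \<in> X" for f x y
  proof -
    have "f x \<le> exp (M' * \<bar>x - y\<bar>) * f y" by (rule log_lip_coneD(3)[OF that])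
    also have "\<dots> \<le> E * f y"
      unfolding E_def using D[OF that(2,3)] M' log_lip_coneD(2)[OF that(1,3)]
      by (intro mult_right_mono) (auto intro: mult_left_mono)
    finally show ?thesis .
  qed
  define \<delta> where "\<delta> = (M - M') / (M + M')"
  have \<delta>: "0 < \<delta>" "\<delta> \<le> 1" using M' by (auto simp: \<delta>_def)
  \<comment> \<open>The two factors \<open>E\<close> pay for moving the evaluation of h and of u to
    x0, and 2 for selecting the larger of two pieces.\<close>
  define \<epsilon> where "\<epsilon> = \<delta> / (2 * (E * E))"
  have EE: "1 \<le> E * E" using mult_mono[OF E1 E1] E1 by simp
  have \<epsilon>: "0 < \<epsilon>" "\<epsilon> < 1" using \<delta> EE by (auto simp: \<epsilon>_def divide_less_eq)
  have step: "(\<lambda>x. u x - \<epsilon> * k * h x) \<in> log_lip_cone X M"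
    if h: "h \<in> log_lip_cone X M'" and u: "u \<in> log_lip_cone X M'" and k: "0 \<le> k"
      and half: "k * h x0 \<le> 2 * u x0" for h u k
  proof (rule log_lip_cone_diff[OF M' h u])
    show "0 \<le> \<epsilon> * k" using \<epsilon> k by simp
    fix y assume y: "y \<in> X"
    have "k * h y \<le> k * (E * h x0)" using osc[OF h y x0] k by (rule mult_left_mono)
    also have "\<dots> = E * (k * h x0)" by simp
    also have "\<dots> \<le> E * (2 * u x0)" using half E1 by (intro mult_left_mono) auto
    also have "\<dots> \<le> E * (2 * (E * u y))" using osc[OF u x0 y] E1 by (intro mult_left_mono) auto
    finally have "\<epsilon> * (k * h y) \<le> \<epsilon> * (2 * (E * E) * u y)" using \<epsilon> by (intro mult_left_mono) (auto simp: algebra_simps)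
    also have "\<dots> = \<delta> * u y" using E1 by (simp add: \<epsilon>_def)
    finally show "\<epsilon> * k * h y \<le> (M - M') / (M + M') * u y" by (simp add: \<delta>_def mult.assoc)
  qed
  show ?thesis
  proof (intro exI[of _ \<epsilon>] conjI allI impI)
    fix h u w k
    assume a: "h \<in> log_lip_cone X M'" "u \<in> log_lip_cone X M'" "w \<in> log_lip_cone X M'" "0 \<le> k"
      "\<forall>x\<in>X. u x + w x = k * h x"
    \<comment> \<open>At the single point x0 one of the two pieces carries at least half of k * h;
      bounded oscillation spreads this over \<open>X\<close>.\<close>
    have "k * h x0 \<le> 2 * u x0 \<or> k * h x0 \<le> 2 * w x0" using a(5) x0 by (smt (verit))
    thus "(\<lambda>x. u x - \<epsilon> * k * h x) \<in> log_lip_cone X M \<or> (\<lambda>x. w x - \<epsilon> * k * h x) \<in> log_lip_cone X M"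
      using step[OF a(1,2,4)] step[OF a(1,3,4)] by blast
  qed (use \<epsilon> in auto)
qed

text \<open>Consecutive iterates are enclosed, in the order of the cone, between multiples of each
  other. Applying \<open>A\<close> preserves an enclosure and moves its differences into the smaller
  cone, where the contraction constant allows one of the two multiples to be improved.\<close>

lemma exists_ratio_bounds:
  assumes f0: "f0 \<in> log_lip_cone X M'" "\<And>x. x \<in> X \<Longrightarrow> 0 < f0 x"
  shows "\<exists>\<alpha> \<beta> q. 0 < \<alpha> 0 \<and> 0 \<le> q \<and> q < 1 \<and>
    (\<forall>n. \<alpha> 0 \<le> \<alpha> n \<and> \<alpha> n \<le> \<alpha> (Suc n) \<and> \<beta> (Suc n) \<le> \<beta> n \<and> \<beta> n - \<alpha> n \<le> (\<beta> 0 - \<alpha> 0) * q ^ n \<and>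
      (\<forall>x\<in>X. \<alpha> n * (A ^^ n) f0 x \<le> (A ^^ Suc n) f0 x \<and> (A ^^ Suc n) f0 x \<le> \<beta> n * (A ^^ n) f0 x))"
proof -
  define f where "f n = (A ^^ n) f0" for n
  have f: "f n \<in> log_lip_cone X M' \<and> (\<forall>x\<in>X. 0 < f n x)" for n
  proof (induction n)
    case (Suc n)
    thus ?case using cone_sub cone pos by (auto simp: f_def)
  qed (use f0 in \<open>auto simp: f_def\<close>)
  have fS: "f (Suc n) = A (f n)" for n by (simp add: f_def)
  have fc: "continuous_on X (f n)" for n using f log_lip_coneD(1) by blast
  obtain \<epsilon> where \<epsilon>: "0 < \<epsilon>" "\<epsilon> < 1" and contr: "\<forall>h u w k. h \<in> log_lip_cone X M' \<longrightarrow> u \<in> log_lip_cone X M' \<longrightarrow>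
      w \<in> log_lip_cone X M' \<longrightarrow> 0 \<le> k \<longrightarrow> (\<forall>x\<in>X. u x + w x = k * h x) \<longrightarrow>
      (\<lambda>x. u x - \<epsilon> * k * h x) \<in> log_lip_cone X M \<or> (\<lambda>x. w x - \<epsilon> * k * h x) \<in> log_lip_cone X M"
    using exists_contraction_constant by (elim exE conjE) (rule that)
  \<comment> \<open>\<open>P\<close> is an enclosure at stage n, \<open>Q\<close> a refinement that
    shrinks its width by the factor 1 - \<epsilon>; dependent choice then produces the
    sequence.\<close>
  define P where "P n p \<longleftrightarrow> 0 < fst p \<and> (\<lambda>x. f (Suc n) x - fst p * f n x) \<in> log_lip_cone X M \<and>
      (\<lambda>x. snd p * f n x - f (Suc n) x) \<in> log_lip_cone X M" for n and p :: "real \<times> real"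
  define Q where "Q p p' \<longleftrightarrow> fst p \<le> fst p' \<and> snd p' \<le> snd p \<and>
      snd p' - fst p' \<le> (1 - \<epsilon>) * (snd p - fst p)" for p p' :: "real \<times> real"
  obtain x0 where x0: "x0 \<in> X" using X_ne by blast
  have between: "fst p * f n x \<le> f (Suc n) x" "f (Suc n) x \<le> snd p * f n x" if "P n p" "x \<in> X" for n p x
    using that log_lip_coneD(2) unfolding P_def by force+
  have le: "fst p \<le> snd p" if "P n p" for n p
    using between[OF that x0] f[of n] x0 by (meson mult_le_cancel_right_pos order_trans)
  have init: "\<exists>p. P 0 p"
  proof -
    obtain c where c: "0 < c" "(\<lambda>x. c * f 1 x - f 0 x) \<in> log_lip_cone X M"
      using exists_cone_dominator[of "f 0" M' "f 1"] f M' by blast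
    obtain b where b: "0 < b" "(\<lambda>x. b * f 0 x - f 1 x) \<in> log_lip_cone X M"
      using exists_cone_dominator[of "f 1" M' "f 0"] f M' by blast
    have "(\<lambda>x. 1 / c * (c * f 1 x - f 0 x) + 0 * (c * f 1 x - f 0 x)) \<in> log_lip_cone X M"
      using c by (intro log_lip_cone_comb) auto
    hence "(\<lambda>x. f 1 x - 1 / c * f 0 x) \<in> log_lip_cone X M"
      by (rule log_lip_cone_cong) (use c in \<open>simp add: field_simps\<close>)
    thus ?thesis using b c by (intro exI[of _ "(1 / c, b)"]) (simp add: P_def)
  qed
  have step: "\<exists>p'. P (Suc n) p' \<and> Q p p'" if p: "P n p" for n p
  proof -
    define a b where "a = fst p" and "b = snd p"
    define u w where "u x = f (Suc (Suc n)) x - a * f (Suc n) x" and "w x = b * f (Suc n) x - f (Suc (Suc n)) x" for x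
    have ab: "a \<le> b" "0 < a" using le[OF p] p by (auto simp: a_def b_def P_def)
    have u: "u \<in> log_lip_cone X M'"
    proof (rule log_lip_cone_cong[OF cone])
      show "(\<lambda>x. f (Suc n) x - a * f n x) \<in> log_lip_cone X M" using p by (simp add: P_def a_def)
      show "A (\<lambda>x. f (Suc n) x - a * f n x) x = u x" if "x \<in> X" for x
        using A_diff[OF fc fc that, of 1 "Suc n" a n] by (simp add: u_def fS)
    qed
    have w: "w \<in> log_lip_cone X M'"
    proof (rule log_lip_cone_cong[OF cone])
      show "(\<lambda>x. b * f n x - f (Suc n) x) \<in> log_lip_cone X M" using p by (simp add: P_def b_def)
      show "A (\<lambda>x. b * f n x - f (Suc n) x) x = w x" if "x \<in> X" for x
        using A_diff[OF fc fc that, of b n 1 "Suc n"] by (simp add: w_def fS)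
    qed
    have "(\<lambda>x. u x - \<epsilon> * (b - a) * f (Suc n) x) \<in> log_lip_cone X M \<or>
        (\<lambda>x. w x - \<epsilon> * (b - a) * f (Suc n) x) \<in> log_lip_cone X M"
      using f ab by (intro contr[rule_format] u w) (auto simp: u_def w_def algebra_simps)
    thus ?thesis
    proof
      assume "(\<lambda>x. u x - \<epsilon> * (b - a) * f (Suc n) x) \<in> log_lip_cone X M"
      hence "(\<lambda>x. f (Suc (Suc n)) x - (a + \<epsilon> * (b - a)) * f (Suc n) x) \<in> log_lip_cone X M"
        by (rule log_lip_cone_cong) (simp add: u_def algebra_simps)
      moreover have "(\<lambda>x. b * f (Suc n) x - f (Suc (Suc n)) x) \<in> log_lip_cone X M"
        using w cone_sub unfolding w_def by blast
      moreover have "0 < a + \<epsilon> * (b - a)" using ab \<epsilon> by (simp add: add_pos_nonneg)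
      ultimately have "P (Suc n) (a + \<epsilon> * (b - a), b)" by (simp add: P_def)
      moreover have "Q p (a + \<epsilon> * (b - a), b)"
        unfolding Q_def using ab \<epsilon> by (auto simp: a_def b_def algebra_simps)
      ultimately show ?thesis by blast
    next
      assume "(\<lambda>x. w x - \<epsilon> * (b - a) * f (Suc n) x) \<in> log_lip_cone X M"
      hence "(\<lambda>x. (b - \<epsilon> * (b - a)) * f (Suc n) x - f (Suc (Suc n)) x) \<in> log_lip_cone X M"
        by (rule log_lip_cone_cong) (simp add: w_def algebra_simps)
      moreover have "(\<lambda>x. f (Suc (Suc n)) x - a * f (Suc n) x) \<in> log_lip_cone X M"
        using u cone_sub unfolding u_def by blast
      ultimately have "P (Suc n) (a, b - \<epsilon> * (b - a))" using ab by (simp add: P_def)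
      moreover have "Q p (a, b - \<epsilon> * (b - a))"
        unfolding Q_def using ab \<epsilon> by (auto simp: a_def b_def algebra_simps)
      ultimately show ?thesis by blast
    qed
  qed
  obtain p where p: "\<And>n. P n (p n)" "\<And>n. Q (p n) (p (Suc n))"
    using dependent_nat_choice[of P "\<lambda>n. Q", OF init step] by blast
  define \<alpha> \<beta> where "\<alpha> n = fst (p n)" and "\<beta> n = snd (p n)" for n
  have mono: "\<alpha> n \<le> \<alpha> (Suc n)" "\<beta> (Suc n) \<le> \<beta> n" for n using p(2)[of n] by (auto simp: \<alpha>_def \<beta>_def Q_def)
  have "\<alpha> 0 \<le> \<alpha> n" for n using mono(1) by (induction n) (auto intro: order_trans)
  moreover have "\<beta> n - \<alpha> n \<le> (\<beta> 0 - \<alpha> 0) * (1 - \<epsilon>) ^ n" for n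
  proof (induction n)
    case (Suc n)
    have "\<beta> (Suc n) - \<alpha> (Suc n) \<le> (1 - \<epsilon>) * (\<beta> n - \<alpha> n)"
      using p(2)[of n] by (auto simp: \<alpha>_def \<beta>_def Q_def)
    also have "\<dots> \<le> (1 - \<epsilon>) * ((\<beta> 0 - \<alpha> 0) * (1 - \<epsilon>) ^ n)" using Suc \<epsilon> by (intro mult_left_mono) auto
    finally show ?case by (simp add: algebra_simps)
  qed simp
  moreover have "0 < \<alpha> 0" using p(1)[of 0] by (simp add: \<alpha>_def P_def)
  moreover have "\<alpha> n * f n x \<le> f (Suc n) x \<and> f (Suc n) x \<le> \<beta> n * f n x" if "x \<in> X" for n x
    using between[OF p(1) that] by (simp add: \<alpha>_def \<beta>_def)
  ultimately show ?thesis
    using mono \<epsilon> by (intro exI[of _ \<alpha>] exI[of _ \<beta>] exI[of _ "1 - \<epsilon>"]) (auto simp: f_def)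
qed

text \<open>Normalized at x0, the iterates form a uniformly Cauchy sequence because the ratio bounds
  close up geometrically. Their convergence is part of the conclusion: properties of the iterates,
  not just of the cone, must reach the limit.\<close>

theorem exists_eigenvector:
  assumes f0: "f0 \<in> log_lip_cone X M'" "\<And>x. x \<in> X \<Longrightarrow> 0 < f0 x" and x0: "x0 \<in> X"
  shows "\<exists>v \<rho>. 0 < \<rho> \<and> v \<in> log_lip_cone X M' \<and> (\<forall>x\<in>X. 0 < v x \<and> A v x = \<rho> * v x \<and>
    (\<lambda>n. (A ^^ n) f0 x / (A ^^ n) f0 x0) \<longlonglongrightarrow> v x)"
proof -
  obtain \<alpha> \<beta> q where q: "0 < \<alpha> 0" "0 \<le> q" "q < 1"
    and mono: "\<And>n. \<alpha> 0 \<le> \<alpha> n" "\<And>n. \<alpha> n \<le> \<alpha> (Suc n)" "\<And>n. \<beta> (Suc n) \<le> \<beta> n"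
    and diff: "\<And>n. \<beta> n - \<alpha> n \<le> (\<beta> 0 - \<alpha> 0) * q ^ n"
    and betw: "\<And>n x. x \<in> X \<Longrightarrow> \<alpha> n * (A ^^ n) f0 x \<le> (A ^^ Suc n) f0 x"
      "\<And>n x. x \<in> X \<Longrightarrow> (A ^^ Suc n) f0 x \<le> \<beta> n * (A ^^ n) f0 x"
    using exists_ratio_bounds[OF f0] by blast
  define f where "f n = (A ^^ n) f0" for n
  have f: "f n \<in> log_lip_cone X M' \<and> (\<forall>x\<in>X. 0 < f n x)" for n
  proof (induction n)
    case (Suc n)
    thus ?case using cone_sub cone pos by (auto simp: f_def)
  qed (use f0 in \<open>auto simp: f_def\<close>)
  have fp: "0 < f n x" if "x \<in> X" for n x using f that by blast
  have fc: "continuous_on X (f n)" for n using f log_lip_coneD(1) by blast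
  define r where "r n = f (Suc n) x0 / f n x0" for n
  have rb: "\<alpha> n \<le> r n" "r n \<le> \<beta> n" for n
    using betw[OF x0, of n] fp[OF x0, of n] by (auto simp: r_def f_def field_simps)
  have r0: "0 < r n" for n using rb(1)[of n] mono(1)[of n] q by linarith
  define G where "G n x = f n x / f n x0" for n x
  have Gcone: "G n \<in> log_lip_cone X M'" for n
  proof -
    have "(\<lambda>x. 1 / f n x0 * f n x + 0 * f n x) \<in> log_lip_cone X M'"
      using f fp[OF x0] by (intro log_lip_cone_comb) (auto intro: less_imp_le)
    thus ?thesis by (rule log_lip_cone_cong) (simp add: G_def)
  qed
  have Gx0: "G n x0 = 1" for n using fp[OF x0, of n] by (simp add: G_def)
  obtain E where E: "0 < E" "\<And>x. x \<in> X \<Longrightarrow> exp (M' * \<bar>x - x0\<bar>) \<le> E"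
  proof -
    have "continuous_on X (\<lambda>x. exp (M' * \<bar>x - x0\<bar>))" by (intro continuous_intros)
    from continuous_upper_bound[OF compact_X X_ne this] show ?thesis using that by blast
  qed
  have GE: "G n x \<le> E" if "x \<in> X" for n x
    using log_lip_coneD(3)[OF Gcone that x0, of n] E(2)[OF that] by (simp add: Gx0)
  have G0: "0 \<le> G n x" if "x \<in> X" for n x using fp[OF that, of n] fp[OF x0, of n] by (simp add: G_def)
  define K where "K = E / \<alpha> 0 * (\<beta> 0 - \<alpha> 0)"
  have Gstep: "\<bar>G (Suc n) x - G n x\<bar> \<le> K * q ^ n" if x: "x \<in> X" for n x
  proof -
    define t where "t = f (Suc n) x / f n x"
    have t: "\<alpha> n \<le> t" "t \<le> \<beta> n"
      using betw[OF x, of n] fp[OF x, of n] by (auto simp: t_def f_def field_simps)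
    \<comment> \<open>The relative change equals the difference of the growth ratios at x and x0,
      both of which lie in the enclosure at stage n.\<close>
    have e: "G (Suc n) x - G n x = G n x * ((t - r n) / r n)"
      using fp[OF x, of n] fp[OF x0, of n] fp[OF x0, of "Suc n"]
      by (simp add: G_def t_def r_def field_simps)
    have "\<bar>t - r n\<bar> / r n \<le> (\<beta> n - \<alpha> n) / \<alpha> 0"
      using t rb[of n] mono(1)[of n] q by (intro frac_le) auto
    hence "\<bar>G (Suc n) x - G n x\<bar> \<le> E * ((\<beta> n - \<alpha> n) / \<alpha> 0)"
      unfolding e abs_mult using GE[OF x, of n] G0[OF x, of n] r0[of n] E(1)
      by (intro mult_mono) (auto simp: abs_divide)
    also have "\<dots> \<le> E * (((\<beta> 0 - \<alpha> 0) * q ^ n) / \<alpha> 0)"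
      using diff[of n] q E(1) by (intro mult_left_mono divide_right_mono) auto
    finally show ?thesis by (simp add: K_def mult_ac)
  qed
  define v where "v x = G 0 x + (\<Sum>n. G (Suc n) x - G n x)" for x
  have "uniform_limit X (\<lambda>n x. \<Sum>k<n. G (Suc k) x - G k x) (\<lambda>x. \<Sum>k. G (Suc k) x - G k x) sequentially"
    by (rule Weierstrass_m_test[where M = "\<lambda>n. K * q ^ n"]) (use Gstep q in \<open>auto intro!: summable_mult\<close>)
  hence lim: "uniform_limit X G v sequentially"
  proof -
    have "(\<Sum>k<n. G (Suc k) x - G k x) = G n x - G 0 x" for n x by (rule sum_lessThan_telescope)
    with \<open>uniform_limit X _ _ sequentially\<close> show ?thesis
      unfolding uniform_limit_iff v_def by (simp add: dist_real_def algebra_simps)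
  qed
  have Gc: "continuous_on X (G n)" for n using Gcone log_lip_coneD(1) by blast
  have vc: "continuous_on X v" by (rule uniform_limit_theorem[OF _ lim]) (auto intro!: always_eventually Gc)
  have pl: "(\<lambda>n. G n x) \<longlonglongrightarrow> v x" if "x \<in> X" for x using tendsto_uniform_limitI[OF lim that] .
  have vx0: "v x0 = 1" using pl[OF x0] unfolding Gx0 by (simp add: LIMSEQ_const_iff)
  have vcone: "v \<in> log_lip_cone X M'"
  proof (rule log_lip_coneI[OF vc])
    show "0 \<le> v x" if "x \<in> X" for x using pl[OF that] G0[OF that] by (intro LIMSEQ_le_const) auto
    fix x y assume xy: "x \<in> X" "y \<in> X"
    show "v x \<le> exp (M' * \<bar>x - y\<bar>) * v y"
      using log_lip_coneD(3)[OF Gcone xy]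
      by (intro LIMSEQ_le[OF pl[OF xy(1)] tendsto_mult_left[OF pl[OF xy(2)]]]) auto
  qed
  \<comment> \<open>A zero at x would force v x0 = 0 by the cone inequality, but v x0 = 1.\<close>
  have vpos: "0 < v x" if "x \<in> X" for x
    using log_lip_coneD(3)[OF vcone x0 that] vx0 log_lip_coneD(2)[OF vcone that]
    by (cases "v x = 0") auto
  have "\<exists>\<rho>. \<alpha> \<longlonglongrightarrow> \<rho> \<and> (\<forall>n. \<alpha> n \<le> \<rho>)"
  proof -
    have inc: "incseq \<alpha>" using mono(2) by (rule incseq_SucI)
    have "\<beta> n \<le> \<beta> 0" for n using mono(3) by (induction n) (auto intro: order_trans)
    hence "\<alpha> n \<le> \<beta> 0" for n using rb[of n] by (meson order_trans)
    thus ?thesis using incseq_convergent[OF inc, of "\<beta> 0"] by blast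
  qed
  then obtain \<rho> where \<rho>: "\<alpha> \<longlonglongrightarrow> \<rho>" "\<And>n. \<alpha> n \<le> \<rho>" by blast
  have rlim: "r \<longlonglongrightarrow> \<rho>"
  proof -
    have "(\<lambda>n. (\<beta> 0 - \<alpha> 0) * q ^ n) \<longlonglongrightarrow> (\<beta> 0 - \<alpha> 0) * 0"
      using q by (intro tendsto_intros LIMSEQ_power_zero) auto
    hence lim0: "(\<lambda>n. (\<beta> 0 - \<alpha> 0) * q ^ n) \<longlonglongrightarrow> 0" by simp
    have nb: "norm (r n - \<alpha> n) \<le> (\<beta> 0 - \<alpha> 0) * q ^ n" for n
      using rb[of n] diff[of n] by auto
    have "(\<lambda>n. r n - \<alpha> n) \<longlonglongrightarrow> 0"
      by (rule Lim_null_comparison[OF _ lim0]) (simp only: nb eventually_True)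
    from tendsto_add[OF this \<rho>(1)] show ?thesis by simp
  qed
  have AG: "A (G n) x = r n * G (Suc n) x" if x: "x \<in> X" for n x
  proof -
    have "A (G n) x = A (\<lambda>y. 1 / f n x0 * f n y + 0 * f n y) x"
      by (rule fun_cong[OF T_cong]) (simp add: G_def)
    also have "\<dots> = 1 / f n x0 * A (f n) x + 0 * A (f n) x" by (rule T_lin[OF fc fc x])
    finally show ?thesis using fp[OF x0, of "Suc n"] by (simp add: G_def r_def f_def)
  qed
  have Av: "A v x = \<rho> * v x" if x: "x \<in> X" for x
  proof -
    have "(\<lambda>n. A (G n) x) \<longlonglongrightarrow> A v x"
    proof (rule LIMSEQ_I)
      fix e :: real assume e: "0 < e"
      define e' where "e' = e / (2 * (\<bar>C\<bar> + 1))"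
      have e': "0 < e'" using e by (simp add: e'_def)
      obtain N where N: "\<And>n y. n \<ge> N \<Longrightarrow> y \<in> X \<Longrightarrow> dist (G n y) (v y) < e'"
        using uniform_limitD[OF lim e'] unfolding eventually_sequentially by blast
      have "norm (A (G n) x - A v x) < e" if n: "n \<ge> N" for n
      proof -
        have "A (\<lambda>y. 1 * G n y - 1 * v y) x = 1 * A (G n) x - 1 * A v x"
          by (rule A_diff[OF Gc vc x])
        moreover have "norm (A (\<lambda>y. 1 * G n y - 1 * v y) x) \<le> C * e'"
          using N[OF n] by (intro T_bdd x continuous_intros Gc vc) (auto simp: dist_norm dest: less_imp_le)
        moreover have "C * e' < e"
        proof -
          have "C * e' \<le> (\<bar>C\<bar> + 1) * e'" using e' by (intro mult_right_mono) auto
          also have "\<dots> = e / 2" by (simp add: e'_def field_simps)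
          finally show ?thesis using e by simp
        qed
        ultimately show ?thesis by simp
      qed
      thus "\<exists>N. \<forall>n\<ge>N. norm (A (G n) x - A v x) < e" by blast
    qed
    moreover have "(\<lambda>n. A (G n) x) \<longlonglongrightarrow> \<rho> * v x"
      unfolding AG[OF x] using rlim LIMSEQ_Suc[OF pl[OF x]] by (intro tendsto_mult)
    ultimately show ?thesis by (rule LIMSEQ_unique)
  qed
  have "0 < \<rho>" using \<rho>(2)[of 0] q by simp
  thus ?thesis using vcone vpos Av pl by (intro exI[of _ v] exI[of _ \<rho>]) (auto simp: G_def f_def)
qed

section \<open>Comparison of eigenvalues and identification with the spectral radius\<close>

lemma A_pow_cone: "f \<in> log_lip_cone X M \<Longrightarrow> (A ^^ n) f \<in> log_lip_cone X M"
  using cone cone_sub by (induction n) auto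

lemma power_ratio_le:
  fixes a b s t :: real
  assumes "0 < s" "0 < t" "0 \<le> a" "0 < b" "\<And>n. a ^ n * s \<le> b ^ n * t"
  shows "a \<le> b"
proof (rule ccontr)
  assume "\<not> a \<le> b"
  hence "1 < a / b" using assms by simp
  then obtain n where "t / s < (a / b) ^ n" using real_arch_pow by blast
  hence "b ^ n * t < a ^ n * s" using assms by (simp add: power_divide field_simps)
  thus False using assms(5)[of n] by simp
qed

text \<open>Comparison in the order induced by the cone, rather than in the pointwise order, which the
  operator need not respect.\<close>

lemma eigenvalue_bounds:
  assumes v: "v \<in> log_lip_cone X M'" "\<And>x. x \<in> X \<Longrightarrow> 0 < v x" "\<And>x. x \<in> X \<Longrightarrow> A v x = \<rho> * v x" "0 < \<rho>"
    and w: "w \<in> log_lip_cone X L" "\<And>x. x \<in> X \<Longrightarrow> 0 < w x" "0 \<le> L" "L < M"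
  shows "(\<lambda>x. A w x - a * w x) \<in> log_lip_cone X M \<Longrightarrow> 0 \<le> a \<Longrightarrow> a \<le> \<rho>"
    and "(\<lambda>x. b * w x - A w x) \<in> log_lip_cone X M \<Longrightarrow> 0 < b \<Longrightarrow> \<rho> \<le> b"
proof -
  obtain x0 where x0: "x0 \<in> X" using X_ne by blast
  define L' where "L' = max L M'"
  have L': "0 \<le> L'" "L' < M" using w(3,4) M' by (auto simp: L'_def)
  have vw: "v \<in> log_lip_cone X L'" "w \<in> log_lip_cone X L'"
    using v(1) w(1) log_lip_cone_mono[of M' L' X] log_lip_cone_mono[of L L' X] by (auto simp: L'_def)
  have c: "continuous_on X v" "continuous_on X w" using v(1) w(1) log_lip_coneD(1) by blast+
  have Anv: "(A ^^ n) v x = \<rho> ^ n * v x" if "x \<in> X" for n x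
    using that T_pow_eigen[OF c(1) v(3)] by blast
  have wM: "w \<in> log_lip_cone X M" using w log_lip_cone_mono[of L M X] by auto
  note Apc = T_pow_cont[OF c(2)]
  {
    assume a: "(\<lambda>x. A w x - a * w x) \<in> log_lip_cone X M" "0 \<le> a"
    \<comment> \<open>The next difference is \<open>A\<close> applied to the present one plus a^n
      times the assumed one.\<close>
    have pn: "(\<lambda>x. (A ^^ n) w x - a ^ n * w x) \<in> log_lip_cone X M" for n
    proof (induction n)
      case 0
      show ?case by (rule log_lip_coneI) auto
    next
      case (Suc n)
      have "A (\<lambda>x. (A ^^ n) w x - a ^ n * w x) \<in> log_lip_cone X M"
        using cone[OF Suc] cone_sub by blast
      hence "(\<lambda>x. 1 * A (\<lambda>x. (A ^^ n) w x - a ^ n * w x) x + a ^ n * (A w x - a * w x)) \<in> log_lip_cone X M"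
        using a by (intro log_lip_cone_comb) auto
      thus ?case
      proof (rule log_lip_cone_cong)
        fix x assume x: "x \<in> X"
        show "1 * A (\<lambda>x. (A ^^ n) w x - a ^ n * w x) x + a ^ n * (A w x - a * w x)
            = (A ^^ Suc n) w x - a ^ Suc n * w x"
          using A_diff[OF Apc[of n] c(2) x, of 1 "a ^ n"] by (simp add: algebra_simps)
      qed
    qed
    \<comment> \<open>Once \<open>w\<close> is dominated by a multiple of \<open>v\<close>, its
      iterates grow at most like \<rho>^n, and a^n cannot outgrow them.\<close>
    obtain k where k: "0 < k" "(\<lambda>x. k * v x - w x) \<in> log_lip_cone X M"
      using exists_cone_dominator[OF vw(2,1) L' v(2)] by blast
    have rat: "a ^ n * w x0 \<le> \<rho> ^ n * (k * v x0)" for n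
    proof -
      have "a ^ n * w x0 \<le> (A ^^ n) w x0" using log_lip_coneD(2)[OF pn x0, of n] by simp
      moreover have "0 \<le> (A ^^ n) (\<lambda>x. k * v x - w x) x0"
        using log_lip_coneD(2)[OF A_pow_cone[OF k(2)] x0] .
      moreover have "(A ^^ n) (\<lambda>x. k * v x - w x) x0 = k * (A ^^ n) v x0 - (A ^^ n) w x0"
        using T_pow_lin[OF c x0, of n k "- 1"] by simp
      ultimately show ?thesis by (simp add: Anv[OF x0] mult_ac)
    qed
    show "a \<le> \<rho>"
      by (rule power_ratio_le[OF w(2)[OF x0] mult_pos_pos[OF k(1) v(2)[OF x0]] a(2) v(4) rat])
  }
  {
    assume b: "(\<lambda>x. b * w x - A w x) \<in> log_lip_cone X M" "0 < b"
    have pn: "(\<lambda>x. b ^ n * w x - (A ^^ n) w x) \<in> log_lip_cone X M" for n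
    proof (induction n)
      case 0
      show ?case by (rule log_lip_coneI) auto
    next
      case (Suc n)
      have "A (\<lambda>x. b ^ n * w x - (A ^^ n) w x) \<in> log_lip_cone X M"
        using cone[OF Suc] cone_sub by blast
      hence "(\<lambda>x. 1 * A (\<lambda>x. b ^ n * w x - (A ^^ n) w x) x + b ^ n * (b * w x - A w x)) \<in> log_lip_cone X M"
        using b by (intro log_lip_cone_comb) auto
      thus ?case
      proof (rule log_lip_cone_cong)
        fix x assume x: "x \<in> X"
        show "1 * A (\<lambda>x. b ^ n * w x - (A ^^ n) w x) x + b ^ n * (b * w x - A w x)
            = b ^ Suc n * w x - (A ^^ Suc n) w x"
          using A_diff[OF c(2) Apc[of n] x, of "b ^ n" 1] by (simp add: algebra_simps)
      qed
    qed
    obtain k where k: "0 < k" "(\<lambda>x. k * w x - v x) \<in> log_lip_cone X M"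
      using exists_cone_dominator[OF vw L' w(2)] by blast
    have rat: "\<rho> ^ n * v x0 \<le> b ^ n * (k * w x0)" for n
    proof -
      have "k * (A ^^ n) w x0 \<le> k * (b ^ n * w x0)"
        using log_lip_coneD(2)[OF pn x0, of n] k(1) by (intro mult_left_mono) auto
      moreover have "0 \<le> (A ^^ n) (\<lambda>x. k * w x - v x) x0"
        using log_lip_coneD(2)[OF A_pow_cone[OF k(2)] x0] .
      moreover have "(A ^^ n) (\<lambda>x. k * w x - v x) x0 = k * (A ^^ n) w x0 - (A ^^ n) v x0"
        using T_pow_lin[OF c(2,1) x0, of n k "- 1"] by simp
      ultimately show ?thesis by (simp add: Anv[OF x0] mult_ac)
    qed
    show "\<rho> \<le> b"
      by (rule power_ratio_le[OF v(2)[OF x0] mult_pos_pos[OF k(1) w(2)[OF x0]] less_imp_le[OF v(4)] b(2) rat])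
  }
qed

text \<open>The eigenvector satisfies the inequalities of the larger cone strictly. On a finite set
  it is therefore an interior point: adding a multiple of it brings any bounded function into the
  cone, whose invariance then bounds all powers without pointwise positivity.\<close>

lemma spec_radius_eq_finite:
  assumes fin: "finite X"
    and v: "v \<in> log_lip_cone X M'" "\<And>x. x \<in> X \<Longrightarrow> 0 < v x" "\<And>x. x \<in> X \<Longrightarrow> A v x = \<rho> * v x" "0 < \<rho>"
  shows "spec_radius X A = \<rho>"
proof -
  obtain x0 where x0: "x0 \<in> X" using X_ne by blast
  have c: "continuous_on X f" for f :: "real \<Rightarrow> real" using fin by (rule continuous_on_finite)
  \<comment> \<open>The least slack in the finitely many strict inequalities satisfied by
    \<open>v\<close>.\<close>
  define m where "m = Min (insert 1 (v ` X \<union> (\<lambda>(x, y). exp (M * \<bar>x - y\<bar>) * v y - v x) ` {(x, y) \<in> X \<times> X. x \<noteq> y}))"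
  have finS: "finite (insert 1 (v ` X \<union> (\<lambda>(x, y). exp (M * \<bar>x - y\<bar>) * v y - v x) ` {(x, y) \<in> X \<times> X. x \<noteq> y}))"
    using fin by (auto intro!: finite_imageI intro: finite_subset[of _ "X \<times> X"])
  have strict: "0 < exp (M * \<bar>x - y\<bar>) * v y - v x" if "x \<in> X" "y \<in> X" "x \<noteq> y" for x y
  proof -
    have "v x \<le> exp (M' * \<bar>x - y\<bar>) * v y" by (rule log_lip_coneD(3)[OF v(1) that(1,2)])
    also have "\<dots> < exp (M * \<bar>x - y\<bar>) * v y" using v(2)[OF that(2)] M' that(3) by simp
    finally show ?thesis by simp
  qed
  have m0: "0 < m" unfolding m_def using finS strict v(2) by (subst Min_gr_iff) auto
  have m1: "m \<le> v x" if "x \<in> X" for x unfolding m_def using finS that by (intro Min_le) auto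
  have m2: "m \<le> exp (M * \<bar>x - y\<bar>) * v y - v x" if "x \<in> X" "y \<in> X" "x \<noteq> y" for x y
    unfolding m_def using finS that by (intro Min_le) force+
  obtain E where E: "0 < E" "\<And>x y. x \<in> X \<Longrightarrow> y \<in> X \<Longrightarrow> exp (M * \<bar>x - y\<bar>) \<le> E"
  proof -
    define E where "E = exp (M * diameter X)"
    have "exp (M * \<bar>x - y\<bar>) \<le> E" if "x \<in> X" "y \<in> X" for x y
      unfolding E_def using M' diameter_bounded_bound[OF compact_imp_bounded[OF compact_X] that]
      by (auto simp: dist_real_def intro: mult_left_mono)
    thus ?thesis using that[of E] by (simp add: E_def)
  qed
  \<comment> \<open>Both terms of a cone inequality may be perturbed: one by at most K, the other,
    after the exponential factor, by at most E K.\<close>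
  define D0 where "D0 = (E + 1) / m"
  have D0: "0 < D0" using E m0 by (simp add: D0_def)
  have inK: "(\<lambda>x. D0 * K * v x + \<sigma> * f x) \<in> log_lip_cone X M"
    if K: "\<And>y. y \<in> X \<Longrightarrow> \<bar>f y\<bar> \<le> K" and \<sigma>: "\<bar>\<sigma>\<bar> = 1" for f K \<sigma>
  proof (rule log_lip_coneI[OF c])
    have K0: "0 \<le> K" using K[OF x0] by linarith
    have sf: "\<bar>\<sigma> * f y\<bar> \<le> K" if "y \<in> X" for y using K[OF that] \<sigma> by (simp add: abs_mult)
    have DKm: "D0 * K * m = (E + 1) * K" using m0 by (simp add: D0_def)
    fix x assume x: "x \<in> X"
    have "D0 * K * m \<le> D0 * K * v x" using m1[OF x] D0 K0 by (intro mult_left_mono) auto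
    moreover have "K \<le> (E + 1) * K" using K0 E(1) by (simp add: algebra_simps)
    ultimately show "0 \<le> D0 * K * v x + \<sigma> * f x" using sf[OF x] DKm by linarith
    fix y assume y: "y \<in> X"
    show "D0 * K * v x + \<sigma> * f x \<le> exp (M * \<bar>x - y\<bar>) * (D0 * K * v y + \<sigma> * f y)"
    proof (cases "x = y")
      case False
      have "D0 * K * m \<le> D0 * K * (exp (M * \<bar>x - y\<bar>) * v y - v x)"
        using m2[OF x y False] D0 K0 by (intro mult_left_mono) auto
      moreover have "\<bar>exp (M * \<bar>x - y\<bar>) * (\<sigma> * f y)\<bar> \<le> E * K"
        unfolding abs_mult[of "exp _"] using sf[OF y] E(2)[OF x y] E(1) by (intro mult_mono) auto
      ultimately show ?thesis using sf[OF x] DKm by (simp add: algebra_simps)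
    qed simp
  qed
  define V where "V = Max (v ` X)"
  have V: "v x \<le> V" if "x \<in> X" for x unfolding V_def using fin that by (intro Max_ge) auto
  show ?thesis
  proof (rule spec_radius_eq_eigenvalue[where v = v and p = x0 and C = C and D = "D0 * V"])
    show "field_operator X A C" ..
    show "0 \<le> D0 * V" using D0 V[OF x0] v(2)[OF x0] by simp
    fix f :: "real \<Rightarrow> real" and K x n assume f: "\<And>y. y \<in> X \<Longrightarrow> \<bar>f y\<bar> \<le> K" and x: "x \<in> X"
    have K0: "0 \<le> K" using f[OF x0] by linarith
    have "0 \<le> D0 * K * (\<rho> ^ n * v x) + \<sigma> * (A ^^ n) f x" if \<sigma>: "\<bar>\<sigma>\<bar> = 1" for \<sigma>
      using log_lip_coneD(2)[OF A_pow_cone[OF inK[of f K, OF f \<sigma>], of n] x]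
        T_pow_lin[OF c[of v] c[of f] x, of n "D0 * K" \<sigma>] T_pow_eigen[OF c[of v] v(3) x, of n] by simp
    from this[of 1] this[of "- 1"] have "\<bar>(A ^^ n) f x\<bar> \<le> D0 * K * (\<rho> ^ n * v x)" by simp
    also have "\<dots> \<le> D0 * K * (\<rho> ^ n * V)"
      using V[OF x] D0 K0 v(4) by (intro mult_left_mono) auto
    finally show "\<bar>(A ^^ n) f x\<bar> \<le> D0 * V * K * \<rho> ^ n" by (simp add: mult_ac)
  qed (use v(3,4) v(2)[OF x0] x0 c in auto)
qed

text \<open>On an infinite set a merely continuous function need not enter the cone by adding a
  multiple of \<open>v\<close>; pointwise positivity of the operator replaces that argument.\<close>

lemma spec_radius_eq_positive:
  assumes nonneg: "\<And>f x. continuous_on X f \<Longrightarrow> (\<And>y. y \<in> X \<Longrightarrow> 0 \<le> f y) \<Longrightarrow> x \<in> X \<Longrightarrow> 0 \<le> A f x"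
    and v: "v \<in> log_lip_cone X M'" "\<And>x. x \<in> X \<Longrightarrow> 0 < v x" "\<And>x. x \<in> X \<Longrightarrow> A v x = \<rho> * v x" "0 < \<rho>"
  shows "spec_radius X A = \<rho>"
proof -
  obtain x0 where x0: "x0 \<in> X" using X_ne by blast
  have vc: "continuous_on X v" by (rule log_lip_coneD(1)[OF v(1)])
  obtain m where m: "0 < m" "\<And>x. x \<in> X \<Longrightarrow> m \<le> v x"
    using positive_lower_bound[OF compact_X X_ne vc] v(2) by blast
  obtain V where V: "0 < V" "\<And>x. x \<in> X \<Longrightarrow> v x \<le> V"
    using continuous_upper_bound[OF compact_X X_ne vc] by blast
  have pn: "0 \<le> (A ^^ n) f x" if "continuous_on X f" "\<And>y. y \<in> X \<Longrightarrow> 0 \<le> f y" "x \<in> X" for f n x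
    using that(3)
  proof (induction n arbitrary: x)
    case (Suc n)
    thus ?case using nonneg[OF T_pow_cont[OF that(1)]] by simp
  qed (use that in auto)
  show ?thesis
  proof (rule spec_radius_eq_eigenvalue[where v = v and p = x0 and C = C and D = "V / m"])
    show "field_operator X A C" ..
    fix f :: "real \<Rightarrow> real" and K x n assume fc: "continuous_on X f" and f: "\<And>y. y \<in> X \<Longrightarrow> \<bar>f y\<bar> \<le> K" and x: "x \<in> X"
    have K0: "0 \<le> K" using f[OF x0] by linarith
    have "0 \<le> K / m * (\<rho> ^ n * v x) + \<sigma> * (A ^^ n) f x" if \<sigma>: "\<bar>\<sigma>\<bar> = 1" for \<sigma>
    proof -
      have "0 \<le> K / m * v y + \<sigma> * f y" if y: "y \<in> X" for y
      proof -
        have "K / m * m \<le> K / m * v y" using m K0 y by (intro mult_left_mono) auto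
        moreover have "\<bar>\<sigma> * f y\<bar> \<le> K" using f[OF y] \<sigma> by (simp add: abs_mult)
        ultimately show ?thesis using m(1) by simp
      qed
      hence "0 \<le> (A ^^ n) (\<lambda>y. K / m * v y + \<sigma> * f y) x"
        using vc fc x by (intro pn continuous_intros) auto
      thus ?thesis using T_pow_lin[OF vc fc x, of n "K / m" \<sigma>] T_pow_eigen[OF vc v(3) x, of n] by simp
    qed
    from this[of 1] this[of "- 1"] have "\<bar>(A ^^ n) f x\<bar> \<le> K / m * (\<rho> ^ n * v x)" by simp
    also have "\<dots> \<le> K / m * (\<rho> ^ n * V)"
      using V(2)[OF x] m K0 v(4) by (intro mult_left_mono) auto
    finally show "\<bar>(A ^^ n) f x\<bar> \<le> V / m * K * \<rho> ^ n" by (simp add: mult_ac)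
  qed (use v(3,4) v(2)[OF x0] x0 vc V(1) m(1) in auto)
qed

end

section \<open>The iterated function system\<close>

text \<open>The logarithmic derivative of u^(-p) is at most p/m in modulus for u \<ge> m; ln z \<le>
  z - 1 yields this bound without a mean value argument.\<close>

lemma powr_neg_log_lip:
  fixes u w m p :: real
  assumes "0 < m" "m \<le> u" "m \<le> w" "0 \<le> p"
  shows "u powr (- p) \<le> exp (p / m * \<bar>u - w\<bar>) * w powr (- p)"
proof -
  have uw: "0 < u" "0 < w" using assms by auto
  have "ln (w / u) \<le> w / u - 1" using uw by (intro ln_le_minus_one) auto
  also have "\<dots> = (w - u) / u" using uw by (simp add: field_simps)
  also have "\<dots> \<le> \<bar>u - w\<bar> / m" using assms uw by (intro frac_le) auto
  finally have "p * (ln w - ln u) \<le> p * (\<bar>u - w\<bar> / m)"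
    using assms uw by (intro mult_left_mono) (auto simp: ln_div)
  hence "- p * ln u \<le> p / m * \<bar>u - w\<bar> + - p * ln w" by (simp add: algebra_simps)
  thus ?thesis using uw by (simp add: powr_def flip: exp_add)
qed

text \<open>Positive combinations of the functions \<open>(x + \<tau>)\<^sup>-\<^sup>p\<close>; this family is invariant under the transfer
  operator when \<open>\<tau>\<close> ranges over \<open>[\<gamma> + \<aa>\<^sub>\<infinity>, \<Gamma> + \<bb>\<^sub>\<infinity>]\<close>.\<close>

inductive power_comb :: "real \<Rightarrow> real \<Rightarrow> real \<Rightarrow> (real \<Rightarrow> real) \<Rightarrow> bool" for p lo hi where
  base: "lo \<le> \<tau> \<Longrightarrow> \<tau> \<le> hi \<Longrightarrow> 0 \<le> c \<Longrightarrow> power_comb p lo hi (\<lambda>x. c * (x + \<tau>) powr (- p))"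
| add: "power_comb p lo hi f \<Longrightarrow> power_comb p lo hi g \<Longrightarrow> power_comb p lo hi (\<lambda>x. f x + g x)"

lemma power_comb_scale:
  assumes "power_comb p lo hi f" "0 \<le> k"
  shows "power_comb p lo hi (\<lambda>x. k * f x)"
  using assms(1)
proof induction
  case (base \<tau> c)
  thus ?case using power_comb.base[of lo \<tau> hi "k * c" p] assms(2) by (simp add: mult.assoc)
next
  case (add f g)
  thus ?case using power_comb.add[OF add.IH] by (simp add: distrib_left)
qed

lemma power_comb_sum:
  assumes "finite I" "\<And>i. i \<in> I \<Longrightarrow> power_comb p lo hi (f i)" "lo \<le> hi"
  shows "power_comb p lo hi (\<lambda>x. \<Sum>i\<in>I. f i x)"
  using assms(1,2)
proof (induction I rule: finite_induct)
  case empty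
  show ?case using power_comb.base[of lo lo hi 0 p] assms(3) by simp
next
  case (insert i I)
  thus ?case by (simp add: power_comb.add)
qed

lemma theta_word_append: "theta_word (u @ w) = theta_word u \<circ> theta_word w"
  by (induction u) (auto simp: fun_eq_iff)

lemma theta_has_derivative:
  assumes "0 < x + \<beta>"
  shows "(theta \<beta> has_real_derivative - (1 / (x + \<beta>)\<^sup>2)) (at x)"
  unfolding theta_def[abs_def] using assms
  by (auto intro!: derivative_eq_intros simp: power2_eq_square)

locale ifs =
  fixes B :: "real set" and \<gamma> \<Gamma> s :: real
  assumes fin: "finite B" and ne: "B \<noteq> {}" and gam: "\<gamma> = Min B" and Gam: "\<Gamma> = Max B"
    and gam1: "1 \<le> \<gamma>" and gG: "\<gamma> < \<Gamma>" and s: "0 < s"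
begin

abbreviation "al \<equiv> a_inf \<gamma> \<Gamma>"
abbreviation "be \<equiv> b_inf \<gamma> \<Gamma>"
abbreviation "S \<equiv> S_interval \<gamma> \<Gamma>"

lemma B_bounds: "\<beta> \<in> B \<Longrightarrow> \<gamma> \<le> \<beta>" "\<beta> \<in> B \<Longrightarrow> \<beta> \<le> \<Gamma>"
  using fin by (auto simp: gam Gam)

lemma seq_nonneg: "0 \<le> a_seq \<gamma> \<Gamma> k \<and> 0 \<le> b_seq \<gamma> \<Gamma> k"
  using gam1 gG by (induction k) (auto simp: theta_def)

lemma inf_fixed: "al = 1 / (be + \<Gamma>)" "be = 1 / (al + \<gamma>)"
  and al_pos: "0 < al" and be_pos: "0 < be"
proof -
  note lim = a_seq_tendsto[OF gam1 gG] b_seq_tendsto[OF gam1 gG]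
  have nn: "0 \<le> al" "0 \<le> be"
    using LIMSEQ_le_const[OF lim(1), of 0] LIMSEQ_le_const[OF lim(2), of 0] seq_nonneg by blast+
  have "(\<lambda>k. a_seq \<gamma> \<Gamma> (Suc k)) \<longlonglongrightarrow> 1 / (be + \<Gamma>)"
    using nn gam1 gG unfolding a_seq.simps theta_def by (intro tendsto_intros lim) auto
  thus 1: "al = 1 / (be + \<Gamma>)" using LIMSEQ_Suc[OF lim(1)] LIMSEQ_unique by blast
  have "(\<lambda>k. b_seq \<gamma> \<Gamma> (Suc k)) \<longlonglongrightarrow> 1 / (al + \<gamma>)"
    using nn gam1 gG unfolding b_seq.simps theta_def by (intro tendsto_intros lim) auto
  thus 2: "be = 1 / (al + \<gamma>)" using LIMSEQ_Suc[OF lim(2)] LIMSEQ_unique by blast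
  have "0 < 1 / (be + \<Gamma>)" "0 < 1 / (al + \<gamma>)" using nn gam1 gG by auto
  thus "0 < al" "0 < be" using 1 2 by linarith+
qed

lemma seq_bounds: "a_seq \<gamma> \<Gamma> k \<le> al \<and> be \<le> b_seq \<gamma> \<Gamma> k"
proof (induction k)
  case 0
  have "1 / (al + \<gamma>) \<le> 1 / \<gamma>" using al_pos gam1 by (intro divide_left_mono) auto
  thus ?case using al_pos inf_fixed(2) by simp
next
  case (Suc k)
  have "a_seq \<gamma> \<Gamma> (Suc k) \<le> 1 / (be + \<Gamma>)"
    unfolding a_seq.simps theta_def using Suc be_pos gam1 gG by (intro divide_left_mono mult_pos_pos) auto
  moreover have "1 / (al + \<gamma>) \<le> b_seq \<gamma> \<Gamma> (Suc k)"
    unfolding b_seq.simps theta_def using Suc al_pos gam1 seq_nonneg[of k]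
    by (intro divide_left_mono mult_pos_pos) auto
  ultimately show ?case using inf_fixed by linarith
qed

lemma al_less_be: "al < be"
proof -
  have nz: "be + \<Gamma> \<noteq> 0" "al + \<gamma> \<noteq> 0" using al_pos be_pos gam1 gG by auto
  have "al * (be + \<Gamma>) = 1" "be * (al + \<gamma>) = 1"
    by (subst inf_fixed(1), simp add: nz) (subst inf_fixed(2), simp add: nz)
  hence "al * \<Gamma> = be * \<gamma>" by (simp add: algebra_simps)
  moreover have "al * \<gamma> < al * \<Gamma>" using al_pos gG by simp
  ultimately show ?thesis using gam1 by simp
qed

lemma S_pos: "x \<in> S \<Longrightarrow> 0 < x" "x \<in> S \<Longrightarrow> al \<le> x" "x \<in> S \<Longrightarrow> x \<le> be"
  using al_pos by (auto simp: S_interval_def)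

lemma S_compact: "compact S" "S \<noteq> {}" "al \<in> S"
  using al_less_be by (auto simp: S_interval_def)

lemma theta_in_S: "\<beta> \<in> B \<Longrightarrow> x \<in> S \<Longrightarrow> theta \<beta> x \<in> S"
proof -
  assume \<beta>: "\<beta> \<in> B" and x: "x \<in> S"
  note b = B_bounds[OF \<beta>] S_pos[OF x]
  have "1 / (be + \<Gamma>) \<le> 1 / (x + \<beta>)" "1 / (x + \<beta>) \<le> 1 / (al + \<gamma>)"
    using b gam1 al_pos by (intro divide_left_mono mult_pos_pos; simp)+
  thus ?thesis unfolding S_interval_def theta_def atLeastAtMost_iff using inf_fixed by linarith
qed

lemma finite_words: "finite (words B \<nu>)"
  unfolding words_def using finite_lists_length_eq[OF fin, of \<nu>] by simp

lemma B_tilde_pos: "0 < B_tilde \<gamma> n"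
proof -
  have "0 < B_tilde \<gamma> n \<and> 0 < B_tilde \<gamma> (Suc n)"
    by (induction n) (use gam1 in \<open>auto intro: add_pos_pos\<close>)
  thus ?thesis by blast
qed

text \<open>A word acts as a Moebius map of determinant plus or minus 1 with denominator P x + Q.
  Appending a letter \<beta> turns (P, Q) into (Q, \<beta> Q + P), the recursion of continued
  fraction denominators; hence the bounds by \<open>B_tilde\<close>. Both bounds on Q/P are carried
  along because inversion turns each into the other.\<close>

lemma word_form:
  assumes "set \<omega> \<subseteq> B" "\<omega> \<noteq> []"
  shows "\<exists>P Q. 0 < P \<and> B_tilde \<gamma> (length \<omega> - 1) \<le> P \<and> B_tilde \<gamma> (length \<omega>) \<le> Q \<and>
    (\<gamma> + a_seq \<gamma> \<Gamma> (length \<omega> - 1)) * P \<le> Q \<and> Q \<le> (\<Gamma> + b_seq \<gamma> \<Gamma> (length \<omega> - 1)) * P \<and>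
    (\<forall>x\<ge>0. (\<exists>\<sigma>. \<bar>\<sigma>\<bar> = 1 \<and> (theta_word \<omega> has_real_derivative \<sigma> / (P * x + Q)\<^sup>2) (at x)) \<and>
      (\<forall>y\<ge>0. \<bar>theta_word \<omega> x - theta_word \<omega> y\<bar> = \<bar>x - y\<bar> / ((P * x + Q) * (P * y + Q))))"
  using assms
proof (induction \<omega> rule: rev_induct)
  case (snoc \<beta> \<omega>)
  have \<beta>: "\<beta> \<in> B" "\<gamma> \<le> \<beta>" "\<beta> \<le> \<Gamma>" "1 \<le> \<beta>" using snoc.prems B_bounds gam1 by force+
  have dtheta: "\<bar>theta \<beta> x - theta \<beta> y\<bar> = \<bar>x - y\<bar> / ((x + \<beta>) * (y + \<beta>))" if "0 \<le> x" "0 \<le> y" for x y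
  proof -
    have "theta \<beta> x - theta \<beta> y = (y - x) / ((x + \<beta>) * (y + \<beta>))"
      using that \<beta> by (simp add: theta_def field_simps)
    thus ?thesis using that \<beta> by (simp add: abs_mult abs_minus_commute)
  qed
  have tpos: "0 \<le> theta \<beta> x" if "0 \<le> x" for x using that \<beta> by (simp add: theta_def)
  show ?case
  proof (cases "\<omega> = []")
    case True
    have "\<exists>\<sigma>. \<bar>\<sigma>\<bar> = 1 \<and> (theta \<beta> has_real_derivative \<sigma> / (1 * x + \<beta>)\<^sup>2) (at x)" if "0 \<le> x" for x
      using theta_has_derivative[of x \<beta>] that \<beta> by (intro exI[of _ "- 1"]) simp
    thus ?thesis using \<beta> dtheta gam1 True
      by (intro exI[of _ 1] exI[of _ \<beta>]) (auto simp: add_increasing2)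
  next
    case False
    obtain P Q where PQ: "0 < P" "B_tilde \<gamma> (length \<omega> - 1) \<le> P" "B_tilde \<gamma> (length \<omega>) \<le> Q"
      "(\<gamma> + a_seq \<gamma> \<Gamma> (length \<omega> - 1)) * P \<le> Q" "Q \<le> (\<Gamma> + b_seq \<gamma> \<Gamma> (length \<omega> - 1)) * P"
      "\<And>x. 0 \<le> x \<Longrightarrow> \<exists>\<sigma>. \<bar>\<sigma>\<bar> = 1 \<and> (theta_word \<omega> has_real_derivative \<sigma> / (P * x + Q)\<^sup>2) (at x)"
      "\<And>x y. 0 \<le> x \<Longrightarrow> 0 \<le> y \<Longrightarrow>
        \<bar>theta_word \<omega> x - theta_word \<omega> y\<bar> = \<bar>x - y\<bar> / ((P * x + Q) * (P * y + Q))"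
      using snoc.IH snoc.prems(1) False by (force simp: )
    obtain n where n: "length \<omega> = Suc n" using False by (cases \<omega>) auto
    have Q: "0 < Q" using PQ(3) B_tilde_pos[of "length \<omega>"] by linarith
    \<comment> \<open>The denominator obtained by substituting 1/(x + \<beta>) for x and clearing
      fractions.\<close>
    define Q' where "Q' = \<beta> * Q + P"
    have Q': "0 < Q'" using Q PQ(1) \<beta> by (simp add: Q'_def add_pos_pos)
    have key: "(P * theta \<beta> x + Q) * (x + \<beta>) = Q * x + Q'" if "0 \<le> x" for x
      using that \<beta> by (simp add: theta_def Q'_def field_simps)
    have "B_tilde \<gamma> (Suc (length \<omega>)) \<le> Q'"
    proof -
      have "\<gamma> * B_tilde \<gamma> (Suc n) \<le> \<beta> * Q"
        using PQ(3) \<beta> gam1 Q B_tilde_pos[of "Suc n"] n by (intro mult_mono) auto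
      thus ?thesis using PQ(2) n by (simp add: Q'_def)
    qed
    moreover have "(\<gamma> + a_seq \<gamma> \<Gamma> (length \<omega>)) * Q \<le> Q'"
    proof -
      have pos: "0 < b_seq \<gamma> \<Gamma> n + \<Gamma>" using seq_nonneg[of n] gam1 gG by (simp add: add_nonneg_pos)
      have "a_seq \<gamma> \<Gamma> (Suc n) * Q \<le> P"
        using PQ(5) pos n by (simp add: theta_def divide_le_eq algebra_simps)
      moreover have "\<gamma> * Q \<le> \<beta> * Q" using \<beta> Q by simp
      ultimately show ?thesis using n unfolding Q'_def distrib_right by simp
    qed
    moreover have "Q' \<le> (\<Gamma> + b_seq \<gamma> \<Gamma> (length \<omega>)) * Q"
    proof -
      have pos: "0 < a_seq \<gamma> \<Gamma> n + \<gamma>" using seq_nonneg[of n] gam1 by (simp add: add_nonneg_pos)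
      have "P \<le> b_seq \<gamma> \<Gamma> (Suc n) * Q"
        using PQ(4) pos n by (simp add: theta_def le_divide_eq algebra_simps)
      moreover have "\<beta> * Q \<le> \<Gamma> * Q" using \<beta> Q by simp
      ultimately show ?thesis using n unfolding Q'_def distrib_right by simp
    qed
    moreover have "\<exists>\<sigma>. \<bar>\<sigma>\<bar> = 1 \<and> (theta_word (\<omega> @ [\<beta>]) has_real_derivative \<sigma> / (Q * x + Q')\<^sup>2) (at x)"
      if x: "0 \<le> x" for x
    proof -
      obtain \<sigma> where \<sigma>: "\<bar>\<sigma>\<bar> = 1"
        "(theta_word \<omega> has_real_derivative \<sigma> / (P * theta \<beta> x + Q)\<^sup>2) (at (theta \<beta> x))"
        using PQ(6)[OF tpos[OF x]] by blast
      have "(theta_word \<omega> \<circ> theta \<beta> has_real_derivative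
          \<sigma> / (P * theta \<beta> x + Q)\<^sup>2 * (- (1 / (x + \<beta>)\<^sup>2))) (at x)"
        using DERIV_chain[OF \<sigma>(2) theta_has_derivative[of x \<beta>]] x \<beta> by simp
      moreover have "\<sigma> / (P * theta \<beta> x + Q)\<^sup>2 * (- (1 / (x + \<beta>)\<^sup>2)) = - \<sigma> / (Q * x + Q')\<^sup>2"
        unfolding key[OF x, symmetric] power_mult_distrib by simp
      ultimately have "(theta_word \<omega> \<circ> theta \<beta> has_real_derivative - \<sigma> / (Q * x + Q')\<^sup>2) (at x)"
        by (simp only:)
      moreover have "theta_word (\<omega> @ [\<beta>]) = theta_word \<omega> \<circ> theta \<beta>" by (simp add: theta_word_append)
      ultimately show ?thesis using \<sigma>(1) by (intro exI[of _ "- \<sigma>"]) (simp only: abs_minus_cancel)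
    qed
    moreover have "\<bar>theta_word (\<omega> @ [\<beta>]) x - theta_word (\<omega> @ [\<beta>]) y\<bar> = \<bar>x - y\<bar> / ((Q * x + Q') * (Q * y + Q'))"
      if "0 \<le> x" "0 \<le> y" for x y
      using PQ(7)[OF tpos[OF that(1)] tpos[OF that(2)]] dtheta[OF that]
      unfolding key[OF that(1), symmetric] key[OF that(2), symmetric]
      by (simp add: theta_word_append mult_ac)
    ultimately show ?thesis using PQ Q by (intro exI[of _ Q] exI[of _ Q']) simp
  qed
qed simp

lemma g_word_pos: "set \<omega> \<subseteq> B \<Longrightarrow> \<omega> \<noteq> [] \<Longrightarrow> 0 \<le> x \<Longrightarrow> 0 < g_word \<omega> x"
proof -
  assume a: "set \<omega> \<subseteq> B" "\<omega> \<noteq> []" "0 \<le> x"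
  obtain P Q \<sigma> where PQ: "0 < P" "B_tilde \<gamma> (length \<omega>) \<le> Q" "\<bar>\<sigma>\<bar> = 1"
    "(theta_word \<omega> has_real_derivative \<sigma> / (P * x + Q)\<^sup>2) (at x)"
    using word_form[OF a(1,2)] a(3) by blast
  have "0 < P * x + Q" using PQ B_tilde_pos[of "length \<omega>"] a(3) by (simp add: add_nonneg_pos)
  thus ?thesis unfolding g_word_def DERIV_imp_deriv[OF PQ(4)] using PQ(3) by (auto simp: abs_divide)
qed

lemma theta_word_contraction:
  assumes "set \<omega> \<subseteq> B" "\<omega> \<noteq> []" "x \<in> S" "y \<in> S"
  shows "\<bar>theta_word \<omega> x - theta_word \<omega> y\<bar> \<le> c_const \<gamma> \<Gamma> (length \<omega>) * \<bar>x - y\<bar>"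
proof -
  obtain P Q where PQ: "0 < P" "B_tilde \<gamma> (length \<omega> - 1) \<le> P" "B_tilde \<gamma> (length \<omega>) \<le> Q"
    "\<And>x y. 0 \<le> x \<Longrightarrow> 0 \<le> y \<Longrightarrow>
      \<bar>theta_word \<omega> x - theta_word \<omega> y\<bar> = \<bar>x - y\<bar> / ((P * x + Q) * (P * y + Q))"
    using word_form[OF assms(1,2)] by blast
  define D where "D = B_tilde \<gamma> (length \<omega> - 1) * al + B_tilde \<gamma> (length \<omega>)"
  have D: "0 < D" using B_tilde_pos al_pos by (simp add: D_def add_pos_pos)
  have le: "D \<le> P * z + Q" if "z \<in> S" for z
    unfolding D_def using PQ S_pos[OF that] B_tilde_pos[of "length \<omega> - 1"] al_pos
    by (intro add_mono mult_mono) auto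
  have "\<bar>theta_word \<omega> x - theta_word \<omega> y\<bar> = \<bar>x - y\<bar> / ((P * x + Q) * (P * y + Q))"
    using S_pos(1)[OF assms(3)] S_pos(1)[OF assms(4)] by (intro PQ(4)) auto
  also have "\<dots> \<le> \<bar>x - y\<bar> / (D * D)"
    using D le[OF assms(3)] le[OF assms(4)] by (intro divide_left_mono mult_mono) auto
  finally show ?thesis by (simp add: c_const_def D_def power2_eq_square)
qed

text \<open>Up to a constant factor the weight is (x + Q/P)^(-2s), and Q/P \<ge> \<gamma> +
  \<open>a_seq\<close> at index \<nu> - 1. The resulting logarithmic derivative is what
  \<open>M0_const\<close> records.\<close>

lemma g_word_distortion:
  assumes "set \<omega> \<subseteq> B" "\<omega> \<noteq> []" "x \<in> S" "y \<in> S"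
  shows "g_word \<omega> x powr s \<le> exp (s * M0_const \<gamma> \<Gamma> (length \<omega>) * \<bar>x - y\<bar>) * g_word \<omega> y powr s"
proof -
  obtain P Q where PQ: "0 < P" "B_tilde \<gamma> (length \<omega>) \<le> Q" "(\<gamma> + a_seq \<gamma> \<Gamma> (length \<omega> - 1)) * P \<le> Q"
    "\<And>x. 0 \<le> x \<Longrightarrow> \<exists>\<sigma>. \<bar>\<sigma>\<bar> = 1 \<and> (theta_word \<omega> has_real_derivative \<sigma> / (P * x + Q)\<^sup>2) (at x)"
    using word_form[OF assms(1,2)] by blast
  define m \<tau> where "m = al + a_seq \<gamma> \<Gamma> (length \<omega> - 1) + \<gamma>" and "\<tau> = Q / P"
  have m: "0 < m" using al_pos seq_nonneg[of "length \<omega> - 1"] gam1 by (simp add: m_def add_pos_nonneg)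
  have \<tau>: "\<gamma> + a_seq \<gamma> \<Gamma> (length \<omega> - 1) \<le> \<tau>" using PQ(1,3) by (simp add: \<tau>_def le_divide_eq)
  have mz: "m \<le> z + \<tau>" if "z \<in> S" for z using S_pos(2)[OF that] \<tau> by (simp add: m_def)
  have g: "g_word \<omega> z powr s = P powr (- 2 * s) * (z + \<tau>) powr (- (2 * s))" if z: "z \<in> S" for z
  proof -
    obtain \<sigma> where \<sigma>: "\<bar>\<sigma>\<bar> = 1" "(theta_word \<omega> has_real_derivative \<sigma> / (P * z + Q)\<^sup>2) (at z)"
      using PQ(4)[of z] S_pos(1)[OF z] by auto
    have zt: "0 < z + \<tau>" using mz[OF z] m by linarith
    have "P * z + Q = P * (z + \<tau>)" using PQ(1) by (simp add: \<tau>_def algebra_simps)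
    hence "g_word \<omega> z = (P * (z + \<tau>)) powr (- 2)"
      unfolding g_word_def DERIV_imp_deriv[OF \<sigma>(2)] using \<sigma>(1) PQ(1) zt
      by (simp add: abs_divide powr_minus_divide powr_numeral)
    thus ?thesis using PQ(1) zt by (simp add: powr_powr powr_mult)
  qed
  have "(x + \<tau>) powr (- (2 * s)) \<le> exp (2 * s / m * \<bar>(x + \<tau>) - (y + \<tau>)\<bar>) * (y + \<tau>) powr (- (2 * s))"
    using m mz[OF assms(3)] mz[OF assms(4)] s by (intro powr_neg_log_lip) auto
  hence "P powr (- 2 * s) * (x + \<tau>) powr (- (2 * s))
      \<le> P powr (- 2 * s) * (exp (2 * s / m * \<bar>x - y\<bar>) * (y + \<tau>) powr (- (2 * s)))"
    by (intro mult_left_mono) auto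
  thus ?thesis unfolding g[OF assms(3)] g[OF assms(4)]
    by (simp add: M0_const_def m_def mult_ac)
qed

section \<open>The transfer operator and its eigenfunction\<close>

lemma L_op_eq:
  assumes x: "x \<in> S"
  shows "L_op B s S f x = (\<Sum>\<beta>\<in>B. (x + \<beta>) powr (- (2 * s)) * f (theta \<beta> x))"
proof -
  have "\<bar>deriv (theta \<beta>) x\<bar> powr s = (x + \<beta>) powr (- (2 * s))" if "\<beta> \<in> B" for \<beta>
  proof -
    have p: "0 < x + \<beta>" using S_pos(1)[OF x] B_bounds(1)[OF that] gam1 by linarith
    have "\<bar>deriv (theta \<beta>) x\<bar> = (x + \<beta>) powr (- 2)"
      unfolding DERIV_imp_deriv[OF theta_has_derivative[OF p]] using p
      by (simp add: powr_minus_divide powr_numeral)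
    thus ?thesis by (simp add: powr_powr)
  qed
  thus ?thesis using x by (simp add: L_op_def)
qed

text \<open>Words are split at their last letter, whose map acts first. By the chain rule the
  weights multiply, the inner sum is the induction hypothesis at the image point, and the outer sum
  is one more application of the operator.\<close>

lemma L_op_iterate:
  assumes v: "\<And>x. x \<in> S \<Longrightarrow> L_op B s S v x = lam * v x" and x: "x \<in> S"
  shows "lam ^ \<nu> * v x = (\<Sum>\<omega>\<in>words B \<nu>. g_word \<omega> x powr s * v (theta_word \<omega> x))"
  using x
proof (induction \<nu> arbitrary: x)
  case 0
  have "words B 0 = {[]}" by (auto simp: words_def)
  moreover have "g_word [] x = 1" by (simp add: g_word_def id_def)
  ultimately show ?case by simp
next
  case (Suc \<nu>)
  have words_Suc: "words B (Suc \<nu>) = (\<lambda>(\<beta>, \<omega>). \<omega> @ [\<beta>]) ` (B \<times> words B \<nu>)"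
  proof (intro equalityI subsetI)
    fix u assume "u \<in> words B (Suc \<nu>)"
    hence u: "set u \<subseteq> B" "length u = Suc \<nu>" by (auto simp: words_def)
    hence "u \<noteq> []" by auto
    then obtain w b where "u = w @ [b]" by (metis append_butlast_last_id)
    thus "u \<in> (\<lambda>(\<beta>, \<omega>). \<omega> @ [\<beta>]) ` (B \<times> words B \<nu>)" using u by (force simp: words_def)
  qed (auto simp: words_def)
  have inj: "inj_on (\<lambda>(\<beta>, \<omega>). \<omega> @ [\<beta>]) (B \<times> words B \<nu>)" by (auto simp: inj_on_def)
  have g: "g_word (\<omega> @ [\<beta>]) x powr s = (x + \<beta>) powr (- (2 * s)) * g_word \<omega> (theta \<beta> x) powr s"
    if "\<beta> \<in> B" "\<omega> \<in> words B \<nu>" for \<beta> \<omega>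
  proof -
    have w: "set \<omega> \<subseteq> B" using that by (simp add: words_def)
    have p: "0 < x + \<beta>" using S_pos(1)[OF Suc.prems] B_bounds(1)[OF that(1)] gam1 by linarith
    have t0: "0 \<le> theta \<beta> x" using S_pos(1)[OF theta_in_S[OF that(1) Suc.prems]] by simp
    have "\<exists>D. (theta_word \<omega> has_real_derivative D) (at (theta \<beta> x))"
    proof (cases "\<omega> = []")
      case True
      thus ?thesis by (auto simp: id_def intro!: exI[of _ 1] derivative_eq_intros)
    next
      case False
      thus ?thesis using word_form[OF w False] t0 by blast
    qed
    then obtain D where D: "(theta_word \<omega> has_real_derivative D) (at (theta \<beta> x))" by blast
    have e: "theta_word (\<omega> @ [\<beta>]) = theta_word \<omega> \<circ> theta \<beta>" by (simp add: theta_word_append)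
    have "deriv (theta_word (\<omega> @ [\<beta>])) x = D * (- (1 / (x + \<beta>)\<^sup>2))"
      unfolding e using DERIV_chain[OF D theta_has_derivative[OF p]] by (rule DERIV_imp_deriv)
    hence "g_word (\<omega> @ [\<beta>]) x = g_word \<omega> (theta \<beta> x) * (x + \<beta>) powr (- 2)"
      unfolding g_word_def DERIV_imp_deriv[OF D] using p
      by (simp add: abs_mult powr_minus_divide powr_numeral)
    thus ?thesis using p by (simp add: g_word_def powr_mult powr_powr)
  qed
  have "(\<Sum>\<omega>\<in>words B (Suc \<nu>). g_word \<omega> x powr s * v (theta_word \<omega> x))
      = (\<Sum>(\<beta>, \<omega>)\<in>B \<times> words B \<nu>. g_word (\<omega> @ [\<beta>]) x powr s * v (theta_word (\<omega> @ [\<beta>]) x))"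
    unfolding words_Suc by (subst sum.reindex[OF inj]) (simp add: case_prod_unfold)
  also have "\<dots> = (\<Sum>\<beta>\<in>B. \<Sum>\<omega>\<in>words B \<nu>. g_word (\<omega> @ [\<beta>]) x powr s * v (theta_word (\<omega> @ [\<beta>]) x))"
    by (rule sum.cartesian_product[symmetric])
  also have "\<dots> = (\<Sum>\<beta>\<in>B. (x + \<beta>) powr (- (2 * s)) *
      (\<Sum>\<omega>\<in>words B \<nu>. g_word \<omega> (theta \<beta> x) powr s * v (theta_word \<omega> (theta \<beta> x))))"
    unfolding sum_distrib_left by (intro sum.cong refl) (simp add: g theta_word_append mult.assoc)
  also have "\<dots> = (\<Sum>\<beta>\<in>B. (x + \<beta>) powr (- (2 * s)) * (lam ^ \<nu> * v (theta \<beta> x)))"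
    by (intro sum.cong refl) (simp add: Suc.IH theta_in_S Suc.prems)
  also have "\<dots> = lam ^ \<nu> * L_op B s S v x"
    unfolding L_op_eq[OF Suc.prems] sum_distrib_left by (intro sum.cong refl) simp
  finally show ?case using v[OF Suc.prems] by simp
qed

lemma continuous_on_theta: "\<beta> \<in> B \<Longrightarrow> continuous_on S (theta \<beta>)"
  unfolding theta_def[abs_def] using B_bounds(1)[of \<beta>] gam1
  by (intro continuous_intros ballI) (auto dest: S_pos(1))

lemma L_op_field_operator: "field_operator S (L_op B s S) (real (card B))"
proof
  show "compact S" "S \<noteq> {}" by (rule S_compact)+
  show "L_op B s S f = L_op B s S g" if "\<And>x. x \<in> S \<Longrightarrow> f x = g x" for f g
    using that theta_in_S unfolding L_op_def by (intro restrict_ext sum.cong) auto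
  show "continuous_on S (L_op B s S f)" if f: "continuous_on S f" for f
  proof -
    have "continuous_on S (\<lambda>x. \<Sum>\<beta>\<in>B. (x + \<beta>) powr (- (2 * s)) * f (theta \<beta> x))"
    proof (intro continuous_on_sum continuous_on_mult)
      fix \<beta> assume \<beta>: "\<beta> \<in> B"
      show "continuous_on S (\<lambda>x. (x + \<beta>) powr (- (2 * s)))"
        using B_bounds(1)[OF \<beta>] gam1 by (intro continuous_intros ballI) (auto dest: S_pos(1))
      show "continuous_on S (\<lambda>x. f (theta \<beta> x))"
        by (rule continuous_on_compose2[OF f continuous_on_theta[OF \<beta>]]) (use theta_in_S \<beta> in auto)
    qed
    thus ?thesis by (rule continuous_on_eq) (simp add: L_op_eq)
  qed
  show "L_op B s S (\<lambda>y. c * f y + d * g y) x = c * L_op B s S f x + d * L_op B s S g x"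
    if "x \<in> S" for f g c d x
    using that by (simp add: L_op_eq sum.distrib sum_distrib_left algebra_simps)
  show "norm (L_op B s S f x) \<le> real (card B) * K"
    if K: "\<And>y. y \<in> S \<Longrightarrow> norm (f y) \<le> K" and x: "x \<in> S" for f K x
  proof -
    have "norm (L_op B s S f x) \<le> (\<Sum>\<beta>\<in>B. K)"
      unfolding L_op_eq[OF x]
    proof (rule sum_norm_le)
      fix \<beta> assume \<beta>: "\<beta> \<in> B"
      have "1 \<le> x + \<beta>" using S_pos(1)[OF x] B_bounds(1)[OF \<beta>] gam1 by linarith
      hence "(x + \<beta>) powr (- (2 * s)) \<le> 1"
        using powr_mono[of "- (2 * s)" 0 "x + \<beta>"] s by simp
      hence "(x + \<beta>) powr (- (2 * s)) * norm (f (theta \<beta> x)) \<le> 1 * K"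
        using K[OF theta_in_S[OF \<beta> x]] by (intro mult_mono) auto
      thus "norm ((x + \<beta>) powr (- (2 * s)) * f (theta \<beta> x)) \<le> K" by (simp add: abs_mult)
    qed
    thus ?thesis by simp
  qed
qed

lemma L_op_power_comb:
  assumes "power_comb (2 * s) (\<gamma> + al) (\<Gamma> + be) f"
  shows "\<exists>g. power_comb (2 * s) (\<gamma> + al) (\<Gamma> + be) g \<and> (\<forall>x\<in>S. L_op B s S f x = g x)"
  using assms
proof induction
  case (base \<tau> c)
  have \<tau>: "0 < \<tau>" using base al_pos gam1 by linarith
  define g where "g x = (\<Sum>\<beta>\<in>B. c * \<tau> powr (- (2 * s)) * (x + (\<beta> + 1 / \<tau>)) powr (- (2 * s)))" for x
  have "power_comb (2 * s) (\<gamma> + al) (\<Gamma> + be) g"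
    unfolding g_def
  proof (rule power_comb_sum[OF fin])
    have "1 / (be + \<Gamma>) \<le> 1 / \<tau>" "1 / \<tau> \<le> 1 / (al + \<gamma>)"
      using base \<tau> al_pos gam1 by (intro divide_left_mono; simp)+
    hence b: "al \<le> 1 / \<tau>" "1 / \<tau> \<le> be" using inf_fixed by linarith+
    show "power_comb (2 * s) (\<gamma> + al) (\<Gamma> + be)
        (\<lambda>x. c * \<tau> powr (- (2 * s)) * (x + (\<beta> + 1 / \<tau>)) powr (- (2 * s)))" if "\<beta> \<in> B" for \<beta>
      using b B_bounds[OF that] base(3) by (intro power_comb.base) auto
    show "\<gamma> + al \<le> \<Gamma> + be" using gG al_less_be by simp
  qed
  moreover have "L_op B s S (\<lambda>x. c * (x + \<tau>) powr (- (2 * s))) x = g x" if x: "x \<in> S" for x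
    unfolding L_op_eq[OF x] g_def
  proof (rule sum.cong[OF refl])
    fix \<beta> assume "\<beta> \<in> B"
    hence p: "0 < x + \<beta>" using S_pos(1)[OF x] B_bounds(1)[of \<beta>] gam1 by linarith
    have q: "0 < theta \<beta> x + \<tau>" using p \<tau> by (simp add: theta_def add_pos_pos)
    \<comment> \<open>This identity sends the parameter \<tau> to \<beta> + 1/\<tau>. The fixed
      point equations of the interval ends keep the new parameter in range.\<close>
    have "(x + \<beta>) * (theta \<beta> x + \<tau>) = \<tau> * (x + (\<beta> + 1 / \<tau>))"
      using p \<tau> by (simp add: theta_def field_simps)
    hence "(x + \<beta>) powr (- (2 * s)) * (theta \<beta> x + \<tau>) powr (- (2 * s))
        = \<tau> powr (- (2 * s)) * (x + (\<beta> + 1 / \<tau>)) powr (- (2 * s))"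
      using p q \<tau> by (metis powr_mult less_imp_le mult_pos_pos zero_less_mult_pos)
    thus "(x + \<beta>) powr (- (2 * s)) * (c * (theta \<beta> x + \<tau>) powr (- (2 * s)))
        = c * \<tau> powr (- (2 * s)) * (x + (\<beta> + 1 / \<tau>)) powr (- (2 * s))" by simp
  qed
  ultimately show ?case by blast
next
  case (add f1 f2)
  then obtain g1 g2 where g: "power_comb (2 * s) (\<gamma> + al) (\<Gamma> + be) g1" "power_comb (2 * s) (\<gamma> + al) (\<Gamma> + be) g2"
    "\<forall>x\<in>S. L_op B s S f1 x = g1 x" "\<forall>x\<in>S. L_op B s S f2 x = g2 x" by blast
  have "L_op B s S (\<lambda>x. f1 x + f2 x) x = g1 x + g2 x" if "x \<in> S" for x
  proof -
    have "L_op B s S (\<lambda>x. f1 x + f2 x) x = L_op B s S f1 x + L_op B s S f2 x"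
      unfolding L_op_eq[OF that] by (simp add: sum.distrib distrib_left)
    thus ?thesis using g(3,4) that by simp
  qed
  thus ?case using power_comb.add[OF g(1,2)] by blast
qed

text \<open>The approximants \<open>G n\<close> are exported because they carry explicit
  information: the interpolation error and the log-Lipschitz constant 2s/\<chi>, which is smaller
  than the constant of the cone used here.\<close>

theorem exists_eigenfunction:
  "\<exists>v lam G. 0 < lam \<and> spec_radius S (L_op B s S) = lam \<and>
    (\<forall>x\<in>S. 0 < v x \<and> L_op B s S v x = lam * v x \<and> (\<lambda>n. G n x) \<longlonglongrightarrow> v x) \<and>
    (\<forall>n. power_comb (2 * s) (\<gamma> + al) (\<Gamma> + be) (G n))"
proof -
  define k where "k = al + \<gamma>"
  have k: "1 < k" using al_pos gam1 by (simp add: k_def)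
  have kk: "1 < k * k" using k less_1_mult by blast
  \<comment> \<open>Distortion and contraction send a log-Lipschitz constant M to 2s/k + M/k^2. The
    choice exceeds the fixed point of this map by 1, so the image constant is strictly
    smaller.\<close>
  define M where "M = 2 * s / k / (1 - 1 / (k * k)) + 1"
  define M' where "M' = 2 * s / k + M / (k * k)"
  have d0: "0 < 1 - 1 / (k * k)" using kk by simp
  have M0: "0 < M" using s k d0 by (simp add: M_def add_nonneg_pos)
  have M': "0 \<le> M'" using s k M0 by (simp add: M'_def)
  have "(t / e + 1) * e = t + e" if "e \<noteq> 0" for t e :: real using that by (simp add: field_simps)
  hence "M * (1 - 1 / (k * k)) = 2 * s / k + (1 - 1 / (k * k))"
    unfolding M_def using d0 by (metis less_irrefl)
  hence "2 * s / k < M * (1 - 1 / (k * k))" using d0 by linarith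
  hence MM: "M' < M" by (simp add: M'_def algebra_simps)
  interpret L: field_operator S "L_op B s S" "real (card B)" by (rule L_op_field_operator)
  have kx: "k \<le> x + \<beta>" if "x \<in> S" "\<beta> \<in> B" for x \<beta>
    using S_pos(2)[OF that(1)] B_bounds(1)[OF that(2)] by (simp add: k_def)
  interpret L: cone_operator S "L_op B s S" "real (card B)" M M'
  proof
    show "0 \<le> M'" "M' < M" by (rule M' MM)+
    fix f assume f: "f \<in> log_lip_cone S M"
    show "L_op B s S f \<in> log_lip_cone S M'"
    proof (rule log_lip_coneI)
      show "continuous_on S (L_op B s S f)" by (rule L.T_cont[OF log_lip_coneD(1)[OF f]])
      show "0 \<le> L_op B s S f x" if "x \<in> S" for x
        unfolding L_op_eq[OF that] using log_lip_coneD(2)[OF f] theta_in_S[OF _ that]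
        by (intro sum_nonneg mult_nonneg_nonneg) auto
      fix x y assume xy: "x \<in> S" "y \<in> S"
      show "L_op B s S f x \<le> exp (M' * \<bar>x - y\<bar>) * L_op B s S f y"
        unfolding L_op_eq[OF xy(1)] L_op_eq[OF xy(2)] sum_distrib_left
      proof (rule sum_mono)
        fix \<beta> assume \<beta>: "\<beta> \<in> B"
        note kxy = kx[OF xy(1) \<beta>] kx[OF xy(2) \<beta>]
        have p: "0 < x + \<beta>" "0 < y + \<beta>" using kxy k by linarith+
        have w: "(x + \<beta>) powr (- (2 * s)) \<le> exp (2 * s / k * \<bar>x - y\<bar>) * (y + \<beta>) powr (- (2 * s))"
          using powr_neg_log_lip[OF _ kxy, of "2 * s"] k s by simp
        have "theta \<beta> x - theta \<beta> y = (y - x) / ((x + \<beta>) * (y + \<beta>))"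
          using p by (simp add: theta_def field_simps)
        hence "\<bar>theta \<beta> x - theta \<beta> y\<bar> = \<bar>x - y\<bar> / ((x + \<beta>) * (y + \<beta>))"
          using p by (simp add: abs_mult abs_minus_commute)
        also have "\<dots> \<le> \<bar>x - y\<bar> / (k * k)"
          using kxy k by (intro divide_left_mono mult_mono) auto
        finally have "M * \<bar>theta \<beta> x - theta \<beta> y\<bar> \<le> M * (\<bar>x - y\<bar> / (k * k))"
          using M0 by (intro mult_left_mono) auto
        hence e: "exp (M * \<bar>theta \<beta> x - theta \<beta> y\<bar>) \<le> exp (M / (k * k) * \<bar>x - y\<bar>)" by simp
        have t: "theta \<beta> x \<in> S" "theta \<beta> y \<in> S" using theta_in_S \<beta> xy by auto
        have "f (theta \<beta> x) \<le> exp (M * \<bar>theta \<beta> x - theta \<beta> y\<bar>) * f (theta \<beta> y)"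
          by (rule log_lip_coneD(3)[OF f t])
        also have "\<dots> \<le> exp (M / (k * k) * \<bar>x - y\<bar>) * f (theta \<beta> y)"
          using e log_lip_coneD(2)[OF f t(2)] by (rule mult_right_mono)
        finally have ft: "f (theta \<beta> x) \<le> exp (M / (k * k) * \<bar>x - y\<bar>) * f (theta \<beta> y)" .
        have "(x + \<beta>) powr (- (2 * s)) * f (theta \<beta> x) \<le>
          (exp (2 * s / k * \<bar>x - y\<bar>) * (y + \<beta>) powr (- (2 * s))) * (exp (M / (k * k) * \<bar>x - y\<bar>) * f (theta \<beta> y))"
          using w ft log_lip_coneD(2)[OF f t(1)] by (intro mult_mono) auto
        also have "\<dots> = (exp (2 * s / k * \<bar>x - y\<bar>) * exp (M / (k * k) * \<bar>x - y\<bar>))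
            * ((y + \<beta>) powr (- (2 * s)) * f (theta \<beta> y))" by (simp only: mult_ac)
        also have "exp (2 * s / k * \<bar>x - y\<bar>) * exp (M / (k * k) * \<bar>x - y\<bar>) = exp (M' * \<bar>x - y\<bar>)"
          by (simp add: M'_def distrib_right flip: exp_add)
        finally show "(x + \<beta>) powr (- (2 * s)) * f (theta \<beta> x)
          \<le> exp (M' * \<bar>x - y\<bar>) * ((y + \<beta>) powr (- (2 * s)) * f (theta \<beta> y))" .
      qed
    qed
    fix x assume fp: "\<And>y. y \<in> S \<Longrightarrow> 0 < f y" and x: "x \<in> S"
    show "0 < L_op B s S f x"
      unfolding L_op_eq[OF x]
    proof (intro sum_pos fin ne mult_pos_pos fp)
      fix \<beta> assume \<beta>: "\<beta> \<in> B"
      show "theta \<beta> x \<in> S" using theta_in_S \<beta> x by auto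
      show "0 < (x + \<beta>) powr (- (2 * s))" using kx[OF x \<beta>] k by simp
    qed
  qed
  \<comment> \<open>The power function with the smallest admissible parameter, so that all iterates
    are positive combinations of powers.\<close>
  define f0 where "f0 x = 1 * (x + k) powr (- (2 * s))" for x
  have f0p: "0 < f0 x" if "x \<in> S" for x using S_pos(1)[OF that] k by (simp add: f0_def)
  have f0: "f0 \<in> log_lip_cone S M'"
  proof (rule log_lip_coneI)
    show "continuous_on S f0" unfolding f0_def using k
      by (intro continuous_intros ballI) (auto dest: S_pos(1))
    fix x y assume xy: "x \<in> S" "y \<in> S"
    have "f0 x \<le> exp (2 * s / k * \<bar>x - y\<bar>) * f0 y"
      using powr_neg_log_lip[of k "x + k" "y + k" "2 * s"] k s S_pos(1)[OF xy(1)] S_pos(1)[OF xy(2)]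
      by (simp add: f0_def)
    also have "\<dots> \<le> exp (M' * \<bar>x - y\<bar>) * f0 y"
    proof (intro mult_right_mono)
      have "2 * s / k \<le> M'" using M0 by (simp add: M'_def)
      hence "2 * s / k * \<bar>x - y\<bar> \<le> M' * \<bar>x - y\<bar>" by (rule mult_right_mono) simp
      thus "exp (2 * s / k * \<bar>x - y\<bar>) \<le> exp (M' * \<bar>x - y\<bar>)" by (simp only: exp_le_cancel_iff)
    qed (use f0p[OF xy(2)] in simp)
    finally show "f0 x \<le> exp (M' * \<bar>x - y\<bar>) * f0 y" .
  qed (use f0p in \<open>auto dest: less_imp_le\<close>)
  obtain v lam where v: "0 < lam" "v \<in> log_lip_cone S M'"
    "\<And>x. x \<in> S \<Longrightarrow> 0 < v x" "\<And>x. x \<in> S \<Longrightarrow> L_op B s S v x = lam * v x"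
    "\<And>x. x \<in> S \<Longrightarrow> (\<lambda>n. ((L_op B s S) ^^ n) f0 x / ((L_op B s S) ^^ n) f0 al) \<longlonglongrightarrow> v x"
    using L.exists_eigenvector[OF f0 f0p S_compact(3)] by blast
  have sr: "spec_radius S (L_op B s S) = lam"
  proof (rule L.spec_radius_eq_positive[OF _ v(2,3,4,1)])
    show "0 \<le> L_op B s S f x" if "\<And>y. y \<in> S \<Longrightarrow> 0 \<le> f y" "x \<in> S" for f x
      unfolding L_op_eq[OF that(2)] using that(1) theta_in_S[OF _ that(2)]
      by (intro sum_nonneg mult_nonneg_nonneg) auto
  qed
  have iter: "\<exists>g. power_comb (2 * s) (\<gamma> + al) (\<Gamma> + be) g \<and> (\<forall>x\<in>S. ((L_op B s S) ^^ n) f0 x = g x)" for n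
  proof (induction n)
    case 0
    have "power_comb (2 * s) (\<gamma> + al) (\<Gamma> + be) f0"
      unfolding f0_def[abs_def] using gG al_less_be by (intro power_comb.base) (auto simp: k_def)
    thus ?case by auto
  next
    case (Suc n)
    then obtain g where g: "power_comb (2 * s) (\<gamma> + al) (\<Gamma> + be) g" "\<forall>x\<in>S. ((L_op B s S) ^^ n) f0 x = g x"
      by blast
    have "((L_op B s S) ^^ Suc n) f0 = L_op B s S g" using L.T_cong[of "((L_op B s S) ^^ n) f0" g] g(2) by simp
    thus ?case using L_op_power_comb[OF g(1)] by auto
  qed
  have pn: "0 \<le> ((L_op B s S) ^^ n) f0 al" for n
    using log_lip_coneD(2)[OF L.A_pow_cone S_compact(3)] f0 L.cone_sub by blast
  have "\<exists>G. \<forall>n. power_comb (2 * s) (\<gamma> + al) (\<Gamma> + be) (G n) \<and>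
      (\<forall>x\<in>S. ((L_op B s S) ^^ n) f0 x / ((L_op B s S) ^^ n) f0 al = G n x)"
  proof (rule choice, rule allI)
    fix n
    obtain g where g: "power_comb (2 * s) (\<gamma> + al) (\<Gamma> + be) g" "\<forall>x\<in>S. ((L_op B s S) ^^ n) f0 x = g x"
      using iter by blast
    show "\<exists>G. power_comb (2 * s) (\<gamma> + al) (\<Gamma> + be) G \<and>
      (\<forall>x\<in>S. ((L_op B s S) ^^ n) f0 x / ((L_op B s S) ^^ n) f0 al = G x)"
      using power_comb_scale[OF g(1), of "1 / ((L_op B s S) ^^ n) f0 al"] pn[of n] g(2) by (intro exI conjI) auto
  qed
  then obtain G where G: "\<And>n. power_comb (2 * s) (\<gamma> + al) (\<Gamma> + be) (G n)"
    "\<And>n x. x \<in> S \<Longrightarrow> ((L_op B s S) ^^ n) f0 x / ((L_op B s S) ^^ n) f0 al = G n x" by blast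
  have "(\<lambda>n. G n x) \<longlonglongrightarrow> v x" if "x \<in> S" for x using v(5)[OF that] G(2)[OF that] by simp
  thus ?thesis using v(1,3,4) sr G(1) by blast
qed

end

section \<open>Interpolation on a single mesh interval\<close>

definition piece_node :: "nat \<Rightarrow> real \<Rightarrow> real \<Rightarrow> nat \<Rightarrow> real"
  where "piece_node r t h k = t + h * (1 + c_hat r k) / 2"

lemma phi_eq: "pi / (2 * real (Suc r)) = pi / (2 * real r + 2)"
  by (simp add: algebra_simps)

lemma phi_bounds:
  assumes "2 \<le> r"
  shows "0 < pi / (2 * real r + 2)" "pi / (2 * real r + 2) \<le> pi / 6" "0 < cos (pi / (2 * real r + 2))"
    "0 < sin (pi / (2 * real r + 2))" "(sin (pi / (2 * real r + 2)))\<^sup>2 \<le> 1 / 4"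
proof -
  have r: "2 \<le> real r" using assms by simp
  show p: "0 < pi / (2 * real r + 2)" using r by simp
  show q: "pi / (2 * real r + 2) \<le> pi / 6" using r by (intro divide_left_mono) auto
  show "0 < cos (pi / (2 * real r + 2))" using p q pi_gt_zero by (intro cos_gt_zero) linarith+
  show s: "0 < sin (pi / (2 * real r + 2))" using p q pi_gt_zero by (intro sin_gt_zero) linarith+
  have "sin (pi / (2 * real r + 2)) \<le> sin (pi / 6)"
    using p q pi_gt_zero by (intro sin_monotone_2pi_le) linarith+
  hence "(sin (pi / (2 * real r + 2)))\<^sup>2 \<le> (1 / 2)\<^sup>2" using s by (intro power_mono) (auto simp: sin_30)
  thus "(sin (pi / (2 * real r + 2)))\<^sup>2 \<le> 1 / 4" by (simp add: power2_eq_square)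
qed

lemma c_hat_eq: "c_hat r k = - cheb_node (Suc r) k / cos (pi / (2 * real r + 2))"
  unfolding c_hat_def cheb_node_def cheb_angle_def phi_eq by simp

lemma c_hat_ends:
  assumes "2 \<le> r"
  shows "c_hat r 0 = - 1" "c_hat r r = 1"
proof -
  have c: "cos (pi / (2 * real r + 2)) \<noteq> 0" using phi_bounds(3)[OF assms] by simp
  thus "c_hat r 0 = - 1" by (simp add: c_hat_def)
  have "(2 * real r + 1) / (2 * real r + 2) * pi = pi - pi / (2 * real r + 2)" by (simp add: field_simps)
  hence "cos ((2 * real r + 1) / (2 * real r + 2) * pi) = - cos (pi / (2 * real r + 2))"
    by (simp only: cos_pi_minus)
  thus "c_hat r r = 1" using c by (simp add: c_hat_def)
qed

text \<open>Neighbours differ by 2 sin A sin \<phi> / cos \<phi> with A between 2\<phi> and pi -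
  2\<phi>. The sine is smallest at the ends of this range, where sin (2\<phi>) = 2 sin \<phi> cos
  \<phi> gives 4 sin^2 \<phi>.\<close>

lemma c_hat_spacing:
  assumes r: "2 \<le> r" and k: "j < k" "k \<le> r"
  shows "c_hat r j + 4 * (sin (pi / (2 * real r + 2)))\<^sup>2 \<le> c_hat r k"
proof -
  define \<phi> where "\<phi> = pi / (2 * real r + 2)"
  note p = phi_bounds[OF r, folded \<phi>_def]
  have pr: "(2 * real r + 2) * \<phi> = pi" by (simp add: \<phi>_def)
  have ang: "(2 * real i + 1) / (2 * real r + 2) * pi = (2 * real i + 1) * \<phi>" for i
    by (simp add: \<phi>_def)
  have step: "c_hat r i + 4 * (sin \<phi>)\<^sup>2 \<le> c_hat r (Suc i)" if i: "Suc i \<le> r" for i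
  proof -
    define A where "A = 2 * real (Suc i) * \<phi>"
    have "2 * \<phi> \<le> A" using p(1) by (simp add: A_def)
    moreover have "A \<le> pi - 2 * \<phi>"
    proof -
      have "A + 2 * \<phi> = 2 * real (Suc (Suc i)) * \<phi>" by (simp add: A_def algebra_simps)
      also have "\<dots> \<le> (2 * real r + 2) * \<phi>" using i p(1) by (intro mult_right_mono) auto
      finally show ?thesis using pr by simp
    qed
    ultimately have sA: "sin (2 * \<phi>) \<le> sin A"
    proof (cases "A \<le> pi / 2")
      case True
      thus ?thesis using \<open>2 * \<phi> \<le> A\<close> p(1) by (intro sin_monotone_2pi_le) auto
    next
      case False
      have "sin (2 * \<phi>) \<le> sin (pi - A)"
        using \<open>A \<le> pi - 2 * \<phi>\<close> False p(1) by (intro sin_monotone_2pi_le) auto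
      thus ?thesis by simp
    qed
    have e: "(2 * real i + 1) * \<phi> = A - \<phi>" "(2 * real (Suc i) + 1) * \<phi> = A + \<phi>"
      by (simp_all add: A_def algebra_simps)
    have "c_hat r (Suc i) - c_hat r i = (cos (A - \<phi>) - cos (A + \<phi>)) / cos \<phi>"
      unfolding c_hat_def ang e \<phi>_def[symmetric] by (simp add: diff_divide_distrib)
    also have "cos (A - \<phi>) - cos (A + \<phi>) = 2 * (sin A * sin \<phi>)" by (simp add: cos_add cos_diff)
    also have "2 * (sin A * sin \<phi>) / cos \<phi> \<ge> 2 * (sin (2 * \<phi>) * sin \<phi>) / cos \<phi>"
      using sA p by (intro divide_right_mono mult_left_mono mult_right_mono) auto
    also have "2 * (sin (2 * \<phi>) * sin \<phi>) / cos \<phi> = 4 * (sin \<phi>)\<^sup>2"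
      using p(3) by (simp add: sin_double power2_eq_square)
    finally show ?thesis by simp
  qed
  have "c_hat r j + 4 * (sin \<phi>)\<^sup>2 \<le> c_hat r (Suc j + m)" if "Suc j + m \<le> r" for m
    using that
  proof (induction m)
    case 0
    thus ?case using step[of j] by simp
  next
    case (Suc m)
    have "c_hat r j + 4 * (sin \<phi>)\<^sup>2 \<le> c_hat r (Suc j + m)" using Suc by simp
    moreover have "c_hat r (Suc j + m) + 4 * (sin \<phi>)\<^sup>2 \<le> c_hat r (Suc j + Suc m)"
      using step[of "Suc j + m"] Suc.prems by simp
    moreover have "0 \<le> 4 * (sin \<phi>)\<^sup>2" by simp
    ultimately show ?case by linarith
  qed
  from this[of "k - Suc j"] show ?thesis using k by (simp add: \<phi>_def)
qed

lemma c_hat_bounds: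
  assumes "2 \<le> r" "k \<le> r"
  shows "- 1 \<le> c_hat r k" "c_hat r k \<le> 1"
proof -
  have nn: "0 \<le> 4 * (sin (pi / (2 * real r + 2)))\<^sup>2" by simp
  show "- 1 \<le> c_hat r k"
  proof (cases "k = 0")
    case False
    thus ?thesis using c_hat_spacing[OF assms(1), of 0 k] c_hat_ends(1)[OF assms(1)] assms(2) nn by linarith
  qed (simp add: c_hat_ends(1)[OF assms(1)])
  show "c_hat r k \<le> 1"
  proof (cases "k = r")
    case False
    thus ?thesis using c_hat_spacing[OF assms(1), of k r] c_hat_ends(2)[OF assms(1)] assms(2) nn by linarith
  qed (simp add: c_hat_ends(2)[OF assms(1)])
qed

lemma piece_node_ends:
  assumes "2 \<le> r"
  shows "piece_node r t h 0 = t" "piece_node r t h r = t + h"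
  using c_hat_ends[OF assms] by (simp_all add: piece_node_def)

lemma piece_node_in:
  assumes "2 \<le> r" "k \<le> r" "0 < h"
  shows "piece_node r t h k \<in> {t..t + h}"
proof -
  have "0 \<le> h * (1 + c_hat r k)" "h * (1 + c_hat r k) \<le> h * 2"
    using c_hat_bounds[OF assms(1,2)] assms(3) by (auto intro!: mult_left_mono)
  thus ?thesis by (simp add: piece_node_def)
qed

lemma piece_node_spacing:
  assumes "2 \<le> r" "j < k" "k \<le> r" "0 < h"
  shows "piece_node r t h j + 2 * (sin (pi / (2 * real r + 2)))\<^sup>2 * h \<le> piece_node r t h k"
proof -
  have "h * (c_hat r j + 4 * (sin (pi / (2 * real r + 2)))\<^sup>2) \<le> h * c_hat r k"
    using c_hat_spacing[OF assms(1-3)] assms(4) by (intro mult_left_mono) auto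
  thus ?thesis by (simp add: piece_node_def algebra_simps add_divide_distrib)
qed

lemma piece_node_less:
  assumes "2 \<le> r" "j < k" "k \<le> r" "0 < h"
  shows "piece_node r t h j < piece_node r t h k"
proof -
  have "0 < 2 * (sin (pi / (2 * real r + 2)))\<^sup>2 * h" using phi_bounds(4)[OF assms(1)] assms(4) by simp
  thus ?thesis using piece_node_spacing[OF assms, of t] by linarith
qed

lemma inj_on_piece_node:
  assumes "2 \<le> r" "0 < h"
  shows "inj_on (piece_node r t h) {..<Suc r}"
proof (rule inj_onI)
  fix j k assume a: "j \<in> {..<Suc r}" "k \<in> {..<Suc r}" "piece_node r t h j = piece_node r t h k"
  have "\<not> j < k" "\<not> k < j"
    using piece_node_less[OF assms(1) _ _ assms(2), of j k t] piece_node_less[OF assms(1) _ _ assms(2), of k j t] a by auto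
  thus "j = k" by simp
qed

text \<open>The scale is negative because the Chebyshev nodes decrease while the nodes of a piece
  increase.\<close>

lemma piece_node_affine:
  assumes "2 \<le> r"
  shows "piece_node r t h = (\<lambda>k. (t + h / 2) + (- (h / (2 * cos (pi / (2 * real r + 2))))) * cheb_node (Suc r) k)"
  using phi_bounds(3)[OF assms] by (auto simp: piece_node_def c_hat_eq fun_eq_iff field_simps)

lemma piece_affine_point:
  assumes r: "2 \<le> r" and h: "0 < h" and x: "x \<in> {t..t + h}"
  obtains y where "x = (t + h / 2) + (- (h / (2 * cos (pi / (2 * real r + 2))))) * y"
    "\<bar>y\<bar> \<le> cos (pi / (2 * real r + 2))"
proof -
  define c where "c = cos (pi / (2 * real r + 2))"
  have c: "0 < c" using phi_bounds(3)[OF r] by (simp add: c_def)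
  define y where "y = - ((x - (t + h / 2)) * (2 * c / h))"
  have "x = (t + h / 2) + (- (h / (2 * c))) * y" using c h by (simp add: y_def)
  moreover have "\<bar>y\<bar> \<le> c"
  proof -
    have "\<bar>y\<bar> = \<bar>x - (t + h / 2)\<bar> * (2 * c / h)" using c h by (simp add: y_def abs_mult)
    also have "\<dots> \<le> (h / 2) * (2 * c / h)"
    proof (rule mult_right_mono)
      show "\<bar>x - (t + h / 2)\<bar> \<le> h / 2" using x unfolding abs_le_iff by (auto simp: field_simps)
    qed (use c h in auto)
    finally show ?thesis using h by simp
  qed
  ultimately show ?thesis using that unfolding c_def by blast
qed

lemma piece_Lebesgue:
  assumes r: "2 \<le> r" and h: "0 < h" and x: "x \<in> {t..t + h}"
  shows "(\<Sum>k<Suc r. \<bar>lagrange (Suc r) (piece_node r t h) k x\<bar>) \<le> psi r"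
proof -
  define v where "v = - (h / (2 * cos (pi / (2 * real r + 2))))"
  have v: "v \<noteq> 0" using phi_bounds(3)[OF r] h by (simp add: v_def)
  obtain y where y: "x = (t + h / 2) + v * y" "\<bar>y\<bar> \<le> cos (pi / (2 * real r + 2))"
    using piece_affine_point[OF assms] unfolding v_def by blast
  have "lagrange (Suc r) (piece_node r t h) k x = lagrange (Suc r) (cheb_node (Suc r)) k y" for k
    unfolding piece_node_affine[OF r] v_def[symmetric] y(1) by (rule lagrange_affine[OF v])
  moreover have "(\<Sum>k<Suc r. \<bar>lagrange (Suc r) (cheb_node (Suc r)) k y\<bar>) \<le> psi r"
    using y(2) by (intro Lebesgue_constant_le[OF r refl]) (simp only: phi_eq)
  ultimately show ?thesis by simp
qed

text \<open>The node polynomial is a rescaled monic Chebyshev polynomial, and the preimage of the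
  subinterval lies in [-1, 1], where the Chebyshev polynomial is at most 1 in modulus.\<close>

lemma piece_node_prod:
  assumes r: "2 \<le> r" and h: "0 < h" and x: "x \<in> {t..t + h}"
  shows "\<bar>\<Prod>k<Suc r. x - piece_node r t h k\<bar> \<le> 2 * (h / (4 * cos (pi / (2 * real r + 2)))) ^ Suc r"
proof -
  define v where "v = h / (2 * cos (pi / (2 * real r + 2)))"
  have v: "0 < v" using phi_bounds(3)[OF r] h by (simp add: v_def)
  obtain y where y: "x = (t + h / 2) + (- v) * y" "\<bar>y\<bar> \<le> cos (pi / (2 * real r + 2))"
    using piece_affine_point[OF assms] unfolding v_def by blast
  have y1: "\<bar>y\<bar> \<le> 1" using y(2) cos_le_one order_trans by blast
  have "poly (chebyshev (Suc r)) y = cos (real (Suc r) * arccos y)"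
    using poly_chebyshev_cos[of "Suc r" "arccos y"] y1 by (simp add: cos_arccos_abs)
  moreover have "poly (chebyshev (Suc r)) y = 2 ^ r * (\<Prod>k<Suc r. y - cheb_node (Suc r) k)"
    using chebyshev_eq_prod[of "Suc r" y] by (simp only: zero_less_Suc diff_Suc_1)
  ultimately have "\<bar>2 ^ r * (\<Prod>k<Suc r. y - cheb_node (Suc r) k)\<bar> \<le> 1"
    by (metis abs_cos_le_one)
  hence p: "\<bar>\<Prod>k<Suc r. y - cheb_node (Suc r) k\<bar> \<le> 1 / 2 ^ r" by (simp add: abs_mult field_simps del: prod.lessThan_Suc)
  have "x - piece_node r t h k = (- v) * (y - cheb_node (Suc r) k)" for k
    unfolding piece_node_affine[OF r] v_def[symmetric] y(1) by (simp add: algebra_simps)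
  hence "\<bar>\<Prod>k<Suc r. x - piece_node r t h k\<bar> = v ^ Suc r * \<bar>\<Prod>k<Suc r. y - cheb_node (Suc r) k\<bar>"
    using v by (simp only: prod.distrib prod_constant card_lessThan) (simp add: abs_mult power_abs)
  also have "\<dots> \<le> v ^ Suc r * (1 / 2 ^ r)" using p v by (intro mult_left_mono) auto
  also have "\<dots> = 2 * (v / 2) ^ Suc r" by (simp add: power_divide)
  finally show ?thesis by (simp add: v_def)
qed

text \<open>The origin of \<open>eta\<close>: for even r the node r div 2 is the midpoint of the
  subinterval, for odd r it lies tan \<phi> half-lengths to its left.\<close>

lemma piece_center:
  assumes r: "2 \<le> r" and k: "k \<le> r" and h: "0 < h"
  shows "\<bar>piece_node r t h k - piece_node r t h (r div 2)\<bar> \<le> eta r * h"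
proof -
  define \<phi> where "\<phi> = pi / (2 * real r + 2)"
  have cm: "\<bar>c_hat r (r div 2)\<bar> \<le> 2 * eta r - 1"
  proof (cases "even r")
    case True
    then obtain m where m: "r = 2 * m" by blast
    have "(2 * real m + 1) / (2 * real r + 2) * pi = pi / 2" by (simp add: m field_simps)
    hence "cos ((2 * real m + 1) / (2 * real r + 2) * pi) = 0" by (simp only: cos_pi_half)
    moreover have "r div 2 = m" using m by simp
    ultimately show ?thesis using True by (simp add: c_hat_def eta_def)
  next
    case False
    then obtain m where m: "r = 2 * m + 1" by (elim oddE)
    have "(2 * real m + 1) / (2 * real r + 2) * pi = pi / 2 - \<phi>" by (simp add: m \<phi>_def field_simps)
    hence "cos ((2 * real m + 1) / (2 * real r + 2) * pi) = sin \<phi>" by (simp only: cos_sin_eq) simp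
    hence "c_hat r (r div 2) = - tan \<phi>" using m by (simp add: c_hat_def \<phi>_def tan_def)
    moreover have "0 < tan \<phi>" unfolding \<phi>_def tan_def using phi_bounds(3,4)[OF r] by simp
    ultimately show ?thesis using False by (simp add: eta_def \<phi>_def add_divide_distrib)
  qed
  have "\<bar>c_hat r k - c_hat r (r div 2)\<bar> \<le> 2 * eta r" using cm c_hat_bounds[OF r k] by linarith
  hence "h / 2 * \<bar>c_hat r k - c_hat r (r div 2)\<bar> \<le> h / 2 * (2 * eta r)" using h by (intro mult_left_mono) auto
  moreover have "\<bar>piece_node r t h k - piece_node r t h (r div 2)\<bar> = h / 2 * \<bar>c_hat r k - c_hat r (r div 2)\<bar>"
  proof -
    have "piece_node r t h k - piece_node r t h (r div 2) = h / 2 * (c_hat r k - c_hat r (r div 2))"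
      by (simp add: piece_node_def field_simps)
    hence "\<bar>piece_node r t h k - piece_node r t h (r div 2)\<bar> = \<bar>h / 2\<bar> * \<bar>c_hat r k - c_hat r (r div 2)\<bar>"
      by (simp only: abs_mult)
    thus ?thesis using h by simp
  qed
  ultimately show ?thesis by (simp add: mult.commute)
qed

lemma eta_pos: "2 \<le> r \<Longrightarrow> 0 < eta r"
  using phi_bounds(3,4)[of r] by (simp add: eta_def tan_def add_pos_pos)

section \<open>Interpolating data from the cone on one subinterval\<close>

context
  fixes r :: nat and t h M u :: real and F :: "nat \<Rightarrow> real" and p :: "real poly"
  assumes r: "2 \<le> r" and h: "0 < h" and M: "0 < M"
    and F: "\<And>k. k \<le> r \<Longrightarrow> 0 \<le> F k"
      "\<And>j k. j \<le> r \<Longrightarrow> k \<le> r \<Longrightarrow> F j \<le> exp (M * \<bar>piece_node r t h j - piece_node r t h k\<bar>) * F k"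
    and u: "u = M * eta r * h" "psi r * u * exp u < 1"
    and p: "p = lagrange_poly (Suc r) (piece_node r t h) F"
begin

text \<open>Every nodal value differs from the central one by at most u exp u times the latter. The
  fundamental polynomials add up to 1, so subtracting the central value from all data shifts the
  interpolant by that constant, and the Lebesgue constant applies to the differences.\<close>

lemma piece_deviation:
  assumes x: "x \<in> {t..t + h}"
  shows "\<bar>poly p x - F (r div 2)\<bar> \<le> psi r * u * exp u * F (r div 2)"
proof -
  let ?m = "r div 2"
  have u0: "0 \<le> u" using u(1) M h eta_pos[OF r] by simp
  have dev: "\<bar>F k - F ?m\<bar> \<le> u * exp u * F ?m" if k: "k \<le> r" for k
  proof -
    have "M * \<bar>piece_node r t h k - piece_node r t h ?m\<bar> \<le> u"
      using mult_left_mono[OF piece_center[OF r k h], of M t] M by (simp add: u(1) mult.assoc)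
    hence e: "exp (M * \<bar>piece_node r t h k - piece_node r t h ?m\<bar>) \<le> exp u" by simp
    have m: "?m \<le> r" by simp
    have 1: "F k \<le> exp u * F ?m"
      using order_trans[OF F(2)[OF k m] mult_right_mono[OF e F(1)[OF m]]] .
    have "F ?m \<le> exp u * F k"
      using order_trans[OF F(2)[OF m k] mult_right_mono[OF _ F(1)[OF k]]] e
      by (simp add: abs_minus_commute)
    hence "exp (- u) * F ?m \<le> exp (- u) * (exp u * F k)" by (intro mult_left_mono) auto
    also have "\<dots> = F k" by (simp add: exp_minus)
    finally have 2: "exp (- u) * F ?m \<le> F k" .
    have 3: "1 - u \<le> exp (- u)" using exp_ge_add_one_self[of "- u"] by simp
    have "exp u * (1 - u) \<le> exp u * exp (- u)" using 3 by (intro mult_left_mono) auto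
    hence 4: "exp u - 1 \<le> u * exp u" by (simp add: exp_minus algebra_simps)
    have 5: "1 - exp (- u) \<le> u * exp u"
    proof -
      have "u * 1 \<le> u * exp u" using u0 by (intro mult_left_mono) auto
      thus ?thesis using 3 by linarith
    qed
    have "F k - F ?m \<le> u * exp u * F ?m"
      using 1 mult_right_mono[OF 4 F(1)[OF m]] by (simp add: algebra_simps)
    moreover have "F ?m - F k \<le> u * exp u * F ?m"
      using 2 mult_right_mono[OF 5 F(1)[OF m]] by (simp add: algebra_simps)
    ultimately show ?thesis by (simp add: abs_le_iff)
  qed
  have "poly p x - F ?m = (\<Sum>k<Suc r. (F k - F ?m) * lagrange (Suc r) (piece_node r t h) k x)"
    using sum_lagrange[OF inj_on_piece_node[OF r h], of t x]
    unfolding p poly_lagrange_poly left_diff_distrib sum_subtractf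
    by (simp add: sum_distrib_left[symmetric] del: sum.lessThan_Suc)
  also have "\<bar>\<dots>\<bar> \<le> (\<Sum>k<Suc r. \<bar>(F k - F ?m) * lagrange (Suc r) (piece_node r t h) k x\<bar>)" by (rule sum_abs)
  also have "\<dots> \<le> (\<Sum>k<Suc r. u * exp u * F ?m * \<bar>lagrange (Suc r) (piece_node r t h) k x\<bar>)"
    unfolding abs_mult by (intro sum_mono mult_right_mono dev) auto
  also have "\<dots> = u * exp u * F ?m * (\<Sum>k<Suc r. \<bar>lagrange (Suc r) (piece_node r t h) k x\<bar>)"
    by (rule sum_distrib_left[symmetric])
  also have "\<dots> \<le> u * exp u * F ?m * psi r"
    using u0 F(1)[of ?m] by (intro mult_left_mono piece_Lebesgue[OF r h x]) auto
  finally show ?thesis by (simp add: mult_ac)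
qed

lemma piece_lower_bound:
  assumes x: "x \<in> {t..t + h}"
  shows "(1 - psi r * u * exp u) * F (r div 2) \<le> poly p x"
  using piece_deviation[OF x] by (simp add: abs_le_iff algebra_simps)

text \<open>Markov's inequality is applied to \<open>p\<close> minus its central value: the constant
  drops out of the derivative, but the bound becomes proportional to u. The factor h in u cancels
  the 2/h of the rescaling, so no negative power of h is left.\<close>

lemma piece_derivative_bound:
  assumes x: "x \<in> {t..t + h}"
  shows "\<bar>poly (pderiv p) x\<bar> \<le> M * (2 * eta r * (real r)\<^sup>2 * psi r) * exp u / (1 - psi r * u * exp u) * poly p x"
proof -
  let ?m = "r div 2"
  define K where "K = psi r * u * exp u * F ?m"
  define q where "q = pcompose (p - [:F ?m:]) [:t + h / 2, h / 2:]"
  have degp: "degree p \<le> r" using degree_lagrange_poly[of "Suc r"] by (simp add: p)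
  have "degree q \<le> r" unfolding q_def using h degp by (simp add: degree_pcompose degree_diff_le)
  moreover have "\<bar>poly q y\<bar> \<le> K" if "\<bar>y\<bar> \<le> 1" for y
  proof -
    have "h / 2 * \<bar>y\<bar> \<le> h / 2 * 1" using that h by (intro mult_left_mono) auto
    hence "\<bar>h / 2 * y\<bar> \<le> h / 2" using h by (simp add: abs_mult)
    hence "t + h / 2 + h / 2 * y \<in> {t..t + h}" by (auto simp: abs_le_iff)
    from piece_deviation[OF this] show ?thesis by (simp add: q_def poly_pcompose K_def mult.commute)
  qed
  moreover define y where "y = (x - (t + h / 2)) * (2 / h)"
  have y1: "\<bar>y\<bar> \<le> 1"
  proof -
    have "\<bar>y\<bar> = \<bar>x - (t + h / 2)\<bar> * (2 / h)"
      unfolding y_def abs_mult using h by simp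
    also have "\<dots> \<le> (h / 2) * (2 / h)"
    proof (rule mult_right_mono)
      show "\<bar>x - (t + h / 2)\<bar> \<le> h / 2" using x unfolding abs_le_iff by (auto simp: field_simps)
    qed (use h in auto)
    finally show ?thesis using h by simp
  qed
  ultimately have mk: "\<bar>poly (pderiv q) y\<bar> \<le> (real r)\<^sup>2 * K"
    using r by (intro Markov_inequality) auto
  have xy: "t + h / 2 + h * y / 2 = x" using h by (simp add: y_def field_simps)
  have "poly (pderiv q) y = h / 2 * poly (pderiv p) x"
    unfolding q_def by (simp add: pderiv_pcompose poly_pcompose pderiv_pCons pderiv_diff mult.commute[of y] xy)
  hence "h / 2 * \<bar>poly (pderiv p) x\<bar> \<le> (real r)\<^sup>2 * K" using mk h by (simp add: abs_mult)
  hence "\<bar>poly (pderiv p) x\<bar> \<le> 2 / h * ((real r)\<^sup>2 * K)" using h by (simp add: field_simps)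
  also have "\<dots> = M * (2 * eta r * (real r)\<^sup>2 * psi r) * exp u * F ?m"
    using h by (simp add: K_def u(1))
  also have "\<dots> \<le> M * (2 * eta r * (real r)\<^sup>2 * psi r) * exp u * (poly p x / (1 - psi r * u * exp u))"
  proof (rule mult_left_mono)
    show "F ?m \<le> poly p x / (1 - psi r * u * exp u)"
      using piece_lower_bound[OF x] u(2) by (simp add: le_divide_eq mult.commute)
    have "0 \<le> psi r" using psi_ge_1[of r] r by simp
    thus "0 \<le> M * (2 * eta r * (real r)\<^sup>2 * psi r) * exp u" using M eta_pos[OF r] by simp
  qed
  finally show ?thesis by simp
qed

text \<open>From |p'| \<le> K p it follows that exp (K z) p(z) increases and exp (-K z) p(z)
  decreases; no logarithm of \<open>p\<close> is taken.\<close>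

lemma piece_log_lip:
  assumes x: "x \<in> {t..t + h}" and y: "y \<in> {t..t + h}"
    and K: "M * (2 * eta r * (real r)\<^sup>2 * psi r) * exp u / (1 - psi r * u * exp u) \<le> K"
  shows "poly p x \<le> exp (K * \<bar>x - y\<bar>) * poly p y"
proof -
  have pnn: "0 \<le> poly p z" if "z \<in> {t..t + h}" for z
    using piece_lower_bound[OF that] F(1)[of "r div 2"] u(2)
    by (meson order_trans mult_nonneg_nonneg diff_ge_0_iff_ge div_le_dividend less_imp_le)
  have d: "\<bar>poly (pderiv p) z\<bar> \<le> K * poly p z" if "z \<in> {t..t + h}" for z
    using piece_derivative_bound[OF that] mult_right_mono[OF K pnn[OF that]] by linarith
  have mono: "exp (\<sigma> * K * v) * poly p v \<le> exp (\<sigma> * K * w) * poly p w"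
    if vw: "\<sigma> * v \<le> \<sigma> * w" and \<sigma>: "\<sigma> = 1 \<or> \<sigma> = - 1" and v: "v \<in> {t..t + h}" and w: "w \<in> {t..t + h}" for v w \<sigma>
  proof -
    have D: "((\<lambda>z. exp (\<sigma> * K * z) * poly p z) has_real_derivative
        exp (\<sigma> * K * z) * (\<sigma> * K * poly p z + poly (pderiv p) z)) (at z)" for z
      by (auto intro!: derivative_eq_intros poly_DERIV simp: algebra_simps)
    show ?thesis
    proof (cases "\<sigma> = 1")
      case True
      have "v \<le> w" using vw True by simp
      thus ?thesis
      proof (rule DERIV_nonneg_imp_nondecreasing)
        fix z assume "v \<le> z" "z \<le> w"
        hence "z \<in> {t..t + h}" using v w by auto
        hence "0 \<le> \<sigma> * K * poly p z + poly (pderiv p) z" using d[of z] True by (simp add: abs_le_iff)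
        thus "\<exists>y. ((\<lambda>z. exp (\<sigma> * K * z) * poly p z) has_real_derivative y) (at z) \<and> 0 \<le> y"
          by (intro exI[of _ "exp (\<sigma> * K * z) * (\<sigma> * K * poly p z + poly (pderiv p) z)"] conjI D) simp
      qed
    next
      case False
      hence \<sigma>1: "\<sigma> = - 1" using \<sigma> by simp
      have "w \<le> v" using vw \<sigma>1 by simp
      thus ?thesis
      proof (rule DERIV_nonpos_imp_nonincreasing)
        fix z assume "w \<le> z" "z \<le> v"
        hence "z \<in> {t..t + h}" using v w by auto
        hence "\<sigma> * K * poly p z + poly (pderiv p) z \<le> 0" using d[of z] \<sigma>1 by (simp add: abs_le_iff)
        thus "\<exists>y. ((\<lambda>z. exp (\<sigma> * K * z) * poly p z) has_real_derivative y) (at z) \<and> y \<le> 0"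
          by (intro exI[of _ "exp (\<sigma> * K * z) * (\<sigma> * K * poly p z + poly (pderiv p) z)"] conjI D)
            (simp add: mult_nonneg_nonpos)
      qed
    qed
  qed
  define \<sigma> :: real where "\<sigma> = (if x \<le> y then 1 else - 1)"
  have \<sigma>: "\<sigma> = 1 \<or> \<sigma> = - 1" "\<sigma> * x \<le> \<sigma> * y" "\<bar>x - y\<bar> = \<sigma> * (y - x)" by (auto simp: \<sigma>_def)
  have "exp (- (\<sigma> * K * x)) * (exp (\<sigma> * K * x) * poly p x) \<le> exp (- (\<sigma> * K * x)) * (exp (\<sigma> * K * y) * poly p y)"
    using mono[OF \<sigma>(2,1) x y] by (intro mult_left_mono) auto
  moreover have "exp (- (\<sigma> * K * x)) * (exp (\<sigma> * K * x) * poly p x) = poly p x"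
    by (simp add: exp_minus)
  moreover have "exp (- (\<sigma> * K * x)) * (exp (\<sigma> * K * y) * poly p y) = exp (K * \<bar>x - y\<bar>) * poly p y"
    unfolding \<sigma>(3) mult.assoc[symmetric] exp_add[symmetric] by (simp add: algebra_simps)
  ultimately show ?thesis by linarith
qed

end

text \<open>The classical Cauchy form. The function minus a polynomial of degree at most r + 1
  vanishes at r + 2 points, and the derivative of order r + 1 of that polynomial is a
  constant.\<close>

lemma interpolation_remainder:
  fixes f :: "nat \<Rightarrow> real \<Rightarrow> real" and z :: "nat \<Rightarrow> real"
  assumes inj: "inj_on z {..<Suc r}" and zI: "\<And>k. k < Suc r \<Longrightarrow> z k \<in> {c..d}" and x: "x \<in> {c..d}"
    and f: "\<And>m y. y \<in> {c..d} \<Longrightarrow> (f m has_real_derivative f (Suc m) y) (at y)"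
  shows "\<exists>\<zeta>\<in>{c..d}. f 0 x - poly (lagrange_poly (Suc r) z (\<lambda>k. f 0 (z k))) x
    = f (Suc r) \<zeta> / fact (Suc r) * (\<Prod>k<Suc r. x - z k)"
proof (cases "\<exists>k<Suc r. x = z k")
  case True
  then obtain k where k: "k < Suc r" "x = z k" by blast
  have "(\<Prod>k<Suc r. x - z k) = 0" using k by (intro prod_zero) auto
  moreover have "poly (lagrange_poly (Suc r) z (\<lambda>k. f 0 (z k))) x = f 0 x"
    using poly_lagrange_poly_node[OF inj k(1)] k(2) by simp
  ultimately show ?thesis using x by (intro bexI[of _ x]) auto
next
  case False
  define P where "P = lagrange_poly (Suc r) z (\<lambda>k. f 0 (z k))"
  define W where "W = (\<Prod>k<Suc r. [:- z k, 1:])"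
  have Wx: "poly W y = (\<Prod>k<Suc r. y - z k)" for y by (simp add: W_def poly_prod del: prod.lessThan_Suc)
  have Wnz: "poly W x \<noteq> 0" using False by (auto simp: Wx simp del: prod.lessThan_Suc)
  \<comment> \<open>Chosen so that \<open>Q\<close> agrees with \<open>f 0\<close> at x in addition
    to the nodes.\<close>
  define K where "K = (f 0 x - poly P x) / poly W x"
  define Q where "Q = P + smult K W"
  have degP: "degree P \<le> r" unfolding P_def using degree_lagrange_poly[of "Suc r"] by simp
  have degW: "degree W = Suc r" unfolding W_def by (subst degree_prod_eq_sum_degree) auto
  have leadW: "coeff W (Suc r) = 1"
    using lead_coeff_prod[of "\<lambda>k. [:- z k, 1:]" "{..<Suc r}"] degW unfolding W_def by simp
  have degQ: "degree Q \<le> Suc r"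
    unfolding Q_def using degP degW degree_smult_le[of K W] by (intro degree_add_le) auto
  have cQ: "coeff Q (Suc r) = K"
    unfolding Q_def using degP leadW by (simp add: coeff_eq_0)
  have hQ: "poly ((pderiv ^^ Suc r) Q) y = fact (Suc r) * K" for y
  proof -
    have "coeff ((pderiv ^^ Suc r) Q) m = coeff [:fact (Suc r) * K:] m" for m
    proof (cases m)
      case 0
      thus ?thesis using cQ by (simp only: coeff_higher_pderiv) (simp add: pochhammer_fact)
    next
      case (Suc l)
      hence "coeff Q (m + Suc r) = 0" using degQ by (intro coeff_eq_0) simp
      thus ?thesis using Suc by (simp only: coeff_higher_pderiv) simp
    qed
    hence "(pderiv ^^ Suc r) Q = [:fact (Suc r) * K:]" by (intro poly_eqI)
    thus ?thesis by simp
  qed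
  \<comment> \<open>Rolle's theorem needs the zeros in increasing order, whereas the position of x
    among the nodes is unknown; hence the sorted list.\<close>
  define pts where "pts = insert x (z ` {..<Suc r})"
  have card: "card pts = Suc (Suc r)"
    unfolding pts_def using False inj by (subst card_insert_disjoint) (auto simp: card_image)
  define l where "l = sorted_list_of_set pts"
  have finp: "finite pts" by (simp add: pts_def)
  have l: "length l = Suc (Suc r)" "sorted_wrt (<) l" "set l = pts"
    using card finp by (auto simp: l_def strict_sorted_iff)
  have ptsI: "y \<in> {c..d}" if "y \<in> pts" for y using that zI x by (auto simp: pts_def)
  have lI: "l ! 0 \<in> {c..d}" "l ! Suc r \<in> {c..d}"
    using nth_mem[of 0 l] nth_mem[of "Suc r" l] unfolding l(1,3) by (auto dest: ptsI)
  define g where "g m y = f m y - poly ((pderiv ^^ m) Q) y" for m y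
  have g0: "g 0 y = 0" if "y \<in> pts" for y
    using that unfolding pts_def
  proof
    assume "y = x"
    thus ?thesis using Wnz by (simp add: g_def Q_def K_def)
  next
    assume "y \<in> z ` {..<Suc r}"
    then obtain k where k: "k < Suc r" "y = z k" by auto
    have "poly W (z k) = 0" unfolding Wx using k by (intro prod_zero) auto
    thus ?thesis using poly_lagrange_poly_node[OF inj k(1)] k(2) by (simp add: g_def Q_def P_def)
  qed
  have "\<exists>\<zeta>\<in>{l ! 0..l ! Suc r}. g (Suc r) \<zeta> = 0"
  proof (rule iterated_Rolle[of "Suc r" "\<lambda>i. l ! i" g])
    show "l ! i < l ! Suc i" if "i < Suc r" for i
      using sorted_wrt_nth_less[OF l(2), of i "Suc i"] that l(1) by simp
    show "g 0 (l ! i) = 0" if "i \<le> Suc r" for i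
      using that l nth_mem[of i l] by (intro g0) auto
    show "(g m has_real_derivative g (Suc m) y) (at y)" if "l ! 0 \<le> y" "y \<le> l ! Suc r" for m y
    proof -
      have "y \<in> {c..d}" using that lI by auto
      thus ?thesis unfolding g_def by (auto intro!: derivative_eq_intros f poly_DERIV)
    qed
  qed
  then obtain \<zeta> where \<zeta>: "l ! 0 \<le> \<zeta>" "\<zeta> \<le> l ! Suc r" "g (Suc r) \<zeta> = 0" by auto
  have "\<zeta> \<in> {c..d}" using \<zeta> lI by auto
  moreover have "f (Suc r) \<zeta> = fact (Suc r) * K" using \<zeta>(3) unfolding g_def hQ by simp
  hence "f (Suc r) \<zeta> / fact (Suc r) = K" by (simp del: fact_Suc)
  moreover have "f 0 x - poly P x = K * (\<Prod>k<Suc r. x - z k)"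
    using Wnz unfolding Wx[symmetric] by (simp add: K_def)
  ultimately show ?thesis unfolding P_def by (intro bexI[of _ \<zeta>]) (simp_all only:)
qed

lemma powr_higher_derivative:
  assumes "0 < y + \<tau>"
  shows "((\<lambda>y. (- 1) ^ m * (\<Prod>k<m. q + real k) * (y + \<tau>) powr (- q - real m)) has_real_derivative
    (- 1) ^ Suc m * (\<Prod>k<Suc m. q + real k) * (y + \<tau>) powr (- q - real (Suc m))) (at y)"
proof -
  have "((\<lambda>y. (y + \<tau>) powr (- q - real m)) has_real_derivative
      (- q - real m) * (y + \<tau>) powr (- q - real (Suc m))) (at y)"
    using assms by (auto intro!: derivative_eq_intros simp: algebra_simps)
  from DERIV_cmult[OF this, of "(- 1) ^ m * (\<Prod>k<m. q + real k)"] show ?thesis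
    by (simp add: algebra_simps)
qed

text \<open>The constant \<open>G_const r s x h\<close> is exactly what the remainder formula yields for
  \<open>(y + \<tau>)\<^sup>-\<^sup>2\<^sup>s\<close> on an interval of length at most \<open>h\<close> where \<open>y + \<tau> \<ge> x\<close>.\<close>

lemma power_interpolation_error:
  assumes r: "2 \<le> r" and h: "0 < h" "h \<le> h'" and s: "0 < s" and \<kappa>: "0 < \<kappa>" "\<kappa> \<le> t + \<tau>"
    and x: "x \<in> {t..t + h}"
  shows "\<bar>(\<Sum>k<Suc r. (piece_node r t h k + \<tau>) powr (- (2 * s)) * lagrange (Suc r) (piece_node r t h) k x)
      - (x + \<tau>) powr (- (2 * s))\<bar> \<le> G_const r s \<kappa> h' * h' ^ Suc r * (x + \<tau>) powr (- (2 * s))"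
proof -
  define n where "n = Suc r"
  define f where "f m y = (- 1) ^ m * (\<Prod>k<m. 2 * s + real k) * (y + \<tau>) powr (- (2 * s) - real m)" for m y
  have pos: "\<kappa> \<le> y + \<tau>" if "y \<in> {t..t + h}" for y using that \<kappa> by auto
  have "\<exists>\<zeta>\<in>{t..t + h}. f 0 x - poly (lagrange_poly (Suc r) (piece_node r t h) (\<lambda>k. f 0 (piece_node r t h k))) x
    = f (Suc r) \<zeta> / fact (Suc r) * (\<Prod>k<Suc r. x - piece_node r t h k)"
  proof (rule interpolation_remainder[OF inj_on_piece_node[OF r h(1)] _ x])
    show "piece_node r t h k \<in> {t..t + h}" if "k < Suc r" for k
      using piece_node_in[OF r _ h(1)] that by simp
    show "(f m has_real_derivative f (Suc m) y) (at y)" if "y \<in> {t..t + h}" for m y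
      unfolding f_def using pos[OF that] \<kappa> by (intro powr_higher_derivative) simp
  qed
  then obtain \<zeta> where \<zeta>: "\<zeta> \<in> {t..t + h}" and eq:
    "f 0 x - poly (lagrange_poly (Suc r) (piece_node r t h) (\<lambda>k. f 0 (piece_node r t h k))) x
      = f (Suc r) \<zeta> / fact (Suc r) * (\<Prod>k<Suc r. x - piece_node r t h k)" by blast
  define c where "c = cos (pi / (2 * real r + 2))"
  have c: "0 < c" using phi_bounds(3)[OF r] by (simp add: c_def)
  define A where "A = (\<Prod>k<n. 2 * s + real k)"
  have A: "0 < A" unfolding A_def using s by (intro prod_pos) auto
  have z0: "0 < \<zeta> + \<tau>" "0 < x + \<tau>" using pos[OF \<zeta>] pos[OF x] \<kappa> by auto
  have fb: "\<bar>f n \<zeta>\<bar> \<le> A * ((1 / \<kappa> ^ n) * (exp (2 * s * h' / \<kappa>) * (x + \<tau>) powr (- (2 * s))))"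
  proof -
    have "\<bar>f n \<zeta>\<bar> = A * (\<zeta> + \<tau>) powr (- (2 * s) - real n)"
      unfolding f_def A_def[symmetric] using A by (simp add: abs_mult)
    also have "(\<zeta> + \<tau>) powr (- (2 * s) - real n) = (1 / (\<zeta> + \<tau>) ^ n) * (\<zeta> + \<tau>) powr (- (2 * s))"
      using z0 by (simp add: powr_diff powr_realpow)
    also have "\<dots> \<le> (1 / \<kappa> ^ n) * (exp (2 * s * h' / \<kappa>) * (x + \<tau>) powr (- (2 * s)))"
    proof (rule mult_mono)
      show "1 / (\<zeta> + \<tau>) ^ n \<le> 1 / \<kappa> ^ n"
        using pos[OF \<zeta>] \<kappa> by (intro divide_left_mono power_mono) auto
      have "(\<zeta> + \<tau>) powr (- (2 * s)) \<le> exp (2 * s / \<kappa> * \<bar>(\<zeta> + \<tau>) - (x + \<tau>)\<bar>) * (x + \<tau>) powr (- (2 * s))"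
        using pos[OF \<zeta>] pos[OF x] \<kappa> s by (intro powr_neg_log_lip) auto
      also have "\<dots> \<le> exp (2 * s * h' / \<kappa>) * (x + \<tau>) powr (- (2 * s))"
      proof (rule mult_right_mono)
        have "\<bar>(\<zeta> + \<tau>) - (x + \<tau>)\<bar> \<le> h'" using \<zeta> x h by auto
        hence "2 * s / \<kappa> * \<bar>(\<zeta> + \<tau>) - (x + \<tau>)\<bar> \<le> 2 * s / \<kappa> * h'" using s \<kappa> by (intro mult_left_mono) auto
        thus "exp (2 * s / \<kappa> * \<bar>(\<zeta> + \<tau>) - (x + \<tau>)\<bar>) \<le> exp (2 * s * h' / \<kappa>)" by simp
      qed simp
      finally show "(\<zeta> + \<tau>) powr (- (2 * s)) \<le> exp (2 * s * h' / \<kappa>) * (x + \<tau>) powr (- (2 * s))" .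
    qed (use \<kappa> in auto)
    finally show ?thesis using A by simp
  qed
  have W: "\<bar>\<Prod>k<n. x - piece_node r t h k\<bar> \<le> 2 * (h' / (4 * c)) ^ n"
  proof -
    have "\<bar>\<Prod>k<n. x - piece_node r t h k\<bar> \<le> 2 * (h / (4 * c)) ^ n"
      unfolding n_def c_def by (rule piece_node_prod[OF r h(1) x])
    also have "\<dots> \<le> 2 * (h' / (4 * c)) ^ n"
      using h c by (intro mult_left_mono power_mono divide_right_mono) auto
    finally show ?thesis .
  qed
  have "\<bar>f 0 x - poly (lagrange_poly (Suc r) (piece_node r t h) (\<lambda>k. f 0 (piece_node r t h k))) x\<bar>
      = \<bar>f n \<zeta>\<bar> / fact n * \<bar>\<Prod>k<n. x - piece_node r t h k\<bar>"
    unfolding eq n_def by (simp add: abs_mult abs_divide del: prod.lessThan_Suc fact_Suc)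
  also have "\<dots> \<le> (A * ((1 / \<kappa> ^ n) * (exp (2 * s * h' / \<kappa>) * (x + \<tau>) powr (- (2 * s))))) / fact n
      * (2 * (h' / (4 * c)) ^ n)"
    using fb W A \<kappa> by (intro mult_mono divide_right_mono) auto
  also have "\<dots> = (2 * exp (2 * s * h' / \<kappa>) * (A / (2 ^ n * fact n)) * (1 / \<kappa> ^ n) * (1 / (2 * c)) ^ n)
      * h' ^ n * (x + \<tau>) powr (- (2 * s))"
  proof -
    \<comment> \<open>The 2^n separated here combines with n! to form the product of even numbers in
      \<open>G_const\<close>.\<close>
    have "(h' / (4 * c)) ^ n = (1 / (2 * c)) ^ n * h' ^ n / 2 ^ n"
      by (simp add: power_divide power_mult_distrib flip: power_mult_distrib[of 2 2])
    thus ?thesis by (simp add: mult_ac)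
  qed
  also have "2 * exp (2 * s * h' / \<kappa>) * (A / (2 ^ n * fact n)) * (1 / \<kappa> ^ n) * (1 / (2 * c)) ^ n = G_const r s \<kappa> h'"
  proof -
    have "(\<Prod>k=0..r. 2 * s + real k) = A"
      unfolding A_def n_def by (simp add: atLeast0AtMost lessThan_Suc_atMost)
    moreover have "(\<Prod>k=1..r+1. 2 * real k) = 2 ^ n * fact n"
      unfolding n_def by (simp add: prod.distrib fact_prod algebra_simps del: fact_Suc)
    ultimately show ?thesis unfolding G_const_def c_def n_def by simp
  qed
  finally show ?thesis
    unfolding poly_lagrange_poly f_def n_def by (simp add: abs_minus_commute del: sum.lessThan_Suc)
qed

text \<open>The error is linear in \<open>f\<close> and its bound is relative to \<open>f x\<close>
  with a factor independent of the parameter, so it survives nonnegative combinations.\<close>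

lemma power_comb_interpolation_error:
  assumes f: "power_comb (2 * s) lo hi f"
    and r: "2 \<le> r" and h: "0 < h" "h \<le> h'" and s: "0 < s" and \<kappa>: "0 < \<kappa>" "\<kappa> \<le> t + lo"
    and x: "x \<in> {t..t + h}"
  shows "\<bar>(\<Sum>k<Suc r. f (piece_node r t h k) * lagrange (Suc r) (piece_node r t h) k x) - f x\<bar>
    \<le> G_const r s \<kappa> h' * h' ^ Suc r * f x"
  using f
proof induction
  case (base \<tau> c)
  have \<tau>: "\<kappa> \<le> t + \<tau>" using base(1) \<kappa> by simp
  let ?D = "(\<Sum>k<Suc r. (piece_node r t h k + \<tau>) powr (- (2 * s)) * lagrange (Suc r) (piece_node r t h) k x)
      - (x + \<tau>) powr (- (2 * s))"
  have "c * \<bar>?D\<bar> \<le> c * (G_const r s \<kappa> h' * h' ^ Suc r * (x + \<tau>) powr (- (2 * s)))"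
    using power_interpolation_error[OF r h s \<kappa>(1) \<tau> x] base(3) by (intro mult_left_mono) auto
  moreover have "c * \<bar>?D\<bar> = \<bar>c * ?D\<bar>" using base(3) by (simp add: abs_mult)
  ultimately show ?case by (simp add: right_diff_distrib sum_distrib_left mult_ac del: sum.lessThan_Suc)
next
  case (add f g)
  thus ?case by (simp add: distrib_left distrib_right sum.distrib del: sum.lessThan_Suc)
qed

lemma power_comb_log_lip:
  assumes f: "power_comb p lo hi f" and p: "0 \<le> p" and \<kappa>: "0 < \<kappa>" "\<kappa> \<le> x + lo" "\<kappa> \<le> y + lo"
  shows "f x \<le> exp (p / \<kappa> * \<bar>x - y\<bar>) * f y"
  using f
proof induction
  case (base \<tau> c)
  have "(x + \<tau>) powr (- p) \<le> exp (p / \<kappa> * \<bar>(x + \<tau>) - (y + \<tau>)\<bar>) * (y + \<tau>) powr (- p)"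
    using base(1) \<kappa> p by (intro powr_neg_log_lip) auto
  from mult_left_mono[OF this base(3)] show ?case by (simp add: mult_ac)
next
  case (add f g)
  thus ?case by (simp add: distrib_left)
qed

section \<open>The piecewise polynomial interpolant\<close>

locale mesh =
  fixes r I :: nat and a b :: "nat \<Rightarrow> real" and N :: "nat \<Rightarrow> nat"
  assumes r: "2 \<le> r" and I: "1 \<le> I"
    and ab: "\<And>i. i \<in> {1..I} \<Longrightarrow> a i < b i"
    and gap: "\<And>i. i \<in> {1..<I} \<Longrightarrow> b i < a (i + 1)"
    and N: "\<And>i. i \<in> {1..I} \<Longrightarrow> 0 < N i"
begin

abbreviation "hh \<equiv> mesh_h a b N"
abbreviation "tt \<equiv> mesh_t a b N"
abbreviation "nd \<equiv> mesh_c r a b N"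
abbreviation "T \<equiv> mesh_T r I a b N"
abbreviation "itp \<equiv> interpolant r I a b N"

lemma hh_pos: "i \<in> {1..I} \<Longrightarrow> 0 < hh i"
  using ab[of i] N[of i] by (simp add: mesh_h_def)

lemma tt_0: "tt i 0 = a i" by (simp add: mesh_t_def)

lemma tt_N: "i \<in> {1..I} \<Longrightarrow> tt i (N i) = b i"
  using N[of i] by (simp add: mesh_t_def mesh_h_def)

lemma tt_Suc: "tt i (Suc j) = tt i j + hh i"
  by (simp add: mesh_t_def algebra_simps)

lemma tt_pred: "1 \<le> j \<Longrightarrow> tt i j = tt i (j - 1) + hh i"
  using tt_Suc[of i "j - 1"] by simp

lemma tt_mono: "i \<in> {1..I} \<Longrightarrow> j \<le> j' \<Longrightarrow> tt i j \<le> tt i j'"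
  using hh_pos[of i] by (simp add: mesh_t_def mult_right_mono)

lemma nd_eq: "nd i j = piece_node r (tt i (j - 1)) (hh i)"
  by (rule ext) (simp add: mesh_c_def piece_node_def)

lemma piece_sub: "i \<in> {1..I} \<Longrightarrow> j \<in> {1..N i} \<Longrightarrow> {tt i (j - 1)..tt i j} \<subseteq> {a i..b i}"
  using tt_mono[of i 0 "j - 1"] tt_mono[of i j "N i"] tt_0 tt_N[of i] by auto

lemma find_piece:
  assumes "i \<in> {1..I}" "x \<in> {a i..b i}"
  shows "\<exists>j\<in>{1..N i}. x \<in> {tt i (j - 1)..tt i j}"
proof -
  define j where "j = (LEAST j. x \<le> tt i (Suc j))"
  have ex: "x \<le> tt i (Suc (N i - 1))" using assms tt_N[of i] N[of i] by simp
  have j: "x \<le> tt i (Suc j)" "j \<le> N i - 1"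
    unfolding j_def using ex by (rule LeastI, rule Least_le)
  have "tt i j \<le> x"
  proof (cases j)
    case 0
    thus ?thesis using assms(2) tt_0[of i] by simp
  next
    case (Suc l)
    hence "\<not> x \<le> tt i (Suc l)"
      using not_less_Least[of l "\<lambda>j. x \<le> tt i (Suc j)"] unfolding j_def by simp
    thus ?thesis using Suc by simp
  qed
  thus ?thesis using j N[OF assms(1)] by (intro bexI[of _ "Suc j"]) auto
qed

lemma gap_mono:
  assumes "i \<in> {1..I}" "i' \<in> {1..I}" "i < i'"
  shows "a (i + 1) \<le> a i'" "b i < a i'"
proof -
  have "i \<in> {1..<I}" using assms by auto
  have "a (i + 1) \<le> a (i + 1 + m)" if "i + 1 + m \<le> I" for m
    using that
  proof (induction m)
    case (Suc m)
    have "a (i + 1 + m) < b (i + 1 + m)" using assms Suc by (intro ab) auto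
    moreover have "b (i + 1 + m) < a (i + 1 + m + 1)" using assms Suc by (intro gap) auto
    ultimately show ?case using Suc by simp
  qed simp
  from this[of "i' - (i + 1)"] show "a (i + 1) \<le> a i'" using assms by simp
  thus "b i < a i'" using gap[OF \<open>i \<in> {1..<I}\<close>] by simp
qed

lemma inj_nd: "i \<in> {1..I} \<Longrightarrow> inj_on (nd i j) {..<Suc r}"
  unfolding nd_eq by (intro inj_on_piece_node r hh_pos)

lemma nd_in: "i \<in> {1..I} \<Longrightarrow> j \<in> {1..N i} \<Longrightarrow> k \<le> r \<Longrightarrow> nd i j k \<in> {tt i (j - 1)..tt i j}"
  using piece_node_in[OF r _ hh_pos, of k i "tt i (j - 1)"] tt_pred[of j i] unfolding nd_eq by auto

lemma nd_in_T: "i \<in> {1..I} \<Longrightarrow> j \<in> {1..N i} \<Longrightarrow> k \<le> r \<Longrightarrow> nd i j k \<in> T"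
  unfolding mesh_T_def by force

lemma nd_ends:
  assumes "j \<in> {1..N i}"
  shows "nd i j 0 = tt i (j - 1)" "nd i j r = tt i j"
  using piece_node_ends[OF r] tt_pred[of j i] assms unfolding nd_eq by auto

definition pieces :: "(nat \<times> nat) set"
  where "pieces = (SIGMA i:{1..I}. {1..N i})"

definition piece :: "nat \<times> nat \<Rightarrow> real set"
  where "piece p = {tt (fst p) (snd p - 1)..tt (fst p) (snd p)}"

definition pc :: "(real \<Rightarrow> real) \<Rightarrow> nat \<times> nat \<Rightarrow> real poly"
  where "pc F p = lagrange_poly (Suc r) (nd (fst p) (snd p)) (\<lambda>k. F (nd (fst p) (snd p) k))"

lemma Union_pieces: "(\<Union>i\<in>{1..I}. {a i..b i}) = (\<Union>p\<in>pieces. piece p)"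
proof
  show "(\<Union>i\<in>{1..I}. {a i..b i}) \<subseteq> (\<Union>p\<in>pieces. piece p)"
  proof
    fix x assume "x \<in> (\<Union>i\<in>{1..I}. {a i..b i})"
    then obtain i j where ij: "i \<in> {1..I}" "j \<in> {1..N i}" "x \<in> {tt i (j - 1)..tt i j}"
      using find_piece by blast
    thus "x \<in> (\<Union>p\<in>pieces. piece p)"
      by (intro UN_I[of "(i, j)"]) (auto simp: pieces_def piece_def)
  qed
  show "(\<Union>p\<in>pieces. piece p) \<subseteq> (\<Union>i\<in>{1..I}. {a i..b i})"
  proof
    fix x assume "x \<in> (\<Union>p\<in>pieces. piece p)"
    then obtain i j where "i \<in> {1..I}" "j \<in> {1..N i}" "x \<in> {tt i (j - 1)..tt i j}"
      unfolding pieces_def piece_def by auto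
    thus "x \<in> (\<Union>i\<in>{1..I}. {a i..b i})" using piece_sub by blast
  qed
qed

text \<open>Distinct pieces meet only in a common end point within one interval. That point is a
  node of both, so both polynomials take the prescribed value there.\<close>

lemma pc_consistent:
  assumes "p \<in> pieces" "q \<in> pieces" "x \<in> piece p" "x \<in> piece q"
  shows "poly (pc F p) x = poly (pc F q) x"
proof -
  obtain i j where p: "p = (i, j)" by (cases p)
  obtain i' j' where q: "q = (i', j')" by (cases q)
  have ij: "i \<in> {1..I}" "j \<in> {1..N i}" "i' \<in> {1..I}" "j' \<in> {1..N i'}"
    using assms p q by (auto simp: pieces_def)
  have x: "x \<in> {tt i (j - 1)..tt i j}" "x \<in> {tt i' (j' - 1)..tt i' j'}" using assms p q by (auto simp: piece_def)
  have "x \<in> {a i..b i}" "x \<in> {a i'..b i'}" using x piece_sub ij by blast+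
  hence "\<not> i < i'" "\<not> i' < i" using gap_mono(2)[of i i'] gap_mono(2)[of i' i] ij by auto
  hence ii: "i = i'" by simp
  have adj: "poly (pc F (i, k)) x = poly (pc F (i, l)) x"
    if kl: "k \<in> {1..N i}" "l \<in> {1..N i}" "k < l" and xk: "x \<in> {tt i (k - 1)..tt i k}" "x \<in> {tt i (l - 1)..tt i l}" for k l
  proof -
    have "tt i k \<le> tt i (l - 1)" using kl by (intro tt_mono ij) auto
    hence xe: "x = tt i k" "x = tt i (l - 1)" using xk by auto
    have "poly (pc F (i, k)) (nd i k r) = F (nd i k r)" "poly (pc F (i, l)) (nd i l 0) = F (nd i l 0)"
      unfolding pc_def fst_conv snd_conv using poly_lagrange_poly_node[OF inj_nd[OF ij(1)]] by auto
    thus ?thesis using nd_ends[OF kl(1)] nd_ends[OF kl(2)] xe by simp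
  qed
  show ?thesis
    using adj[of j j'] adj[of j' j] ij x unfolding p q ii by (cases j j' rule: linorder_cases) auto
qed

text \<open>The predicate under the \<open>THE\<close> of \<open>interpolant\<close>, named so that
  existence and uniqueness can be argued separately.\<close>

definition itp_prop :: "(real \<Rightarrow> real) \<Rightarrow> (real \<Rightarrow> real) \<Rightarrow> bool"
  where "itp_prop F f \<longleftrightarrow> f \<in> cont_functions (\<Union>i\<in>{1..I}. {a i..b i}) \<and>
       (\<forall>i\<in>{1..I}. \<forall>j\<in>{1..N i}. \<exists>p :: real poly. degree p \<le> r \<and>
          (\<forall>k\<in>{0..r}. poly p (nd i j k) = F (nd i j k)) \<and>
          (\<forall>x\<in>{tt i (j - 1)..tt i j}. f x = poly p x))"

lemma itp_prop_eq:
  assumes "itp_prop F f" "p \<in> pieces" "x \<in> piece p"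
  shows "f x = poly (pc F p) x"
proof -
  obtain i j where p: "p = (i, j)" by (cases p)
  have ij: "i \<in> {1..I}" "j \<in> {1..N i}" using assms p by (auto simp: pieces_def)
  obtain q where q: "degree q \<le> r" "\<forall>k\<in>{0..r}. poly q (nd i j k) = F (nd i j k)" "f x = poly q x"
    using assms(1,3) ij p unfolding itp_prop_def piece_def by force
  have "q = pc F p"
  proof (rule poly_eq_if_nodes_agree[OF inj_nd[OF ij(1), of j]])
    show "degree (pc F p) \<le> Suc r - 1" unfolding pc_def by (rule degree_lagrange_poly)
    show "poly q (nd i j k) = poly (pc F p) (nd i j k)" if "k < Suc r" for k
      using that q(2) poly_lagrange_poly_node[OF inj_nd[OF ij(1)] that] by (simp add: pc_def p)
  qed (use q(1) in auto)
  thus ?thesis using q(3) by simp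
qed

text \<open>The consistent polynomials glue to a continuous function on a finite union of closed
  pieces. Uniqueness on the pieces suffices since the candidates are extensional.\<close>

lemma itp_prop_interpolant: "itp_prop F (itp F)"
proof -
  define f where "f = (\<lambda>x\<in>(\<Union>p\<in>pieces. piece p). poly (pc F (SOME p. p \<in> pieces \<and> x \<in> piece p)) x)"
  have f_eq: "f x = poly (pc F p) x" if "p \<in> pieces" "x \<in> piece p" for p x
  proof -
    have "\<exists>p. p \<in> pieces \<and> x \<in> piece p" using that by blast
    from someI_ex[OF this] have "poly (pc F (SOME p. p \<in> pieces \<and> x \<in> piece p)) x = poly (pc F p) x"
      using that by (intro pc_consistent) auto
    thus ?thesis using that unfolding f_def by auto
  qed
  have fin: "finite pieces" by (simp add: pieces_def)
  have "continuous_on (\<Union>p\<in>pieces. piece p) f"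
  proof (rule continuous_on_closed_Union[OF fin])
    show "closed (piece p)" for p by (simp add: piece_def)
    show "continuous_on (piece p) f" if "p \<in> pieces" for p
    proof (rule continuous_on_eq)
      show "continuous_on (piece p) (\<lambda>x. poly (pc F p) x)" by (intro continuous_intros)
      show "poly (pc F p) x = f x" if "x \<in> piece p" for x using f_eq[OF \<open>p \<in> pieces\<close> that] by simp
    qed
  qed
  hence "f \<in> cont_functions (\<Union>i\<in>{1..I}. {a i..b i})"
    unfolding Union_pieces cont_functions_def by (simp add: f_def)
  moreover have "\<exists>p :: real poly. degree p \<le> r \<and> (\<forall>k\<in>{0..r}. poly p (nd i j k) = F (nd i j k)) \<and>
          (\<forall>x\<in>{tt i (j - 1)..tt i j}. f x = poly p x)" if ij: "i \<in> {1..I}" "j \<in> {1..N i}" for i j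
  proof (intro exI[of _ "pc F (i, j)"] conjI ballI)
    show "degree (pc F (i, j)) \<le> r" unfolding pc_def using degree_lagrange_poly[of "Suc r"] by simp
    show "poly (pc F (i, j)) (nd i j k) = F (nd i j k)" if "k \<in> {0..r}" for k
      using that poly_lagrange_poly_node[OF inj_nd[OF ij(1)], of k j] by (simp add: pc_def)
    show "f x = poly (pc F (i, j)) x" if "x \<in> {tt i (j - 1)..tt i j}" for x
      using that ij by (intro f_eq) (auto simp: pieces_def piece_def)
  qed
  ultimately have "itp_prop F f" unfolding itp_prop_def by blast
  moreover have "g = f" if "itp_prop F g" for g
  proof (rule extensionalityI[of _ "\<Union>p\<in>pieces. piece p"])
    show "g \<in> extensional (\<Union>p\<in>pieces. piece p)" "f \<in> extensional (\<Union>p\<in>pieces. piece p)"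
      using that \<open>itp_prop F f\<close> unfolding itp_prop_def Union_pieces cont_functions_def by auto
    show "g x = f x" if "x \<in> (\<Union>p\<in>pieces. piece p)" for x
      using that itp_prop_eq[OF \<open>itp_prop F g\<close>] f_eq by auto
  qed
  ultimately have "itp_prop F (THE f. itp_prop F f)" by (rule theI)
  thus ?thesis unfolding interpolant_def itp_prop_def .
qed

lemma itp_eq_poly:
  assumes "i \<in> {1..I}" "j \<in> {1..N i}" "x \<in> {tt i (j - 1)..tt i j}"
  shows "itp F x = poly (lagrange_poly (Suc r) (piece_node r (tt i (j - 1)) (hh i)) (\<lambda>k. F (nd i j k))) x"
  using itp_prop_eq[OF itp_prop_interpolant, of "(i, j)" x F] assms
  by (simp add: pieces_def piece_def pc_def nd_eq)

lemma itp_eq_sum: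
  assumes "i \<in> {1..I}" "j \<in> {1..N i}" "x \<in> {tt i (j - 1)..tt i j}"
  shows "itp F x = (\<Sum>k<Suc r. F (nd i j k) * lagrange (Suc r) (piece_node r (tt i (j - 1)) (hh i)) k x)"
  unfolding itp_eq_poly[OF assms] poly_lagrange_poly ..

lemma itp_cong:
  assumes "\<And>x. x \<in> T \<Longrightarrow> F x = G x" "i \<in> {1..I}" "x \<in> {a i..b i}"
  shows "itp F x = itp G x"
proof -
  obtain j where j: "j \<in> {1..N i}" "x \<in> {tt i (j - 1)..tt i j}" using find_piece[OF assms(2,3)] by blast
  show ?thesis unfolding itp_eq_sum[OF assms(2) j]
    using assms(1) nd_in_T[OF assms(2) j(1)] by (intro sum.cong) auto
qed

lemma itp_lin:
  assumes "i \<in> {1..I}" "x \<in> {a i..b i}"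
  shows "itp (\<lambda>y. c * F y + d * G y) x = c * itp F x + d * itp G x"
proof -
  obtain j where j: "j \<in> {1..N i}" "x \<in> {tt i (j - 1)..tt i j}" using find_piece[OF assms] by blast
  show ?thesis unfolding itp_eq_sum[OF assms(1) j] sum_distrib_left sum.distrib[symmetric]
    by (intro sum.cong) (auto simp: algebra_simps)
qed

lemma itp_bound:
  assumes "i \<in> {1..I}" "x \<in> {a i..b i}" "\<And>y. y \<in> T \<Longrightarrow> \<bar>F y\<bar> \<le> K"
  shows "\<bar>itp F x\<bar> \<le> psi r * K"
proof -
  obtain j where j: "j \<in> {1..N i}" "x \<in> {tt i (j - 1)..tt i j}" using find_piece[OF assms(1,2)] by blast
  have x: "x \<in> {tt i (j - 1)..tt i (j - 1) + hh i}" using j tt_pred[of j i] by auto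
  have K0: "0 \<le> K" using assms(3)[OF nd_in_T[OF assms(1) j(1), of 0]] by (meson abs_ge_zero order_trans zero_le)
  let ?l = "\<lambda>k. lagrange (Suc r) (piece_node r (tt i (j - 1)) (hh i)) k x"
  have "\<bar>itp F x\<bar> \<le> (\<Sum>k<Suc r. \<bar>F (nd i j k) * ?l k\<bar>)"
    unfolding itp_eq_sum[OF assms(1) j] by (rule sum_abs)
  also have "\<dots> \<le> (\<Sum>k<Suc r. K * \<bar>?l k\<bar>)"
    unfolding abs_mult using assms(3) nd_in_T[OF assms(1) j(1)] by (intro sum_mono mult_right_mono) auto
  also have "\<dots> = K * (\<Sum>k<Suc r. \<bar>?l k\<bar>)" by (rule sum_distrib_left[symmetric])
  also have "\<dots> \<le> K * psi r"
    using K0 by (intro mult_left_mono piece_Lebesgue[OF r hh_pos[OF assms(1)] x])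
  finally show ?thesis by (simp add: mult.commute)
qed

lemma T_finite: "finite T"
proof -
  have "T \<subseteq> (\<Union>i\<in>{1..I}. \<Union>j\<in>{1..N i}. nd i j ` {0..r})" unfolding mesh_T_def by blast
  thus ?thesis by (rule finite_subset) auto
qed

lemma T_ne: "T \<noteq> {}"
  using nd_in_T[of 1 1 0] I N[of 1] by (auto simp: Suc_le_eq)

lemma T_cases:
  assumes "x \<in> T"
  obtains i j k where "i \<in> {1..I}" "j \<in> {1..N i}" "k \<le> r" "x = nd i j k"
  using assms unfolding mesh_T_def by auto

lemma T_sub:
  assumes "x \<in> T"
  shows "\<exists>i\<in>{1..I}. x \<in> {a i..b i}"
  using assms nd_in piece_sub by (elim T_cases) blast

text \<open>Within a piece the nodes are separated by their own spacing, between intervals by the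
  assumed gaps. In distinct pieces of one interval a break point between the two points, itself a
  node, reduces the claim to a single piece.\<close>

lemma T_spacing:
  assumes d: "\<And>i. i \<in> {1..I} \<Longrightarrow> d \<le> 2 * (sin (pi / (2 * real r + 2)))\<^sup>2 * hh i"
    and dg: "\<And>i. i \<in> {1..<I} \<Longrightarrow> d \<le> a (i + 1) - b i"
    and xy: "x \<in> T" "y \<in> T" "x < y"
  shows "d \<le> y - x"
proof -
  obtain i j k where x: "i \<in> {1..I}" "j \<in> {1..N i}" "k \<le> r" "x = nd i j k" using xy(1) by (elim T_cases)
  obtain i' j' k' where y: "i' \<in> {1..I}" "j' \<in> {1..N i'}" "k' \<le> r" "y = nd i' j' k'" using xy(2) by (elim T_cases)
  have xI: "x \<in> {tt i (j - 1)..tt i j}" "x \<in> {a i..b i}" using nd_in[OF x(1,2,3)] piece_sub[OF x(1,2)] x(4) by auto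
  have yI: "y \<in> {tt i' (j' - 1)..tt i' j'}" "y \<in> {a i'..b i'}" using nd_in[OF y(1,2,3)] piece_sub[OF y(1,2)] y(4) by auto
  have same: "d \<le> nd i l m' - nd i l m" if "nd i l m < nd i l m'" "m \<le> r" "m' \<le> r" "i \<in> {1..I}" for i l m m'
  proof -
    have h: "0 < hh i" using hh_pos that by blast
    have "m < m'"
      using that(1,2) piece_node_less[OF r _ _ h, of m' m "tt i (l - 1)"] unfolding nd_eq
      by (cases m m' rule: linorder_cases) auto
    thus ?thesis using piece_node_spacing[OF r _ that(3) h, of m "tt i (l - 1)"] d[OF that(4)] unfolding nd_eq by simp
  qed
  have dh: "d \<le> hh i" if "i \<in> {1..I}" for i
  proof -
    have "2 * (sin (pi / (2 * real r + 2)))\<^sup>2 * hh i \<le> 1 * hh i"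
      using phi_bounds(5)[OF r] hh_pos[OF that] by (intro mult_right_mono) auto
    thus ?thesis using d[OF that] by simp
  qed
  show ?thesis
  proof (cases "i = i'")
    case False
    have "i < i'"
    proof (rule ccontr)
      assume "\<not> i < i'"
      hence "b i' < a i" using gap_mono(2)[OF y(1) x(1)] False by simp
      thus False using xI yI xy(3) by auto
    qed
    hence "a (i + 1) \<le> a i'" "i \<in> {1..<I}" using gap_mono(1)[OF x(1) y(1)] x(1) y(1) by auto
    thus ?thesis using dg[of i] xI yI by auto
  next
    case True
    note y = y[folded True] and yI = yI[folded True]
    show ?thesis
    proof (cases j j' rule: linorder_cases)
      case equal
      thus ?thesis using same[of i j k k'] x y xy(3) by simp
    next
      case greater
      have "tt i j' \<le> tt i (j - 1)" using greater by (intro tt_mono x) auto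
      thus ?thesis using xI yI xy(3) by auto
    next
      case less
      have le: "tt i j \<le> tt i (j' - 1)" using less by (intro tt_mono x) auto
      show ?thesis
      proof (cases "x = tt i j")
        case False
        hence "nd i j k < nd i j r" using nd_ends(2)[OF x(2)] xI x(4) by auto
        from same[OF this x(3) _ x(1)] have "d \<le> tt i j - x" using nd_ends(2)[OF x(2)] x(4) by simp
        thus ?thesis using le yI by auto
      next
        case xt: True
        \<comment> \<open>Here x is also the first node of the next piece. If y lies in a later one,
          a full subinterval separates the points.\<close>
        show ?thesis
        proof (cases "j' = Suc j")
          case True
          hence "nd i j' 0 < nd i j' k'" using nd_ends(1)[OF y(2)] xt y(4) xy(3) by simp
          from same[OF this _ y(3) x(1)] show ?thesis using nd_ends(1)[OF y(2)] xt y(4) True by simp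
        next
          case False
          hence "tt i (Suc j) \<le> tt i (j' - 1)" using less by (intro tt_mono x) auto
          thus ?thesis using yI dh[OF x(1)] tt_Suc[of i j] xt by auto
        qed
      qed
    qed
  qed
qed

text \<open>Log-Lipschitz bounds multiply along ordered points, so the estimate for one piece is
  chained through the break points. This is possible only inside one interval, where the pieces are
  contiguous.\<close>

lemma itp_log_lip:
  assumes i: "i \<in> {1..I}" and F: "F \<in> log_lip_cone T M" and M: "0 < M"
    and u: "u = M * eta r * hh i" "psi r * u * exp u < 1"
    and K: "M * (2 * eta r * (real r)\<^sup>2 * psi r) * exp u / (1 - psi r * u * exp u) \<le> K"
    and x: "x \<in> {a i..b i}" and y: "y \<in> {a i..b i}"
  shows "itp F x \<le> exp (K * \<bar>x - y\<bar>) * itp F y"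
proof -
  have nn: "0 \<le> F (nd i j k)" if "j \<in> {1..N i}" "k \<le> r" for j k
    using log_lip_coneD(2)[OF F nd_in_T[OF i that]] .
  have one: "itp F x \<le> exp (K * \<bar>x - y\<bar>) * itp F y"
    if j: "j \<in> {1..N i}" and x: "x \<in> {tt i (j - 1)..tt i j}" and y: "y \<in> {tt i (j - 1)..tt i j}" for j x y
    unfolding itp_eq_poly[OF i j x] itp_eq_poly[OF i j y]
  proof (rule piece_log_lip[OF r hh_pos[OF i] M _ _ u refl _ _ K])
    show "F (nd i j k) \<le> exp (M * \<bar>piece_node r (tt i (j - 1)) (hh i) k - piece_node r (tt i (j - 1)) (hh i) l\<bar>) * F (nd i j l)"
      if "k \<le> r" "l \<le> r" for k l
      using log_lip_coneD(3)[OF F nd_in_T[OF i j that(1)] nd_in_T[OF i j that(2)]] by (simp add: nd_eq)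
  qed (use x y nn j tt_pred[of j i] in auto)
  have "itp F x \<le> exp (K * \<bar>x - y\<bar>) * itp F y" if "l \<le> N i" "x \<in> {tt i 0..tt i l}" "y \<in> {tt i 0..tt i l}" for l x y
    using that
  proof (induction l arbitrary: x y)
    case 0
    hence "x = tt i 0" "y = tt i 0" by auto
    thus ?case by simp
  next
    case (Suc l)
    have jS: "Suc l \<in> {1..N i}" using Suc.prems by simp
    have tin: "tt i l \<in> {tt i 0..tt i l}" "tt i l \<in> {tt i (Suc l - 1)..tt i (Suc l)}"
      using tt_mono[OF i, of 0 l] tt_mono[OF i, of l "Suc l"] by auto
    have chain: "itp F v \<le> exp (K * \<bar>v - w\<bar>) * itp F w"
      if "itp F v \<le> exp (K * \<bar>v - tt i l\<bar>) * itp F (tt i l)" "itp F (tt i l) \<le> exp (K * \<bar>tt i l - w\<bar>) * itp F w"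
        "\<bar>v - w\<bar> = \<bar>v - tt i l\<bar> + \<bar>tt i l - w\<bar>" for v w
    proof -
      have "exp (K * \<bar>v - tt i l\<bar>) * itp F (tt i l)
          \<le> exp (K * \<bar>v - tt i l\<bar>) * (exp (K * \<bar>tt i l - w\<bar>) * itp F w)"
        using that(2) by (intro mult_left_mono) auto
      also have "\<dots> = exp (K * \<bar>v - w\<bar>) * itp F w"
        unfolding that(3) by (simp add: distrib_left exp_add)
      finally show ?thesis using that(1) by linarith
    qed
    consider "x \<le> tt i l" "y \<le> tt i l" | "x \<le> tt i l" "tt i l \<le> y" | "tt i l \<le> x" "y \<le> tt i l" | "tt i l \<le> x" "tt i l \<le> y"
      by linarith
    thus ?case
    proof cases
      case 1
      thus ?thesis using Suc by (intro Suc.IH) auto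
    next
      case 2
      have "itp F x \<le> exp (K * \<bar>x - tt i l\<bar>) * itp F (tt i l)"
        by (rule Suc.IH) (use Suc.prems 2 tin in auto)
      moreover have "itp F (tt i l) \<le> exp (K * \<bar>tt i l - y\<bar>) * itp F y"
        by (rule one[OF jS tin(2)]) (use Suc.prems 2 in auto)
      ultimately show ?thesis by (rule chain) (use 2 in auto)
    next
      case 3
      have "itp F x \<le> exp (K * \<bar>x - tt i l\<bar>) * itp F (tt i l)"
        by (rule one[OF jS _ tin(2)]) (use Suc.prems 3 in auto)
      moreover have "itp F (tt i l) \<le> exp (K * \<bar>tt i l - y\<bar>) * itp F y"
        by (rule Suc.IH) (use Suc.prems 3 tin in auto)
      ultimately show ?thesis by (rule chain) (use 3 in auto)
    next
      case 4
      thus ?thesis using Suc.prems by (intro one[OF jS]) auto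
    qed
  qed
  from this[of "N i" x y] show ?thesis using x y tt_0[of i] tt_N[OF i] by simp
qed

lemma itp_lower_bound:
  assumes i: "i \<in> {1..I}" and F: "F \<in> log_lip_cone T M" and M: "0 < M"
    and u: "u = M * eta r * hh i" "psi r * u * exp u < 1" and x: "x \<in> {a i..b i}"
  shows "\<exists>y\<in>T. (1 - psi r * u * exp u) * F y \<le> itp F x"
proof -
  obtain j where j: "j \<in> {1..N i}" "x \<in> {tt i (j - 1)..tt i j}" using find_piece[OF i x] by blast
  have "(1 - psi r * u * exp u) * F (nd i j (r div 2)) \<le> itp F x"
    unfolding itp_eq_poly[OF i j]
  proof (rule piece_lower_bound[OF r hh_pos[OF i] M _ _ u refl])
    show "0 \<le> F (nd i j k)" if "k \<le> r" for k
      using log_lip_coneD(2)[OF F nd_in_T[OF i j(1) that]] .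
    show "F (nd i j k) \<le> exp (M * \<bar>piece_node r (tt i (j - 1)) (hh i) k - piece_node r (tt i (j - 1)) (hh i) l\<bar>) * F (nd i j l)"
      if "k \<le> r" "l \<le> r" for k l
      using log_lip_coneD(3)[OF F nd_in_T[OF i j(1) that(1)] nd_in_T[OF i j(1) that(2)]] by (simp add: nd_eq)
    show "x \<in> {tt i (j - 1)..tt i (j - 1) + hh i}" using j tt_pred[of j i] by auto
  qed
  thus ?thesis using nd_in_T[OF i j(1), of "r div 2"] by auto
qed

end

section \<open>The discretized operator\<close>

lemma less_1_of_square_le:
  fixes e :: real
  assumes "e\<^sup>2 \<le> 2 / 3"
  shows "e < 1"
proof (rule ccontr)
  assume "\<not> e < 1"
  hence "1\<^sup>2 \<le> e\<^sup>2" by (intro power_mono) auto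
  thus False using assms by simp
qed

text \<open>The derivative of the difference of the two sides is 2x^2 (2 - 3x^2) / (1 - x^2),
  nonnegative up to x^2 = 2/3.\<close>

lemma ln_ratio_le:
  fixes e :: real
  assumes "0 \<le> e" "e\<^sup>2 \<le> 2 / 3"
  shows "ln ((1 + e) / (1 - e)) \<le> 2 * e * (1 + e\<^sup>2)"
proof -
  have e1: "e < 1" by (rule less_1_of_square_le[OF assms(2)])
  define g where "g x = 2 * x * (1 + x\<^sup>2) - (ln (1 + x) - ln (1 - x))" for x :: real
  have "g 0 \<le> g e"
  proof (rule DERIV_nonneg_imp_nondecreasing[OF assms(1)])
    fix x assume x: "0 \<le> x" "x \<le> e"
    have x1: "0 < 1 + x" "0 < 1 - x" using x e1 by auto
    have d: "(g has_real_derivative (2 + 6 * x\<^sup>2 - (1 / (1 + x) + 1 / (1 - x)))) (at x)"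
      unfolding g_def using x1 by (auto intro!: derivative_eq_intros simp: power2_eq_square algebra_simps)
    have "x\<^sup>2 \<le> 2 / 3" using power_mono[OF x(2,1), of 2] assms(2) by simp
    hence "0 \<le> 2 * (x\<^sup>2 * (2 - 3 * x\<^sup>2)) / ((1 + x) * (1 - x))" using x1 by auto
    also have "\<dots> = 2 + 6 * x\<^sup>2 - (1 / (1 + x) + 1 / (1 - x))"
      using x1 by (simp add: divide_simps power2_eq_square) (simp add: algebra_simps)
    finally show "\<exists>y. (g has_real_derivative y) (at x) \<and> 0 \<le> y" using d by blast
  qed
  thus ?thesis using assms e1 by (simp add: g_def ln_div)
qed

text \<open>The perturbation multiplies a ratio of two values by at most (1 + \<epsilon>)/(1 -
  \<epsilon>), whose logarithm is at most 2\<epsilon> (1 + \<epsilon>^2). For distinct points this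
  is at most q (1 + h^2) times their distance; the exponent q of \<open>v\<close> itself completes q
  (2 + h^2).\<close>

lemma log_lip_cone_perturb:
  assumes v: "v \<in> log_lip_cone T q" and T: "finite T" and q: "0 \<le> q"
    and e: "\<And>x. x \<in> T \<Longrightarrow> \<bar>e x\<bar> \<le> \<epsilon> * v x" and \<epsilon>: "0 \<le> \<epsilon>" "\<epsilon> \<le> h" "\<epsilon>\<^sup>2 \<le> 2 / 3"
    and d: "\<And>x y. x \<in> T \<Longrightarrow> y \<in> T \<Longrightarrow> x \<noteq> y \<Longrightarrow> 2 * \<epsilon> \<le> q * \<bar>x - y\<bar>"
    and M: "q * (2 + h\<^sup>2) \<le> M"
  shows "(\<lambda>x. v x + e x) \<in> log_lip_cone T M"
proof (rule log_lip_coneI)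
  have \<epsilon>1: "\<epsilon> < 1" by (rule less_1_of_square_le[OF \<epsilon>(3)])
  have b: "(1 - \<epsilon>) * v x \<le> v x + e x \<and> v x + e x \<le> (1 + \<epsilon>) * v x" if "x \<in> T" for x
    using e[OF that] by (simp add: abs_le_iff algebra_simps)
  have vn: "0 \<le> v x" if "x \<in> T" for x by (rule log_lip_coneD(2)[OF v that])
  show "continuous_on T (\<lambda>x. v x + e x)" using T by (rule continuous_on_finite)
  show nn: "0 \<le> v x + e x" if "x \<in> T" for x
    using b[OF that] mult_nonneg_nonneg[of "1 - \<epsilon>" "v x"] vn[OF that] \<epsilon>1 by linarith
  fix x y assume x: "x \<in> T" and y: "y \<in> T"
  show "v x + e x \<le> exp (M * \<bar>x - y\<bar>) * (v y + e y)"
  proof (cases "x = y")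
    case False
    define t where "t = q * \<bar>x - y\<bar>"
    have t: "2 * \<epsilon> \<le> t" using d[OF x y False] by (simp add: t_def)
    have "ln ((1 + \<epsilon>) / (1 - \<epsilon>)) \<le> 2 * \<epsilon> * (1 + \<epsilon>\<^sup>2)" by (rule ln_ratio_le[OF \<epsilon>(1,3)])
    also have "\<dots> \<le> t * (1 + h\<^sup>2)"
      using t \<epsilon> power_mono[OF \<epsilon>(2,1), of 2] by (intro mult_mono) auto
    finally have "exp (ln ((1 + \<epsilon>) / (1 - \<epsilon>))) \<le> exp (t * (1 + h\<^sup>2))" by simp
    hence "1 + \<epsilon> \<le> exp (t * (1 + h\<^sup>2)) * (1 - \<epsilon>)" using \<epsilon> \<epsilon>1 by (simp add: field_simps)
    hence "(1 + \<epsilon>) * v x \<le> exp (t * (1 + h\<^sup>2)) * (1 - \<epsilon>) * v x" using vn[OF x] by (rule mult_right_mono)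
    also have "\<dots> \<le> exp (t * (1 + h\<^sup>2)) * (1 - \<epsilon>) * (exp t * v y)"
      using log_lip_coneD(3)[OF v x y] \<epsilon>1 by (intro mult_left_mono) (auto simp: t_def)
    also have "\<dots> = exp (t * (2 + h\<^sup>2)) * ((1 - \<epsilon>) * v y)"
    proof -
      have "exp (t * (2 + h\<^sup>2)) = exp (t * (1 + h\<^sup>2)) * exp t"
        unfolding exp_add[symmetric] by (simp add: algebra_simps)
      thus ?thesis by simp
    qed
    also have "\<dots> \<le> exp (t * (2 + h\<^sup>2)) * (v y + e y)" using b[OF y] by (intro mult_left_mono) auto
    also have "\<dots> \<le> exp (M * \<bar>x - y\<bar>) * (v y + e y)"
    proof (rule mult_right_mono[OF _ nn[OF y]])
      have "q * (2 + h\<^sup>2) * \<bar>x - y\<bar> \<le> M * \<bar>x - y\<bar>" using M by (rule mult_right_mono) simp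
      thus "exp (t * (2 + h\<^sup>2)) \<le> exp (M * \<bar>x - y\<bar>)" by (simp add: t_def mult_ac)
    qed
    finally show ?thesis using b[OF x] by linarith
  qed simp
qed

locale discretization = ifs B \<gamma> \<Gamma> s + mesh r I a b N
  for B \<gamma> \<Gamma> s r I a b N +
  fixes \<nu> :: nat
  assumes nu: "1 \<le> \<nu>"
    and sub: "\<And>i. i \<in> {1..I} \<Longrightarrow> {a i..b i} \<subseteq> S_interval \<gamma> \<Gamma>"
    and inv: "\<And>\<omega>. \<omega> \<in> words B \<nu> \<Longrightarrow> \<exists>i\<in>{1..I}. theta_word \<omega> ` S_interval \<gamma> \<Gamma> \<subseteq> {a i..b i}"
begin

abbreviation "Ld \<equiv> L_disc B s \<nu> r I a b N"

lemma T_sub_S: "x \<in> T \<Longrightarrow> x \<in> S"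
  using T_sub sub by blast

lemma word_props:
  assumes "\<omega> \<in> words B \<nu>"
  shows "set \<omega> \<subseteq> B" "\<omega> \<noteq> []" "length \<omega> = \<nu>"
  using assms nu by (auto simp: words_def)

lemma word_image: "\<omega> \<in> words B \<nu> \<Longrightarrow> x \<in> T \<Longrightarrow> \<exists>i\<in>{1..I}. theta_word \<omega> x \<in> {a i..b i}"
  using inv[of \<omega>] T_sub_S[of x] by blast

lemma words_ne: "words B \<nu> \<noteq> {}"
proof -
  obtain \<beta> where "\<beta> \<in> B" using ne by blast
  hence "replicate \<nu> \<beta> \<in> words B \<nu>" by (auto simp: words_def)
  thus ?thesis by blast
qed

lemma Ld_eq: "x \<in> T \<Longrightarrow> Ld F x = (\<Sum>\<omega>\<in>words B \<nu>. g_word \<omega> x powr s * itp F (theta_word \<omega> x))"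
  by (simp add: L_disc_def)

lemma Ld_field_operator: "\<exists>C. field_operator T Ld C"
proof -
  define C where "C = (\<Sum>x\<in>T. \<Sum>\<omega>\<in>words B \<nu>. g_word \<omega> x powr s) * psi r"
  have psi0: "0 \<le> psi r" using psi_ge_1[of r] r by simp
  have "field_operator T Ld C"
  proof
    show "compact T" "T \<noteq> {}" using T_finite T_ne by (auto intro: finite_imp_compact)
    show "Ld f = Ld g" if fg: "\<And>x. x \<in> T \<Longrightarrow> f x = g x" for f g
    proof -
      have "itp f (theta_word \<omega> x) = itp g (theta_word \<omega> x)" if wx: "\<omega> \<in> words B \<nu>" "x \<in> T" for \<omega> x
      proof -
        obtain i where i: "i \<in> {1..I}" "theta_word \<omega> x \<in> {a i..b i}" using word_image[OF wx] by blast
        show ?thesis by (rule itp_cong[OF fg i])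
      qed
      thus ?thesis unfolding L_disc_def by (intro restrict_ext sum.cong) auto
    qed
    show "continuous_on T (Ld f)" for f using T_finite by (rule continuous_on_finite)
    show "Ld (\<lambda>y. c * f y + d * g y) x = c * Ld f x + d * Ld g x" if x: "x \<in> T" for f g c d x
    proof -
      have "itp (\<lambda>y. c * f y + d * g y) (theta_word \<omega> x) = c * itp f (theta_word \<omega> x) + d * itp g (theta_word \<omega> x)"
        if "\<omega> \<in> words B \<nu>" for \<omega>
        using word_image[OF that x] itp_lin by blast
      thus ?thesis unfolding Ld_eq[OF x]
        by (simp add: sum_distrib_left algebra_simps flip: sum.distrib cong: sum.cong)
    qed
    show "norm (Ld f x) \<le> C * K" if K: "\<And>y. y \<in> T \<Longrightarrow> norm (f y) \<le> K" and x: "x \<in> T" for f K x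
    proof -
      have K0: "0 \<le> K" using K[OF x] norm_ge_zero order_trans by blast
      have "norm (Ld f x) \<le> (\<Sum>\<omega>\<in>words B \<nu>. g_word \<omega> x powr s * (psi r * K))"
        unfolding Ld_eq[OF x]
      proof (rule sum_norm_le)
        fix \<omega> assume "\<omega> \<in> words B \<nu>"
        hence "\<bar>itp f (theta_word \<omega> x)\<bar> \<le> psi r * K"
          using word_image[OF _ x, of \<omega>] itp_bound[of _ _ f K] K by auto
        thus "norm (g_word \<omega> x powr s * itp f (theta_word \<omega> x)) \<le> g_word \<omega> x powr s * (psi r * K)"
          by (simp add: abs_mult mult_left_mono)
      qed
      also have "\<dots> = (\<Sum>\<omega>\<in>words B \<nu>. g_word \<omega> x powr s) * (psi r * K)" by (rule sum_distrib_right[symmetric])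
      also have "\<dots> \<le> (\<Sum>x\<in>T. \<Sum>\<omega>\<in>words B \<nu>. g_word \<omega> x powr s) * (psi r * K)"
        using psi0 K0 T_finite x
        by (intro mult_right_mono member_le_sum[of x T "\<lambda>x. \<Sum>\<omega>\<in>words B \<nu>. g_word \<omega> x powr s"])
          (auto intro: sum_nonneg)
      finally show ?thesis by (simp add: C_def mult.assoc)
    qed
  qed
  thus ?thesis by blast
qed

text \<open>The hidden positivity: although \<open>Ld\<close> has entries of both signs, it maps a cone of
  log-Lipschitz functions into a smaller one.\<close>

lemma Ld_cone_operator:
  fixes M \<kappa>2 :: real
  assumes M: "0 < M" and \<kappa>: "0 \<le> \<kappa>2" "\<kappa>2 < 1"
    and small: "\<And>i u. i \<in> {1..I} \<Longrightarrow> u = M * eta r * hh i \<Longrightarrow> psi r * u * exp u < 1 \<and>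
      kappa1 \<gamma> \<Gamma> \<nu> r * exp u / (1 - psi r * u * exp u) \<le> \<kappa>2 - s * M0_const \<gamma> \<Gamma> \<nu> / M"
  shows "\<exists>C. cone_operator T Ld C M (\<kappa>2 * M)"
proof -
  obtain C where C: "field_operator T Ld C" using Ld_field_operator by blast
  interpret A: field_operator T Ld C by (rule C)
  have "cone_operator T Ld C M (\<kappa>2 * M)"
  proof
    show "0 \<le> \<kappa>2 * M" "\<kappa>2 * M < M" using M \<kappa> by auto
    fix F assume F: "F \<in> log_lip_cone T M"
    have step: "itp F (theta_word \<omega> x) \<le> exp ((\<kappa>2 * M - s * M0_const \<gamma> \<Gamma> \<nu>) * \<bar>x - y\<bar>) * itp F (theta_word \<omega> y)
        \<and> 0 \<le> itp F (theta_word \<omega> y)"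
      if w: "\<omega> \<in> words B \<nu>" and x: "x \<in> T" and y: "y \<in> T" for \<omega> x y
    proof -
      obtain i where i: "i \<in> {1..I}" "theta_word \<omega> ` S \<subseteq> {a i..b i}" using inv[OF w] by blast
      have tw: "theta_word \<omega> z \<in> {a i..b i}" if "z \<in> T" for z using i(2) T_sub_S[OF that] by blast
      define u where "u = M * eta r * hh i"
      note sm = small[OF i(1) u_def]
      define K where "K = M * (2 * eta r * (real r)\<^sup>2 * psi r) * exp u / (1 - psi r * u * exp u)"
      have lip: "itp F z \<le> exp (K * \<bar>z - z'\<bar>) * itp F z'" if "z \<in> {a i..b i}" "z' \<in> {a i..b i}" for z z'
        by (rule itp_log_lip[OF i(1) F M u_def _ _ that]) (use sm in \<open>auto simp: K_def\<close>)
      have psi0: "0 \<le> psi r" using psi_ge_1[of r] r by simp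
      have K0: "0 \<le> K" unfolding K_def using M eta_pos[OF r] psi0 sm by simp
      have nn: "0 \<le> itp F z" if z: "z \<in> {a i..b i}" for z
      proof -
        obtain y where y: "y \<in> T" "(1 - psi r * u * exp u) * F y \<le> itp F z"
          using itp_lower_bound[OF i(1) F M u_def _ z] sm by blast
        have "0 \<le> (1 - psi r * u * exp u) * F y" using sm log_lip_coneD(2)[OF F y(1)] by simp
        thus ?thesis using y(2) by linarith
      qed
      \<comment> \<open>The contraction of the word turns the constant of the interpolant into M
        times the expression in \<kappa>1. The smallness assumption leaves exactly s *
        \<open>M0_const\<close> for the distortion of the weights.\<close>
      have c0: "c_const \<gamma> \<Gamma> \<nu> * K \<le> \<kappa>2 * M - s * M0_const \<gamma> \<Gamma> \<nu>"
      proof -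
        have "c_const \<gamma> \<Gamma> \<nu> * K = M * (kappa1 \<gamma> \<Gamma> \<nu> r * exp u / (1 - psi r * u * exp u))"
          by (simp add: K_def kappa1_def)
        also have "\<dots> \<le> M * (\<kappa>2 - s * M0_const \<gamma> \<Gamma> \<nu> / M)" using sm M by (intro mult_left_mono) auto
        also have "\<dots> = \<kappa>2 * M - s * M0_const \<gamma> \<Gamma> \<nu>" using M by (simp add: right_diff_distrib mult.commute)
        finally show ?thesis .
      qed
      have "K * \<bar>theta_word \<omega> x - theta_word \<omega> y\<bar> \<le> K * (c_const \<gamma> \<Gamma> \<nu> * \<bar>x - y\<bar>)"
        using theta_word_contraction[OF word_props(1,2)[OF w] T_sub_S[OF x] T_sub_S[OF y]] word_props(3)[OF w] K0
        by (intro mult_left_mono) auto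
      also have "\<dots> \<le> (\<kappa>2 * M - s * M0_const \<gamma> \<Gamma> \<nu>) * \<bar>x - y\<bar>"
        using mult_right_mono[OF c0, of "\<bar>x - y\<bar>"] by (simp add: mult_ac)
      finally have "exp (K * \<bar>theta_word \<omega> x - theta_word \<omega> y\<bar>) \<le> exp ((\<kappa>2 * M - s * M0_const \<gamma> \<Gamma> \<nu>) * \<bar>x - y\<bar>)"
        by simp
      from order_trans[OF lip[OF tw[OF x] tw[OF y]] mult_right_mono[OF this nn[OF tw[OF y]]]]
      show ?thesis using nn[OF tw[OF y]] by simp
    qed
    show "Ld F \<in> log_lip_cone T (\<kappa>2 * M)"
    proof (rule log_lip_coneI)
      show "continuous_on T (Ld F)" using T_finite by (rule continuous_on_finite)
      show "0 \<le> Ld F x" if x: "x \<in> T" for x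
        unfolding Ld_eq[OF x] using step[OF _ x x] by (intro sum_nonneg mult_nonneg_nonneg) auto
      fix x y assume x: "x \<in> T" and y: "y \<in> T"
      show "Ld F x \<le> exp (\<kappa>2 * M * \<bar>x - y\<bar>) * Ld F y"
        unfolding Ld_eq[OF x] Ld_eq[OF y] sum_distrib_left
      proof (rule sum_mono)
        fix \<omega> assume w: "\<omega> \<in> words B \<nu>"
        have "g_word \<omega> x powr s \<le> exp (s * M0_const \<gamma> \<Gamma> \<nu> * \<bar>x - y\<bar>) * g_word \<omega> y powr s"
          using g_word_distortion[OF word_props(1,2)[OF w] T_sub_S[OF x] T_sub_S[OF y]] word_props(3)[OF w] by simp
        hence "g_word \<omega> x powr s * itp F (theta_word \<omega> x) \<le>
          (exp (s * M0_const \<gamma> \<Gamma> \<nu> * \<bar>x - y\<bar>) * g_word \<omega> y powr s) *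
          (exp ((\<kappa>2 * M - s * M0_const \<gamma> \<Gamma> \<nu>) * \<bar>x - y\<bar>) * itp F (theta_word \<omega> y))"
          using step[OF w x y] step[OF w x x] by (intro mult_mono) auto
        also have "\<dots> = (exp (s * M0_const \<gamma> \<Gamma> \<nu> * \<bar>x - y\<bar>) * exp ((\<kappa>2 * M - s * M0_const \<gamma> \<Gamma> \<nu>) * \<bar>x - y\<bar>))
            * (g_word \<omega> y powr s * itp F (theta_word \<omega> y))" by (simp only: mult_ac)
        also have "exp (s * M0_const \<gamma> \<Gamma> \<nu> * \<bar>x - y\<bar>) * exp ((\<kappa>2 * M - s * M0_const \<gamma> \<Gamma> \<nu>) * \<bar>x - y\<bar>)
            = exp (\<kappa>2 * M * \<bar>x - y\<bar>)"
          by (simp add: left_diff_distrib flip: exp_add)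
        finally show "g_word \<omega> x powr s * itp F (theta_word \<omega> x)
            \<le> exp (\<kappa>2 * M * \<bar>x - y\<bar>) * (g_word \<omega> y powr s * itp F (theta_word \<omega> y))" .
      qed
    qed
    fix x assume Fp: "\<And>y. y \<in> T \<Longrightarrow> 0 < F y" and x: "x \<in> T"
    show "0 < Ld F x"
      unfolding Ld_eq[OF x]
    proof (intro sum_pos finite_words words_ne mult_pos_pos)
      fix \<omega> assume w: "\<omega> \<in> words B \<nu>"
      show "0 < g_word \<omega> x powr s"
        using g_word_pos[OF word_props(1,2)[OF w], of x] S_pos(1)[OF T_sub_S[OF x]] by simp
      obtain i where i: "i \<in> {1..I}" "theta_word \<omega> ` S \<subseteq> {a i..b i}" using inv[OF w] by blast
      have tw: "theta_word \<omega> x \<in> {a i..b i}" using i(2) T_sub_S[OF x] by blast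
      define u where "u = M * eta r * hh i"
      have u1: "psi r * u * exp u < 1" using small[OF i(1) u_def] by simp
      obtain y where y: "y \<in> T" "(1 - psi r * u * exp u) * F y \<le> itp F (theta_word \<omega> x)"
        using itp_lower_bound[OF i(1) F M u_def u1 tw] by blast
      have "0 < (1 - psi r * u * exp u) * F y" using u1 Fp[OF y(1)] by simp
      thus "0 < itp F (theta_word \<omega> x)" using y(2) by linarith
    qed
  qed
  thus ?thesis by blast
qed

text \<open>Only the finitely many nodes of one piece and the point x are involved, so pointwise
  convergence of the approximants suffices. Both x and the shift minus \<gamma> are at least
  \<open>al\<close>, which explains \<open>chi\<close>.\<close>

lemma itp_eigenfunction_error:
  assumes v: "\<And>x. x \<in> S \<Longrightarrow> (\<lambda>n. G n x) \<longlonglongrightarrow> v x"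
    and G: "\<And>n. power_comb (2 * s) (\<gamma> + al) (\<Gamma> + be) (G n)"
    and h: "\<And>i. i \<in> {1..I} \<Longrightarrow> hh i \<le> h" and i: "i \<in> {1..I}" and x: "x \<in> {a i..b i}"
  shows "\<bar>itp v x - v x\<bar> \<le> G_const r s (chi \<gamma> \<Gamma>) h * h ^ Suc r * v x"
proof -
  obtain j where j: "j \<in> {1..N i}" "x \<in> {tt i (j - 1)..tt i j}" using find_piece[OF i x] by blast
  have x': "x \<in> {tt i (j - 1)..tt i (j - 1) + hh i}" using j tt_pred[of j i] by auto
  have xS: "x \<in> S" using sub[OF i] x by blast
  have ndS: "nd i j k \<in> S" if "k < Suc r" for k using T_sub_S[OF nd_in_T[OF i j(1)]] that by simp
  have "tt i (j - 1) \<in> {a i..b i}" using piece_sub[OF i j(1)] j(2) by auto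
  hence "al \<le> tt i (j - 1)" using sub[OF i] S_pos(2) by blast
  hence \<chi>: "0 < chi \<gamma> \<Gamma>" "chi \<gamma> \<Gamma> \<le> tt i (j - 1) + (\<gamma> + al)"
    using al_pos gam1 by (auto simp: chi_def)
  let ?l = "\<lambda>k. lagrange (Suc r) (piece_node r (tt i (j - 1)) (hh i)) k x"
  have "(\<lambda>n. \<bar>(\<Sum>k<Suc r. G n (nd i j k) * ?l k) - G n x\<bar>) \<longlonglongrightarrow> \<bar>(\<Sum>k<Suc r. v (nd i j k) * ?l k) - v x\<bar>"
    using v[OF ndS] v[OF xS] by (intro tendsto_intros) auto
  moreover have "(\<lambda>n. G_const r s (chi \<gamma> \<Gamma>) h * h ^ Suc r * G n x) \<longlonglongrightarrow> G_const r s (chi \<gamma> \<Gamma>) h * h ^ Suc r * v x"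
    using v[OF xS] by (intro tendsto_intros)
  moreover have "\<bar>(\<Sum>k<Suc r. G n (nd i j k) * ?l k) - G n x\<bar> \<le> G_const r s (chi \<gamma> \<Gamma>) h * h ^ Suc r * G n x" for n
    unfolding nd_eq by (rule power_comb_interpolation_error[OF G r hh_pos[OF i] h[OF i] s \<chi> x'])
  ultimately show ?thesis unfolding itp_eq_sum[OF i j] by (intro LIMSEQ_le) auto
qed

end

theorem theorem8p9:
  fixes B :: "real set" and \<gamma> \<Gamma> s \<kappa>1 \<kappa>2 M h \<mu> H h0 h1 lam R :: real
    and S :: "real set" and r \<nu> I :: nat
    and a b :: "nat \<Rightarrow> real" and N :: "nat \<Rightarrow> nat"
  assumes "finite B" and "B \<noteq> {}"
    and "\<gamma> = Min B" and "\<Gamma> = Max B" and "1 \<le> \<gamma>" and "\<gamma> < \<Gamma>"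
    and "S = S_interval \<gamma> \<Gamma>"
    and "2 \<le> r" and "1 \<le> chi \<gamma> \<Gamma>" and "0 < s" and "s \<le> 3 / 2"
    and "1 \<le> \<nu>" and "\<kappa>1 = kappa1 \<gamma> \<Gamma> \<nu> r" and "\<kappa>1 < 1" and "\<kappa>1 < \<kappa>2" and "\<kappa>2 < 1"
    and "M = M_const \<gamma> \<Gamma> \<nu> s \<kappa>1 \<kappa>2"
    \<comment> \<open>mesh\<close>
    and "1 \<le> I"
    and "\<And>i. i \<in> {1..I} \<Longrightarrow> a i < b i"
    and "\<And>i. i \<in> {1..I} \<Longrightarrow> {a i..b i} \<subseteq> S"
    and "\<And>i. i \<in> {1..<I} \<Longrightarrow> b i < a (i + 1)"
    and "\<And>\<omega>. \<omega> \<in> words B \<nu> \<Longrightarrow> \<exists>i\<in>{1..I}. theta_word \<omega> ` S \<subseteq> {a i..b i}"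
    and "\<And>i. i \<in> {1..I} \<Longrightarrow> 0 < N i"
    and "h = Max (mesh_h a b N ` {1..I})"
    and "\<mu> = h / Min (mesh_h a b N ` {1..I})"
    and "\<And>i. i \<in> {1..<I} \<Longrightarrow>
           2 * (sin (pi / (2 * real r + 2)))\<^sup>2 * mesh_h a b N i \<le> a (i + 1) - b i"
    \<comment> \<open>thresholds for the mesh size\<close>
    and "0 < h0"
    and "\<And>h' u. 0 < h' \<Longrightarrow> h' \<le> h0 \<Longrightarrow> u = M * eta r * h' \<Longrightarrow>
           psi r * u * exp u < 1 \<and>
           \<kappa>1 * exp u / (1 - psi r * u * exp u) < \<kappa>2 - s * M0_const \<gamma> \<Gamma> \<nu> / M"
    and "0 < h1"
    and "\<And>h'. 0 < h' \<Longrightarrow> h' \<le> h1 \<Longrightarrow>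
           2 + H_const r s (chi \<gamma> \<Gamma>) \<mu> h' * h' ^ r * (1 + h' ^ (2 * r + 2)) + h'\<^sup>2 \<le> 2 / (\<kappa>2 - \<kappa>1)"
    and "h \<le> min h0 (min h1 0.2)"
    and "H = H_const r s (chi \<gamma> \<Gamma>) \<mu> h" and "H * h ^ r < 1"
    and "lam = spec_radius S (L_op B s S)"
    and "R = spec_radius (mesh_T r I a b N) (L_disc B s \<nu> r I a b N)"
  shows "(inverse (1 + H * h ^ r) * R) powr (1 / real \<nu>) \<le> lam \<and>
         lam \<le> (inverse (1 - H * h ^ r) * R) powr (1 / real \<nu>)"
proof -
  interpret discretization B \<gamma> \<Gamma> s r I a b N \<nu>
    by unfold_locales (use assms in auto)
  have Seq: "S = S_interval \<gamma> \<Gamma>" by (rule assms(7))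
  \<comment> \<open>The log-Lipschitz constant of the eigenfunction, inherited from powers whose
    base is at least \<open>chi\<close>.\<close>
  define q where "q = 2 * s / chi \<gamma> \<Gamma>"
  have \<chi>: "1 \<le> chi \<gamma> \<Gamma>" by (rule assms(9))
  have s0: "0 < s" "s \<le> 3 / 2" by (rule assms(10,11))+
  have q: "0 < q" "q \<le> 3"
  proof -
    show "0 < q" using s0 \<chi> by (simp add: q_def)
    have "q \<le> 2 * s / 1" unfolding q_def using s0 \<chi> by (intro divide_left_mono) auto
    thus "q \<le> 3" using s0 by simp
  qed
  define hmin where "hmin = Min (mesh_h a b N ` {1..I})"
  have fI: "finite (mesh_h a b N ` {1..I})" "mesh_h a b N ` {1..I} \<noteq> {}" using I by auto
  have h_ge: "hh i \<le> h" and hmin_le: "hmin \<le> hh i" if "i \<in> {1..I}" for i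
    using that fI unfolding assms(24) hmin_def by auto
  have hmin0: "0 < hmin" unfolding hmin_def using fI hh_pos by (subst Min_gr_iff) auto
  have hmm: "hmin \<le> h" using h_ge[of 1] hmin_le[of 1] I by auto
  have h0: "0 < h" using hmin0 hmm by linarith
  have \<mu>: "\<mu> = h / hmin" "0 < \<mu>" using assms(25) hmin0 h0 by (auto simp: hmin_def)
  have hle: "h \<le> h0" "h \<le> h1" "h \<le> 1 / 5" using assms(31) by auto
  define m where "m = al + a_seq \<gamma> \<Gamma> (\<nu> - 1) + \<gamma>"
  have m0: "0 < m" using al_pos seq_nonneg[of "\<nu> - 1"] gam1 by (simp add: m_def)
  have m\<chi>: "m \<le> chi \<gamma> \<Gamma>" using seq_bounds[of "\<nu> - 1"] by (simp add: m_def chi_def)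
  have \<kappa>12: "0 < \<kappa>2 - \<kappa>1" using assms(15) by simp
  have Meq: "M = s * M0_const \<gamma> \<Gamma> \<nu> * (2 / (\<kappa>2 - \<kappa>1))" "s * M0_const \<gamma> \<Gamma> \<nu> = 2 * s / m"
    unfolding assms(17) M_const_def M0_const_def m_def by simp_all
  have M0: "0 < M" unfolding Meq using s0 m0 \<kappa>12 by simp
  have sin0: "0 < sin (pi / (2 * real r + 2))" by (rule phi_bounds(4)[OF r])
  define \<sigma> where "\<sigma> = (sin (pi / (2 * real r + 2)))\<^sup>2"
  have \<sigma>: "0 < \<sigma>" "\<sigma> \<le> 1 / 4" using sin0 phi_bounds(5)[OF r] by (auto simp: \<sigma>_def)
  define Gc where "Gc = G_const r s (chi \<gamma> \<Gamma>) h"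
  have Gc0: "0 < Gc"
    unfolding Gc_def G_const_def using s0 \<chi> phi_bounds(3)[OF r]
    by (intro mult_pos_pos divide_pos_pos prod_pos zero_less_power) auto
  have Heq: "H = \<mu> / \<sigma> * Gc / q"
    unfolding assms(32) H_const_def Gc_def[symmetric] \<sigma>_def q_def by (simp add: power_divide)
  have H0: "0 < H" unfolding Heq using \<mu>(2) \<sigma>(1) Gc0 q(1) by (intro mult_pos_pos divide_pos_pos)
  define t where "t = H * h ^ r"
  have t: "0 < t" "t < 1" using H0 h0 assms(33) by (auto simp: t_def)
  \<comment> \<open>The threshold for h1 yields 2 + h^2 \<le> 2/(\<kappa>2 - \<kappa>1); the other
    factor of \<open>M\<close> is 2s/m, and m \<le> chi because \<open>a_seq\<close> approaches its
    limit from below.\<close>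
  have Mq: "q * (2 + h\<^sup>2) \<le> M"
  proof -
    have "0 \<le> H * h ^ r * (1 + h ^ (2 * r + 2))" using H0 h0 by simp
    moreover have "2 + H * h ^ r * (1 + h ^ (2 * r + 2)) + h\<^sup>2 \<le> 2 / (\<kappa>2 - \<kappa>1)"
      using assms(30)[OF h0 hle(2)] unfolding assms(32) .
    ultimately have "2 + h\<^sup>2 \<le> 2 / (\<kappa>2 - \<kappa>1)" by linarith
    moreover have "q \<le> 2 * s / m" unfolding q_def using m\<chi> m0 s0 by (intro divide_left_mono) auto
    ultimately show ?thesis unfolding Meq using q m0 s0 by (intro mult_mono) auto
  qed
  have qM: "q < M"
  proof -
    have "q * 1 < q * (2 + h\<^sup>2)" using q by (intro mult_strict_left_mono) (auto simp: add_pos_nonneg)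
    thus ?thesis using Mq by simp
  qed
  have \<kappa>1: "0 \<le> \<kappa>1"
    unfolding assms(13) kappa1_def c_const_def using eta_pos[OF r] psi_ge_1[of r] r by simp
  obtain C where C: "cone_operator T Ld C M (\<kappa>2 * M)"
  proof -
    have "\<exists>C. cone_operator T Ld C M (\<kappa>2 * M)"
    proof (rule Ld_cone_operator[OF M0])
      show "0 \<le> \<kappa>2" "\<kappa>2 < 1" using \<kappa>1 \<kappa>12 assms(16) by auto
      \<comment> \<open>The threshold condition is instantiated with the width \<open>hh i\<close>
        of each interval.\<close>
      fix i u assume i: "i \<in> {1..I}" and u: "u = M * eta r * hh i"
      have "hh i \<le> h0" using h_ge[OF i] hle by simp
      from assms(28)[OF hh_pos[OF i] this u]
      show "psi r * u * exp u < 1 \<and>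
        kappa1 \<gamma> \<Gamma> \<nu> r * exp u / (1 - psi r * u * exp u) \<le> \<kappa>2 - s * M0_const \<gamma> \<Gamma> \<nu> / M"
        unfolding assms(13) by auto
    qed
    thus ?thesis using that by blast
  qed
  interpret D: cone_operator T Ld C M "\<kappa>2 * M" by (rule C)
  have one: "(\<lambda>_. 1) \<in> log_lip_cone T (\<kappa>2 * M)"
    using D.M'(1) by (intro log_lip_coneI) auto
  obtain x0 where x0: "x0 \<in> T" using T_ne by blast
  obtain F \<rho> where F: "0 < \<rho>" "F \<in> log_lip_cone T (\<kappa>2 * M)" "\<And>x. x \<in> T \<Longrightarrow> 0 < F x"
    "\<And>x. x \<in> T \<Longrightarrow> Ld F x = \<rho> * F x"
    using D.exists_eigenvector[OF one zero_less_one x0] by blast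
  have R: "R = \<rho>"
    unfolding assms(35) by (rule D.spec_radius_eq_finite[OF T_finite F(2,3,4,1)])
  obtain v lm G where lm: "0 < lm" "spec_radius (S_interval \<gamma> \<Gamma>) (L_op B s (S_interval \<gamma> \<Gamma>)) = lm"
    and v: "\<And>x. x \<in> S_interval \<gamma> \<Gamma> \<Longrightarrow> 0 < v x"
      "\<And>x. x \<in> S_interval \<gamma> \<Gamma> \<Longrightarrow> L_op B s (S_interval \<gamma> \<Gamma>) v x = lm * v x"
      "\<And>x. x \<in> S_interval \<gamma> \<Gamma> \<Longrightarrow> (\<lambda>n. G n x) \<longlonglongrightarrow> v x"
    and G: "\<And>n. power_comb (2 * s) (\<gamma> + al) (\<Gamma> + be) (G n)"
    using exists_eigenfunction by blast
  have lam: "lam = lm" unfolding assms(34) Seq by (rule lm(2))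
  define \<Lambda> where "\<Lambda> = lm ^ \<nu>"
  have \<Lambda>: "0 < \<Lambda>" using lm(1) by (simp add: \<Lambda>_def)
  have vT: "0 < v x" if "x \<in> T" for x using v(1) T_sub_S[OF that] by blast
  have vcone: "v \<in> log_lip_cone T q"
  proof (rule log_lip_coneI)
    show "continuous_on T v" using T_finite by (rule continuous_on_finite)
    show "0 \<le> v x" if "x \<in> T" for x using vT[OF that] by simp
    fix x y assume "x \<in> T" "y \<in> T"
    hence xy: "x \<in> S_interval \<gamma> \<Gamma>" "y \<in> S_interval \<gamma> \<Gamma>" using T_sub_S by auto
    have "G n x \<le> exp (q * \<bar>x - y\<bar>) * G n y" for n
      unfolding q_def using S_pos(2)[OF xy(1)] S_pos(2)[OF xy(2)] \<chi> s0
      by (intro power_comb_log_lip[OF G]) (auto simp: chi_def)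
    thus "v x \<le> exp (q * \<bar>x - y\<bar>) * v y"
      by (intro LIMSEQ_le[OF v(3)[OF xy(1)] tendsto_mult_left[OF v(3)[OF xy(2)]]]) auto
  qed
  \<comment> \<open>Half of q times the minimal node distance, the largest relative error that
    \<open>log_lip_cone_perturb\<close> admits.\<close>
  define \<epsilon> where "\<epsilon> = q * \<sigma> * hmin"
  have \<epsilon>0: "0 \<le> \<epsilon>" using q \<sigma> hmin0 by (simp add: \<epsilon>_def)
  have \<epsilon>h: "\<epsilon> \<le> h"
  proof -
    \<comment> \<open>Here s \<le> 3/2 and chi \<ge> 1 enter through q \<le> 3, and r \<ge> 2
      through \<sigma> \<le> 1/4.\<close>
    have "q * \<sigma> \<le> 3 * (1 / 4)" using q \<sigma> by (intro mult_mono) auto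
    hence "q * \<sigma> * hmin \<le> 1 * h" using hmm hmin0 by (intro mult_mono) auto
    thus ?thesis by (simp add: \<epsilon>_def)
  qed
  have \<epsilon>2: "\<epsilon>\<^sup>2 \<le> 2 / 3"
    using power_mono[of \<epsilon> "1 / 5" 2] \<epsilon>0 \<epsilon>h hle by (simp add: power2_eq_square)
  have spacing: "2 * \<epsilon> \<le> q * \<bar>x - y\<bar>" if xy: "x \<in> T" "y \<in> T" "x \<noteq> y" for x y
  proof -
    have sp: "2 * \<sigma> * hmin \<le> w - z" if "z \<in> T" "w \<in> T" "z < w" for z w
    proof (rule T_spacing[OF _ _ that])
      show "2 * \<sigma> * hmin \<le> 2 * (sin (pi / (2 * real r + 2)))\<^sup>2 * hh i" if "i \<in> {1..I}" for i
        unfolding \<sigma>_def using hmin_le[OF that] by (intro mult_left_mono) auto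
      show "2 * \<sigma> * hmin \<le> a (i + 1) - b i" if "i \<in> {1..<I}" for i
      proof -
        have "2 * \<sigma> * hmin \<le> 2 * \<sigma> * hh i" using hmin_le[of i] that \<sigma> by (intro mult_left_mono) auto
        thus ?thesis using assms(26)[OF that] by (simp add: \<sigma>_def)
      qed
    qed
    have "2 * \<sigma> * hmin \<le> \<bar>x - y\<bar>"
      using sp[of x y] sp[of y x] xy by (cases "x < y") auto
    from mult_left_mono[OF this, of q] q show ?thesis by (simp add: \<epsilon>_def mult_ac)
  qed
  \<comment> \<open>The identity behind the definition of \<open>H\<close>: one power of h is
    exchanged for hmin, at the price of \<mu>.\<close>
  have Gt: "Gc * h ^ Suc r = t * \<epsilon>"
    unfolding t_def Heq \<epsilon>_def \<mu>(1) using q \<sigma> hmin0 by (simp add: field_simps)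
  \<comment> \<open>The discretization error, scaled so that its relative size is \<epsilon> and t
    takes the role of the relative eigenvalue error.\<close>
  define E where "E x = (Ld v x - \<Lambda> * v x) / (t * \<Lambda>)" for x
  have E: "\<bar>E x\<bar> \<le> \<epsilon> * v x" if x: "x \<in> T" for x
  proof -
    have xS: "x \<in> S_interval \<gamma> \<Gamma>" by (rule T_sub_S[OF x])
    have iter: "\<Lambda> * v x = (\<Sum>\<omega>\<in>words B \<nu>. g_word \<omega> x powr s * v (theta_word \<omega> x))"
      unfolding \<Lambda>_def by (rule L_op_iterate[OF v(2) xS])
    have "\<bar>Ld v x - \<Lambda> * v x\<bar>
        = \<bar>\<Sum>\<omega>\<in>words B \<nu>. g_word \<omega> x powr s * (itp v (theta_word \<omega> x) - v (theta_word \<omega> x))\<bar>"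
      unfolding iter Ld_eq[OF x] sum_subtractf[symmetric] right_diff_distrib ..
    also have "\<dots> \<le> (\<Sum>\<omega>\<in>words B \<nu>. \<bar>g_word \<omega> x powr s * (itp v (theta_word \<omega> x) - v (theta_word \<omega> x))\<bar>)"
      by (rule sum_abs)
    also have "\<dots> \<le> (\<Sum>\<omega>\<in>words B \<nu>. g_word \<omega> x powr s * (t * \<epsilon> * v (theta_word \<omega> x)))"
    proof (rule sum_mono)
      fix \<omega> assume w: "\<omega> \<in> words B \<nu>"
      obtain i where i: "i \<in> {1..I}" "theta_word \<omega> ` S_interval \<gamma> \<Gamma> \<subseteq> {a i..b i}" using inv[OF w] by blast
      hence "theta_word \<omega> x \<in> {a i..b i}" using xS by blast
      hence "\<bar>itp v (theta_word \<omega> x) - v (theta_word \<omega> x)\<bar> \<le> t * \<epsilon> * v (theta_word \<omega> x)"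
        using itp_eigenfunction_error[OF v(3) G h_ge i(1)] unfolding Gc_def[symmetric] Gt by blast
      thus "\<bar>g_word \<omega> x powr s * (itp v (theta_word \<omega> x) - v (theta_word \<omega> x))\<bar>
          \<le> g_word \<omega> x powr s * (t * \<epsilon> * v (theta_word \<omega> x))"
        by (simp add: abs_mult mult_left_mono)
    qed
    also have "\<dots> = t * \<epsilon> * (\<Lambda> * v x)"
      unfolding iter sum_distrib_left by (intro sum.cong) auto
    finally show ?thesis unfolding E_def using t \<Lambda> by (simp add: abs_mult field_simps)
  qed
  \<comment> \<open>The perturbed functions v + E and v - E, multiplied by t \<Lambda>, are Ld v -
    (1 - t) \<Lambda> v and (1 + t) \<Lambda> v - Ld v. Their membership in the cone is what the
    eigenvalue comparison asks for.\<close>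
  have bounds: "(1 - t) * \<Lambda> \<le> \<rho>" "\<rho> \<le> (1 + t) * \<Lambda>"
  proof -
    note ev = D.eigenvalue_bounds[OF F(2,3,4,1) vcone vT less_imp_le[OF q(1)] qM]
    have pert: "(\<lambda>x. v x + e x) \<in> log_lip_cone T M" if "\<And>x. x \<in> T \<Longrightarrow> \<bar>e x\<bar> \<le> \<epsilon> * v x" for e
      using log_lip_cone_perturb[OF vcone T_finite _ that \<epsilon>0 \<epsilon>h \<epsilon>2 spacing Mq] q by auto
    have scale: "(\<lambda>x. t * \<Lambda> * f x + 0 * f x) \<in> log_lip_cone T M" if "f \<in> log_lip_cone T M" for f
      using that t \<Lambda> by (intro log_lip_cone_comb) auto
    have tE: "t * \<Lambda> * E x = Ld v x - \<Lambda> * v x" for x using t \<Lambda> by (simp add: E_def)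
    show "(1 - t) * \<Lambda> \<le> \<rho>"
    proof (rule ev(1))
      show "(\<lambda>x. Ld v x - (1 - t) * \<Lambda> * v x) \<in> log_lip_cone T M"
      proof (rule log_lip_cone_cong[OF scale[OF pert[of E]]])
        show "t * \<Lambda> * (v x + E x) + 0 * (v x + E x) = Ld v x - (1 - t) * \<Lambda> * v x" for x
          unfolding distrib_left tE by (simp add: algebra_simps)
      qed (rule E)
      show "0 \<le> (1 - t) * \<Lambda>" using t \<Lambda> by (intro mult_nonneg_nonneg) auto
    qed
    show "\<rho> \<le> (1 + t) * \<Lambda>"
    proof (rule ev(2))
      show "(\<lambda>x. (1 + t) * \<Lambda> * v x - Ld v x) \<in> log_lip_cone T M"
      proof (rule log_lip_cone_cong[OF scale[OF pert[of "\<lambda>x. - E x"]]])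
        show "t * \<Lambda> * (v x + - E x) + 0 * (v x + - E x) = (1 + t) * \<Lambda> * v x - Ld v x" for x
          unfolding distrib_left mult_minus_right tE by (simp add: algebra_simps)
      qed (use E in simp)
      show "0 < (1 + t) * \<Lambda>" using t \<Lambda> by (intro mult_pos_pos) auto
    qed
  qed
  have root: "\<Lambda> powr (1 / real \<nu>) = lm"
    unfolding \<Lambda>_def using lm(1) nu by (simp add: powr_powr flip: powr_realpow)
  have "inverse (1 + t) * R \<le> \<Lambda>" "\<Lambda> \<le> inverse (1 - t) * R"
    using bounds t R by (auto simp: field_simps)
  hence "(inverse (1 + t) * R) powr (1 / real \<nu>) \<le> \<Lambda> powr (1 / real \<nu>)"
    "\<Lambda> powr (1 / real \<nu>) \<le> (inverse (1 - t) * R) powr (1 / real \<nu>)"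
    using t \<Lambda> F(1) R by (auto intro!: powr_mono2)
  thus ?thesis unfolding root lam t_def by simp
qed

end
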